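(* Suppose that for each $N\ge 1$ the random variables $\{X_0^N(i)\}_{1\le i\le N}$ are independent with $P(X_0^N(i)=1)=\phi(i/N)=1-P(X_0^N(i)=0)$ for $1\le i\le N$, where $\phi\in C[0,1]$. Then for any $t\ge 0$ and any $f\in C[0,1]$, $$\lim_{N\to+\infty}\mu_t^N(f)=\mu_t(f)=\int_0^1\rho(t,u)f(u)\,du\quad\text{in } L^2,$$ where $\{\mu_t\}_{t\ge0}$ is the unique solution to the $(C[0,1])'$-valued ordinary differential equation $\frac{d}{dt}\mu_t=P_1^*\mu_t$ $(t\ge 0)$, $\mu_0(du)=\phi(u)\,du$, and $\{\rho(t,\cdot)\}_{t\ge 0}$ is the unique solution to the $C[0,1]$-valued ordinary differential equation $$\begin{cases}\frac{d}{dt}\rho(t,\cdot)=b(\cdot)(c(\cdot)-1)\rho(t,\cdot)+\rho(t,\cdot)\int_0^1\lambda(v,\cdot)(a_4(v,\cdot)-1)\,dv+\rho(t,\cdot)\int_0^1\lambda(\cdot,v)(a_1(\cdot,v)-1)\,dv\\ \qquad\qquad+\int_0^1\lambda(\cdot,v)a_2(\cdot,v)\rho(t,v)\,dv+\int_0^1\lambda(v,\cdot)a_3(v,\cdot)\rho(t,v)\,dv,\\ \rho(0,\cdot)=\phi.\end{cases}$$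
   Context: Fix non-negative functions $b,c\in C[0,1]$ and $\lambda,a_1,a_2,a_3,a_4\in C([0,1]\times[0,1])$. For each integer $N\ge1$, the $N$-urn linear system $\{X_t^N\}_{t\ge0}$ is the continuous-time Markov process with state space contained in $[0,+\infty)^N$ and generator $$\mathcal L_Nf(x)=\sum_{i=1}^N b\left(\tfrac iN\right)\left(f(x^{i,+})-f(x)\right)+\frac1N\sum_{i=1}^N\sum_{j\ne i}\lambda\left(\tfrac iN,\tfrac jN\right)\left(f(x^{(i,j)})-f(x)\right),$$ where, writing $x(k)$ for the $k$-th coordinate of $x$: $x^{i,+}(k)=x(k)$ for $k\ne i$ and $x^{i,+}(i)=c(\tfrac iN)x(i)$; and for $i\neq j$, $x^{(i,j)}(k)=x(k)$ for $k\ne i,j$, $x^{(i,j)}(i)=a_1(\tfrac iN,\tfrac jN)x(i)+a_2(\tfrac iN,\tfrac jN)x(j)$, $x^{(i,j)}(j)=a_3(\tfrac iN,\tfrac jN)x(i)+a_4(\tfrac iN,\tfrac jN)x(j)$. (That is, $x\to x^{i,+}$ at rate $b(\tfrac iN)$ and $x\to x^{(i,j)}$ at rate $\tfrac1N\lambda(\tfrac iN,\tfrac jN)$.) The empirical density field is $\mu_t^N=\frac1N\sum_{i=1}^NX_t^N(i)\delta_{i/N}$, so $\mu_t^N(f)=\frac1N\sum_{i=1}^NX_t^N(i)f(\tfrac iN)$ for $f\in C[0,1]$. $(C[0,1])'$ is the dual of $C[0,1]$ (sup norm $\|\cdot\|_\infty$) with the dual norm; the first ODE is understood in the dual norm, the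 second in $\|\cdot\|_\infty$. The operator $P_1:C[0,1]\to C[0,1]$ is $$P_1f(u)=b(u)(c(u)-1)f(u)+f(u)\int_0^1\lambda(u,v)(a_1(u,v)-1)\,dv+\int_0^1\lambda(u,v)a_3(u,v)f(v)\,dv+f(u)\int_0^1\lambda(v,u)(a_4(v,u)-1)\,dv+\int_0^1\lambda(v,u)f(v)a_2(v,u)\,dv,$$ and $(P_1^*\nu)(f)=\nu(P_1f)$ for $\nu\in(C[0,1])'$. *)

theory Defs
  imports "HOL-Probability.Probability"
begin

section \<open>The unit interval as a type, and the Banach space \<open>C[0,1]\<close>\<close>

typedef unit_interval = "{0..1::real}"
  morphisms point_of unit_point
  by (rule exI[of _ 0]) simp

setup_lifting type_definition_unit_interval

instantiation unit_interval :: metric_space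
begin

lift_definition dist_unit_interval :: "unit_interval \<Rightarrow> unit_interval \<Rightarrow> real" is dist .

definition uniformity_unit_interval :: "(unit_interval \<times> unit_interval) filter"
  where "uniformity_unit_interval = (INF e\<in>{0 <..}. principal {(x, y). dist x y < e})"

definition open_unit_interval :: "unit_interval set \<Rightarrow> bool"
  where "open_unit_interval S = (\<forall>x\<in>S. \<forall>\<^sub>F (x', y) in uniformity. x' = x \<longrightarrow> y \<in> S)"

instance
proof
  fix x y z :: unit_interval
  show "dist x y = 0 \<longleftrightarrow> x = y" by transfer simp
  show "dist x y \<le> dist x z + dist y z" by transfer (rule dist_triangle2)
qed (rule open_unit_interval_def uniformity_unit_interval_def)+

end

lemma continuous_on_unit_point: "continuous_on {0..1} unit_point"
  by (auto simp: continuous_on_iff dist_unit_interval.rep_eq unit_point_inverse)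

lemma range_unit_point: "unit_point ` {0..1} = UNIV"
proof -
  have "x \<in> unit_point ` {0..1}" for x
    using point_of[of x] point_of_inverse[of x] by (metis image_eqI)
  thus ?thesis by auto
qed

lemma compact_UNIV_unit_interval: "compact (UNIV :: unit_interval set)"
  using compact_continuous_image[OF continuous_on_unit_point compact_Icc] range_unit_point by simp

text \<open>All continuous functions on \<^typ>\<open>unit_interval\<close> are bounded, so the library space of bounded
  continuous functions with its supremum norm is \<open>C[0,1]\<close>; the space of bounded linear functionals
  with the operator norm is its dual. Likewise
  \<^typ>\<open>(unit_interval \<times> unit_interval) \<Rightarrow>\<^sub>C real\<close> is \<open>C([0,1] \<times> [0,1])\<close>.\<close>

type_synonym C01 = "unit_interval \<Rightarrow>\<^sub>C real"
type_synonym C01_dual = "C01 \<Rightarrow>\<^sub>L real"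
type_synonym C0101 = "(unit_interval \<times> unit_interval) \<Rightarrow>\<^sub>C real"

lemma continuous_imp_bcontfun:
  fixes g :: "unit_interval \<Rightarrow> real"
  assumes "continuous_on UNIV g"
  shows "g \<in> bcontfun"
  using assms compact_continuous_image[OF assms compact_UNIV_unit_interval]
  by (auto simp: bcontfun_def intro: compact_imp_bounded)

lemma continuous_on_bcontfun_compose [continuous_intros]:
  fixes f :: "'a::topological_space \<Rightarrow>\<^sub>C 'b::metric_space"
  assumes "continuous_on S g"
  shows "continuous_on S (\<lambda>x. apply_bcontfun f (g x))"
  by (rule continuous_on_compose2[OF continuous_on_apply_bcontfun[of UNIV f] assms]) simp

definition int01 :: "(unit_interval \<Rightarrow> real) \<Rightarrow> real"
  where "int01 g = integral {0..1} (\<lambda>v. g (unit_point v))"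

lemma integrable_unit_point:
  fixes g :: "unit_interval \<Rightarrow> real"
  assumes "continuous_on UNIV g"
  shows "(\<lambda>v. g (unit_point v)) integrable_on {0..1}"
  by (intro integrable_continuous_real continuous_on_compose2[OF assms continuous_on_unit_point]) simp

lemma int01_add:
  assumes "continuous_on UNIV f" "continuous_on UNIV g"
  shows "int01 (\<lambda>v. f v + g v) = int01 f + int01 g"
  unfolding int01_def
  by (rule integral_add) (use assms in \<open>auto intro: integrable_unit_point\<close>)

lemma int01_cmult: "int01 (\<lambda>v. r * f v) = r * int01 f"
  unfolding int01_def by simp

lemma int01_bound:
  assumes "continuous_on UNIV f" "\<And>v. \<bar>f v\<bar> \<le> K"
  shows "\<bar>int01 f\<bar> \<le> K"
proof -
  have "norm (integral {0..1} (\<lambda>v. f (unit_point v))) \<le> integral {0..1} (\<lambda>v::real. K)"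
    by (rule integral_norm_bound_integral) (use assms in \<open>auto intro: integrable_unit_point\<close>)
  thus ?thesis by (simp add: int01_def)
qed

lemma continuous_on_int01:
  assumes "continuous_on UNIV (\<lambda>(u, v). g u v)"
  shows "continuous_on UNIV (\<lambda>u::unit_interval. int01 (\<lambda>v. g u v))"
proof -
  have "continuous_on (UNIV \<times> cbox 0 1) (\<lambda>(u, v). g u (unit_point v))"
    unfolding case_prod_unfold
    by (rule continuous_on_compose2[OF assms[unfolded case_prod_unfold], where f = "\<lambda>p. (fst p, unit_point (snd p))", simplified])
       (intro continuous_intros continuous_on_compose2[OF continuous_on_unit_point], auto)
  from integral_continuous_on_param[OF this] show ?thesis
    by (simp add: int01_def)
qed

section \<open>The operators of the limiting equations\<close>

definition P1_fun :: "C01 \<Rightarrow> C01 \<Rightarrow> C0101 \<Rightarrow> C0101 \<Rightarrow> C0101 \<Rightarrow> C0101 \<Rightarrow> C0101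
    \<Rightarrow> C01 \<Rightarrow> unit_interval \<Rightarrow> real" where
  "P1_fun b c lam a1 a2 a3 a4 f u =
     b u * (c u - 1) * f u
     + f u * int01 (\<lambda>v. lam (u, v) * (a1 (u, v) - 1))
     + int01 (\<lambda>v. lam (u, v) * a3 (u, v) * f v)
     + f u * int01 (\<lambda>v. lam (v, u) * (a4 (v, u) - 1))
     + int01 (\<lambda>v. lam (v, u) * f v * a2 (v, u))"

definition P1 :: "C01 \<Rightarrow> C01 \<Rightarrow> C0101 \<Rightarrow> C0101 \<Rightarrow> C0101 \<Rightarrow> C0101 \<Rightarrow> C0101
    \<Rightarrow> C01 \<Rightarrow>\<^sub>L C01" where
  "P1 b c lam a1 a2 a3 a4 = Blinfun (\<lambda>f. Bcontfun (P1_fun b c lam a1 a2 a3 a4 f))"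

definition P1_adjoint :: "C01 \<Rightarrow> C01 \<Rightarrow> C0101 \<Rightarrow> C0101 \<Rightarrow> C0101 \<Rightarrow> C0101 \<Rightarrow> C0101
    \<Rightarrow> C01_dual \<Rightarrow> C01_dual" where
  "P1_adjoint b c lam a1 a2 a3 a4 \<nu> = \<nu> o\<^sub>L P1 b c lam a1 a2 a3 a4"

definition density_rhs_fun :: "C01 \<Rightarrow> C01 \<Rightarrow> C0101 \<Rightarrow> C0101 \<Rightarrow> C0101 \<Rightarrow> C0101 \<Rightarrow> C0101
    \<Rightarrow> C01 \<Rightarrow> unit_interval \<Rightarrow> real" where
  "density_rhs_fun b c lam a1 a2 a3 a4 r u =
     b u * (c u - 1) * r u
     + r u * int01 (\<lambda>v. lam (v, u) * (a4 (v, u) - 1))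
     + r u * int01 (\<lambda>v. lam (u, v) * (a1 (u, v) - 1))
     + int01 (\<lambda>v. lam (u, v) * a2 (u, v) * r v)
     + int01 (\<lambda>v. lam (v, u) * a3 (v, u) * r v)"

definition density_rhs :: "C01 \<Rightarrow> C01 \<Rightarrow> C0101 \<Rightarrow> C0101 \<Rightarrow> C0101 \<Rightarrow> C0101 \<Rightarrow> C0101
    \<Rightarrow> C01 \<Rightarrow> C01" where
  "density_rhs b c lam a1 a2 a3 a4 r = Bcontfun (density_rhs_fun b c lam a1 a2 a3 a4 r)"

text \<open>The element \<open>r(u) du\<close> of the dual of \<open>C[0,1]\<close>.\<close>

definition density_functional :: "C01 \<Rightarrow> C01_dual" where
  "density_functional r = Blinfun (\<lambda>f :: C01. int01 (\<lambda>u. r u * f u))"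

text \<open>The following lemmas show that the uses of \<^const>\<open>Blinfun\<close> and \<^const>\<open>Bcontfun\<close> above are
  legitimate, i.e. that the arguments are bounded linear and continuous, respectively.\<close>

lemma P1_fun_continuous: "continuous_on UNIV (P1_fun b c lam a1 a2 a3 a4 f)"
  unfolding P1_fun_def case_prod_unfold
  by (intro continuous_intros continuous_on_int01, simp_all add: case_prod_unfold)
     (intro continuous_intros)+

lemma density_rhs_fun_continuous: "continuous_on UNIV (density_rhs_fun b c lam a1 a2 a3 a4 r)"
  unfolding density_rhs_fun_def case_prod_unfold
  by (intro continuous_intros continuous_on_int01, simp_all add: case_prod_unfold)
     (intro continuous_intros)+

lemma density_rhs_apply:
  "apply_bcontfun (density_rhs b c lam a1 a2 a3 a4 r) u = density_rhs_fun b c lam a1 a2 a3 a4 r u"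
  by (simp add: density_rhs_def Bcontfun_inverse continuous_imp_bcontfun density_rhs_fun_continuous)

lemma abs_bcontfun_le_norm: "\<bar>apply_bcontfun f x\<bar> \<le> norm f" for f :: "'a::topological_space \<Rightarrow>\<^sub>C real"
  using norm_bounded[of f x] by simp

lemma bounded_linear_P1: "bounded_linear (\<lambda>f. Bcontfun (P1_fun b c lam a1 a2 a3 a4 f))"
proof -
  let ?P = "P1_fun b c lam a1 a2 a3 a4"
  have app: "apply_bcontfun (Bcontfun (?P f)) u = ?P f u" for f u
    by (simp add: Bcontfun_inverse continuous_imp_bcontfun P1_fun_continuous)
  define h1 where "h1 u = int01 (\<lambda>v. lam (u, v) * (a1 (u, v) - 1))" for u
  define h4 where "h4 u = int01 (\<lambda>v. lam (v, u) * (a4 (v, u) - 1))" for u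
  have h1: "\<bar>h1 u\<bar> \<le> norm lam * (norm a1 + 1)" for u
    unfolding h1_def
  proof (rule int01_bound)
    show "\<bar>lam (u, v) * (a1 (u, v) - 1)\<bar> \<le> norm lam * (norm a1 + 1)" for v
      using abs_bcontfun_le_norm[of lam "(u, v)"] abs_bcontfun_le_norm[of a1 "(u, v)"]
      by (simp add: abs_mult) (intro mult_mono, auto)
  qed (intro continuous_intros)
  have h4: "\<bar>h4 u\<bar> \<le> norm lam * (norm a4 + 1)" for u
    unfolding h4_def
  proof (rule int01_bound)
    show "\<bar>lam (v, u) * (a4 (v, u) - 1)\<bar> \<le> norm lam * (norm a4 + 1)" for v
      using abs_bcontfun_le_norm[of lam "(v, u)"] abs_bcontfun_le_norm[of a4 "(v, u)"]
      by (simp add: abs_mult) (intro mult_mono, auto)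
  qed (intro continuous_intros)
  have k3: "\<bar>int01 (\<lambda>v. lam (u, v) * a3 (u, v) * f v)\<bar> \<le> norm lam * norm a3 * norm f" for u and f :: C01
  proof (rule int01_bound)
    show "\<bar>lam (u, v) * a3 (u, v) * f v\<bar> \<le> norm lam * norm a3 * norm f" for v
      unfolding abs_mult by (intro mult_mono abs_bcontfun_le_norm mult_nonneg_nonneg) auto
  qed (intro continuous_intros)
  have k2: "\<bar>int01 (\<lambda>v. lam (v, u) * f v * a2 (v, u))\<bar> \<le> norm lam * norm f * norm a2" for u and f :: C01
  proof (rule int01_bound)
    show "\<bar>lam (v, u) * f v * a2 (v, u)\<bar> \<le> norm lam * norm f * norm a2" for v
      unfolding abs_mult by (intro mult_mono abs_bcontfun_le_norm mult_nonneg_nonneg) auto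
  qed (intro continuous_intros)
  have P: "?P f u = b u * (c u - 1) * f u + f u * h1 u + int01 (\<lambda>v. lam (u, v) * a3 (u, v) * f v)
     + f u * h4 u + int01 (\<lambda>v. lam (v, u) * f v * a2 (v, u))" for f u
    by (simp add: P1_fun_def h1_def h4_def)
  show ?thesis
  proof (rule bounded_linear_intro)
    fix f g :: C01
    have add3: "int01 (\<lambda>v. lam (u, v) * a3 (u, v) * (f v + g v)) =
      int01 (\<lambda>v. lam (u, v) * a3 (u, v) * f v) + int01 (\<lambda>v. lam (u, v) * a3 (u, v) * g v)" for u
      unfolding distrib_left by (intro int01_add continuous_intros)
    have add2: "int01 (\<lambda>v. lam (v, u) * (f v + g v) * a2 (v, u)) =
      int01 (\<lambda>v. lam (v, u) * f v * a2 (v, u)) + int01 (\<lambda>v. lam (v, u) * g v * a2 (v, u))" for u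
      unfolding distrib_left distrib_right by (intro int01_add continuous_intros)
    show "Bcontfun (?P (f + g)) = Bcontfun (?P f) + Bcontfun (?P g)"
      by (rule bcontfun_eqI, simp only: app P plus_bcontfun.rep_eq add2 add3)
         (simp only: distrib_left distrib_right ac_simps)
  next
    fix r :: real and f :: C01
    have s3: "int01 (\<lambda>v. lam (u, v) * a3 (u, v) * (r * f v)) =
      r * int01 (\<lambda>v. lam (u, v) * a3 (u, v) * f v)" for u
      by (subst int01_cmult[symmetric]) (simp add: mult_ac)
    have s2: "int01 (\<lambda>v. lam (v, u) * (r * f v) * a2 (v, u)) =
      r * int01 (\<lambda>v. lam (v, u) * f v * a2 (v, u))" for u
      by (subst int01_cmult[symmetric]) (simp add: mult_ac)
    show "Bcontfun (?P (r *\<^sub>R f)) = r *\<^sub>R Bcontfun (?P f)"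
      by (rule bcontfun_eqI, simp only: app P scaleR_bcontfun.rep_eq real_scaleR_def s2 s3)
         (simp only: distrib_left ac_simps)
  next
    fix f :: C01
    let ?K = "norm b * (norm c + 1) + norm lam * (norm a1 + 1) + norm lam * norm a3
      + norm lam * (norm a4 + 1) + norm lam * norm a2"
    show "norm (Bcontfun (?P f)) \<le> norm f * ?K"
    proof (rule norm_bound)
      fix u
      have c1: "\<bar>c u - 1\<bar> \<le> norm c + 1" using abs_bcontfun_le_norm[of c u] by linarith
      have "\<bar>b u * (c u - 1) * f u\<bar> \<le> norm b * (norm c + 1) * norm f"
        unfolding abs_mult by (intro mult_mono abs_bcontfun_le_norm c1 mult_nonneg_nonneg) auto
      moreover have "\<bar>f u * h1 u\<bar> \<le> norm f * (norm lam * (norm a1 + 1))"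
        unfolding abs_mult by (intro mult_mono abs_bcontfun_le_norm h1) auto
      moreover have "\<bar>f u * h4 u\<bar> \<le> norm f * (norm lam * (norm a4 + 1))"
        unfolding abs_mult by (intro mult_mono abs_bcontfun_le_norm h4) auto
      ultimately have "\<bar>?P f u\<bar> \<le> norm b * (norm c + 1) * norm f + norm f * (norm lam * (norm a1 + 1))
        + norm lam * norm a3 * norm f + norm f * (norm lam * (norm a4 + 1)) + norm lam * norm f * norm a2"
        unfolding P using k2[of u f] k3[of u f] by linarith
      also have "\<dots> = norm f * ?K" by (simp add: algebra_simps)
      finally show "norm (apply_bcontfun (Bcontfun (?P f)) u) \<le> norm f * ?K"
        by (simp add: app)
    qed
  qed
qed

lemma P1_apply:
  "apply_bcontfun (blinfun_apply (P1 b c lam a1 a2 a3 a4) f) u = P1_fun b c lam a1 a2 a3 a4 f u"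
  by (simp add: P1_def bounded_linear_Blinfun_apply bounded_linear_P1
      Bcontfun_inverse continuous_imp_bcontfun P1_fun_continuous)

lemma density_functional_apply:
  "blinfun_apply (density_functional r) f = int01 (\<lambda>u. r u * f u)"
proof -
  have "bounded_linear (\<lambda>f::C01. int01 (\<lambda>u. r u * f u))"
  proof (rule bounded_linear_intro[where K = "norm r"])
    fix f g :: C01
    show "int01 (\<lambda>u. r u * (f + g) u) = int01 (\<lambda>u. r u * f u) + int01 (\<lambda>u. r u * g u)"
      unfolding plus_bcontfun.rep_eq distrib_left by (intro int01_add continuous_intros)
  next
    fix k :: real and f :: C01
    show "int01 (\<lambda>u. r u * (k *\<^sub>R f) u) = k *\<^sub>R int01 (\<lambda>u. r u * f u)"
      by (simp add: int01_cmult[symmetric] mult_ac)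
  next
    fix f :: C01
    have "\<bar>r u * f u\<bar> \<le> norm f * norm r" for u
      unfolding abs_mult by (subst mult.commute) (intro mult_mono abs_bcontfun_le_norm, auto)
    thus "norm (int01 (\<lambda>u. r u * f u)) \<le> norm f * norm r"
      by (auto intro!: int01_bound continuous_intros)
  qed
  thus ?thesis by (simp add: density_functional_def bounded_linear_Blinfun_apply)
qed

section \<open>Initial value problems on \<open>[0,\<infinity>)\<close>\<close>

definition solves_ivp :: "('e::real_normed_vector \<Rightarrow> 'e) \<Rightarrow> 'e \<Rightarrow> (real \<Rightarrow> 'e) \<Rightarrow> bool" where
  "solves_ivp F x0 x \<longleftrightarrow>
     x 0 = x0 \<and> (\<forall>t\<ge>0. (x has_vector_derivative F (x t)) (at t within {0..}))"

text \<open>Solutions are curves on \<open>[0,\<infinity>)\<close>; their values at negative times carry no meaning.\<close>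

definition unique_ivp_solution :: "('e::real_normed_vector \<Rightarrow> 'e) \<Rightarrow> 'e \<Rightarrow> (real \<Rightarrow> 'e) \<Rightarrow> bool" where
  "unique_ivp_solution F x0 x \<longleftrightarrow>
     solves_ivp F x0 x \<and> (\<forall>y. solves_ivp F x0 y \<longrightarrow> (\<forall>t\<ge>0. y t = x t))"

section \<open>Markov processes in continuous time with a given generator\<close>

definition transition_semigroup :: "'s measure \<Rightarrow> (real \<Rightarrow> 's \<Rightarrow> 's measure) \<Rightarrow> bool" where
  "transition_semigroup S P \<longleftrightarrow>
     (\<forall>t\<ge>0. P t \<in> S \<rightarrow>\<^sub>M prob_algebra S) \<and>
     (\<forall>x\<in>space S. P 0 x = return S x) \<and>
     (\<forall>s\<ge>0. \<forall>t\<ge>0. \<forall>x\<in>space S. P (s + t) x = P s x \<bind> P t)"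

text \<open>The operator \<open>L\<close> is required to be the strong generator, with respect to the supremum norm, on
  all bounded measurable functions. This is appropriate for pure jump processes with bounded rates.\<close>

definition semigroup_generator ::
    "'s measure \<Rightarrow> (real \<Rightarrow> 's \<Rightarrow> 's measure) \<Rightarrow> (('s \<Rightarrow> real) \<Rightarrow> 's \<Rightarrow> real) \<Rightarrow> bool" where
  "semigroup_generator S P L \<longleftrightarrow>
     (\<forall>f\<in>borel_measurable S. bounded (f ` space S) \<longrightarrow>
        uniform_limit (space S) (\<lambda>t x. ((\<integral>y. f y \<partial>P t x) - f x) / t) (L f) (at_right 0))"

definition natural_filtration ::
    "'a measure \<Rightarrow> 's measure \<Rightarrow> (real \<Rightarrow> 'a \<Rightarrow> 's) \<Rightarrow> real \<Rightarrow> 'a measure" where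
  "natural_filtration M S X s =
     sigma (space M) {X u -` A \<inter> space M | u A. 0 \<le> u \<and> u \<le> s \<and> A \<in> sets S}"

definition markov_process ::
    "'a measure \<Rightarrow> 's measure \<Rightarrow> (real \<Rightarrow> 's \<Rightarrow> 's measure) \<Rightarrow> (real \<Rightarrow> 'a \<Rightarrow> 's) \<Rightarrow> bool" where
  "markov_process M S P X \<longleftrightarrow>
     prob_space M \<and> (\<forall>t\<ge>0. X t \<in> M \<rightarrow>\<^sub>M S) \<and>
     (\<forall>s\<ge>0. \<forall>t\<ge>0. \<forall>A\<in>sets S. AE \<omega> in M.
        real_cond_exp M (natural_filtration M S X s) (\<lambda>\<omega>. indicator A (X (s + t) \<omega>)) \<omega>
          = measure (P t (X s \<omega>)) A)"

definition markov_process_with_generator ::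
    "'a measure \<Rightarrow> 's measure \<Rightarrow> (('s \<Rightarrow> real) \<Rightarrow> 's \<Rightarrow> real) \<Rightarrow> (real \<Rightarrow> 'a \<Rightarrow> 's) \<Rightarrow> bool" where
  "markov_process_with_generator M S L X \<longleftrightarrow>
     (\<exists>P. transition_semigroup S P \<and> semigroup_generator S P L \<and> markov_process M S P X)"

section \<open>The \<open>N\<close>-urn linear system\<close>

text \<open>Urns are numbered \<open>1, \<dots>, N\<close>; a state is an extensional function on \<^term>\<open>{1..N}\<close> with
  values in \<open>[0,\<infinity>)\<close>.\<close>

definition urn_states :: "nat \<Rightarrow> (nat \<Rightarrow> real) measure" where
  "urn_states N = (\<Pi>\<^sub>M i\<in>{1..N}. restrict_space borel {0..})"

definition grid :: "nat \<Rightarrow> nat \<Rightarrow> unit_interval" where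
  "grid N i = unit_point (real i / real N)"

definition single_jump :: "C01 \<Rightarrow> nat \<Rightarrow> nat \<Rightarrow> (nat \<Rightarrow> real) \<Rightarrow> nat \<Rightarrow> real" where
  "single_jump c N i x = x(i := c (grid N i) * x i)"

definition pair_jump :: "C0101 \<Rightarrow> C0101 \<Rightarrow> C0101 \<Rightarrow> C0101 \<Rightarrow> nat \<Rightarrow> nat \<Rightarrow> nat
    \<Rightarrow> (nat \<Rightarrow> real) \<Rightarrow> nat \<Rightarrow> real" where
  "pair_jump a1 a2 a3 a4 N i j x =
     x(i := a1 (grid N i, grid N j) * x i + a2 (grid N i, grid N j) * x j,
       j := a3 (grid N i, grid N j) * x i + a4 (grid N i, grid N j) * x j)"

definition urn_generator :: "C01 \<Rightarrow> C01 \<Rightarrow> C0101 \<Rightarrow> C0101 \<Rightarrow> C0101 \<Rightarrow> C0101 \<Rightarrow> C0101 \<Rightarrow> nat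
    \<Rightarrow> ((nat \<Rightarrow> real) \<Rightarrow> real) \<Rightarrow> (nat \<Rightarrow> real) \<Rightarrow> real" where
  "urn_generator b c lam a1 a2 a3 a4 N f x =
     (\<Sum>i\<in>{1..N}. b (grid N i) * (f (single_jump c N i x) - f x))
     + 1 / real N * (\<Sum>i\<in>{1..N}. \<Sum>j\<in>{1..N} - {i}.
         lam (grid N i, grid N j) * (f (pair_jump a1 a2 a3 a4 N i j x) - f x))"

definition empirical_density :: "nat \<Rightarrow> (nat \<Rightarrow> real) \<Rightarrow> C01 \<Rightarrow> real" where
  "empirical_density N x f = 1 / real N * (\<Sum>i\<in>{1..N}. x i * f (grid N i))"

text \<open>Since the systems for different \<open>N\<close> may live on different probability spaces, convergence in
  \<open>L\<^sup>2\<close> is to a constant. Square integrability is demanded explicitly, because the Bochner integral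
  of a non-integrable function is \<open>0\<close>.\<close>

definition tendsto_L2 :: "(nat \<Rightarrow> 'a measure) \<Rightarrow> (nat \<Rightarrow> 'a \<Rightarrow> real) \<Rightarrow> real \<Rightarrow> bool" where
  "tendsto_L2 M Y y \<longleftrightarrow>
     (\<forall>N\<ge>1. Y N \<in> borel_measurable (M N) \<and> integrable (M N) (\<lambda>\<omega>. (Y N \<omega>)\<^sup>2)) \<and>
     (\<lambda>N. \<integral>\<omega>. (Y N \<omega> - y)\<^sup>2 \<partial>M N) \<longlonglongrightarrow> 0"

end

theory Submission
  imports Defs
begin

text \<open>For \<open>g\<close> in \<open>C[0,1]\<close> write \<open>S g x = (1/N) \<Sum> x(i) g(i/N)\<close>, so that \<open>\<mu>\<^sup>N\<^sub>t(g) = S g (X\<^sub>t)\<close>. The generator maps the linear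
  statistic \<open>S g\<close> to the linear statistic of a function which is \<open>P1 g\<close> with its integrals replaced by Riemann sums
  over the grid (lemmas \<open>generator_empirical_density\<close> and \<open>discrete_drift_tendsto\<close>). Fix \<open>t\<close> and \<open>f\<close> and evolve the test
  function backwards, \<open>\<gamma> s = exp ((t - s) P1) f\<close>. Then \<open>S (\<gamma> s) (X\<^sub>s)\<close> has almost no drift: it starts at
  \<open>S (exp (t P1) f) (X\<^sub>0)\<close>, which by the law of large numbers for the independent initial values is close to the number
  \<open>m = \<integral> \<phi> \<cdot> exp (t P1) f = \<mu>\<^sub>t(f)\<close>, and it ends at \<open>\<mu>\<^sup>N\<^sub>t(f)\<close>.

  To make this precise, the mean square distance \<open>w(s) = E (S (\<gamma> s) (X\<^sub>s) - m)\<^sup>2\<close> is differentiated in \<open>s\<close>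
  (lemma \<open>squared_error_bound\<close>). Its derivative has two parts. The first contains the drift error, which tends to \<open>0\<close>
  uniformly in time and position. The second is the quadratic variation of \<open>S (\<gamma> s)\<close>, of order \<open>1/N\<close> because a jump
  changes an average over \<open>N\<close> urns only by a quantity of order \<open>1/N\<close>. Both are multiplied by the empirical second moment
  \<open>(1/N) \<Sum> x(i)\<^sup>2\<close>, whose expectation is bounded uniformly in \<open>N\<close> by Gronwall's inequality (lemma \<open>sq_moment\<close>).
  Hence \<open>w(t) \<le> w(0) + o(1)\<close>, and \<open>w(0)\<close> tends to \<open>0\<close>.

  The generator describes the process on bounded functions, whereas \<open>w\<close> involves quadratic ones. The evolution law is
  therefore first derived for bounded functions from the transition semigroup (lemma \<open>markov_generator_derivative\<close>), and
  then extended by truncation (lemma \<open>derivative_dominated\<close>), using that a jump multiplies the weight \<open>1 + \<Sum> x(i)\<^sup>2\<close>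
  by at most a constant.

  Both limiting equations are linear with bounded operators, so operator exponentials give existence and uniqueness
  (lemma \<open>unique_ivp_op_exp\<close>). The right-hand sides of the two equations are dual to each other by Fubini; so the
  functionals with density \<open>\<rho>(t)\<close> solve the equation for \<open>\<mu>\<close> and coincide with \<open>\<mu>\<^sub>t\<close> by uniqueness
  (lemma \<open>density_functional_op_exp\<close>).\<close>

section \<open>Exponentials of bounded operators and linear evolution equations\<close>

definition op_pow :: "('e::real_normed_vector \<Rightarrow>\<^sub>L 'e) \<Rightarrow> nat \<Rightarrow> ('e \<Rightarrow>\<^sub>L 'e)" where
  "op_pow A n = ((\<lambda>B. A o\<^sub>L B) ^^ n) id_blinfun"

definition op_exp :: "('e::real_normed_vector \<Rightarrow>\<^sub>L 'e) \<Rightarrow> real \<Rightarrow> ('e \<Rightarrow>\<^sub>L 'e)" where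
  "op_exp A t = (\<Sum>n. (t ^ n / fact n) *\<^sub>R op_pow A n)"

lemma op_pow_simps:
  "op_pow A 0 = id_blinfun" "op_pow A (Suc n) = A o\<^sub>L op_pow A n"
  by (simp_all add: op_pow_def)

lemma id_blinfun_compose: "id_blinfun o\<^sub>L A = A" "A o\<^sub>L id_blinfun = A"
  by (auto intro!: blinfun_eqI)

lemma op_pow_commute: "A o\<^sub>L op_pow A n = op_pow A n o\<^sub>L A"
  proof (induction n)
  case (Suc n)
  have "A o\<^sub>L (A o\<^sub>L op_pow A n) = A o\<^sub>L (op_pow A n o\<^sub>L A)" by (simp add: Suc)
  also have "\<dots> = (A o\<^sub>L op_pow A n) o\<^sub>L A" by (rule blinfun_eqI) simp
  finally show ?case by (simp add: op_pow_simps)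
qed (simp add: op_pow_simps id_blinfun_compose)

lemma norm_op_pow: "norm (op_pow A n) \<le> norm A ^ n"
proof (induction n)
  case 0
  show ?case by (simp add: op_pow_simps norm_blinfun_id_le)
next
  case (Suc n)
  have "norm (op_pow A (Suc n)) \<le> norm A * norm (op_pow A n)"
    by (simp add: op_pow_simps norm_blinfun_compose)
  also have "\<dots> \<le> norm A * norm A ^ n" by (intro mult_left_mono Suc) auto
  finally show ?case by simp
qed

lemma op_exp_term_bound:
  assumes "\<bar>t\<bar> \<le> T"
  shows "norm ((t ^ n / fact n) *\<^sub>R op_pow A n) \<le> inverse (fact n) * (T * norm A) ^ n"
proof -
  have "norm ((t ^ n / fact n) *\<^sub>R op_pow A n) = inverse (fact n) * (\<bar>t\<bar> ^ n * norm (op_pow A n))"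
    by (simp add: power_abs abs_mult divide_inverse)
  also have "\<dots> \<le> inverse (fact n) * (T ^ n * norm A ^ n)"
    using assms by (intro mult_left_mono mult_mono power_mono norm_op_pow) auto
  finally show ?thesis by (simp add: power_mult_distrib)
qed

text \<open>The Weierstrass test with the majorant series of \<open>exp (T \<cdot> \<parallel>A\<parallel>)\<close>. Uniformity on compact time intervals
  is what allows the series to be differentiated termwise.\<close>

lemma op_exp_uniform_limit:
  fixes A :: "'e::banach \<Rightarrow>\<^sub>L 'e"
  shows "uniform_limit {-T..T} (\<lambda>n t. \<Sum>k<n. (t ^ k / fact k) *\<^sub>R op_pow A k) (op_exp A) sequentially"
  unfolding op_exp_def
proof (rule Weierstrass_m_test)
  show "summable (\<lambda>n. inverse (fact n) * (T * norm A) ^ n)" by (rule summable_exp)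
  show "norm ((t ^ n / fact n) *\<^sub>R op_pow A n) \<le> inverse (fact n) * (T * norm A) ^ n"
    if "t \<in> {-T..T}" for n t
    using that by (intro op_exp_term_bound) auto
qed

lemma op_exp_sums:
  fixes A :: "'e::banach \<Rightarrow>\<^sub>L 'e"
  shows "(\<lambda>n. (t ^ n / fact n) *\<^sub>R op_pow A n) sums op_exp A t"
  unfolding sums_def
  by (rule tendsto_uniform_limitI[OF op_exp_uniform_limit[where T = "\<bar>t\<bar>"]]) auto

lemma op_exp_0: 
  fixes A :: "'e::banach \<Rightarrow>\<^sub>L 'e"
  shows "op_exp A 0 = id_blinfun"
proof -
  have "(\<lambda>n. (0 ^ n / fact n) *\<^sub>R op_pow A n) sums (((0::real) ^ 0 / fact 0) *\<^sub>R op_pow A 0)"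
    by (rule sums_finite[where N = "{0}", simplified sum.insert sum.empty, simplified]) auto
  thus ?thesis using op_exp_sums[of 0 A] sums_unique2 by (fastforce simp: op_pow_simps)
qed

lemma op_exp_commute:
  fixes A :: "'e::banach \<Rightarrow>\<^sub>L 'e"
  shows "A o\<^sub>L op_exp A t = op_exp A t o\<^sub>L A"
proof -
  have "(\<lambda>n. A o\<^sub>L ((t ^ n / fact n) *\<^sub>R op_pow A n)) sums (A o\<^sub>L op_exp A t)"
    by (rule bounded_linear.sums[OF bounded_bilinear.bounded_linear_right[OF bounded_bilinear_blinfun_compose] op_exp_sums])
  moreover have "(\<lambda>n. ((t ^ n / fact n) *\<^sub>R op_pow A n) o\<^sub>L A) sums (op_exp A t o\<^sub>L A)"
    by (rule bounded_linear.sums[OF bounded_bilinear.bounded_linear_left[OF bounded_bilinear_blinfun_compose] op_exp_sums])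
  ultimately show ?thesis
    by (simp add: op_pow_commute sums_unique2 bounded_bilinear.scaleR_left[OF bounded_bilinear_blinfun_compose]
      bounded_bilinear.scaleR_right[OF bounded_bilinear_blinfun_compose])
qed

text \<open>The derivative of the term of order \<open>k + 1\<close> is \<open>A\<close> composed with the term of order \<open>k\<close>. Hence the
  derivatives of the partial sums are \<open>A\<close> composed with partial sums of the same series, and they converge
  uniformly on every bounded time interval.\<close>

lemma op_exp_has_vector_derivative:
  fixes A :: "'e::banach \<Rightarrow>\<^sub>L 'e"
  shows "(op_exp A has_vector_derivative (A o\<^sub>L op_exp A t)) (at t within S)"
proof -
  define T where "T = \<bar>t\<bar> + 1"
  let ?S = "{-T..T}"
  define f where "f k t = (t ^ k / fact k) *\<^sub>R op_pow A k" for k and t :: real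
  define f' where "f' k t = (case k of 0 \<Rightarrow> 0 | Suc j \<Rightarrow> A o\<^sub>L f j t)" for k and t :: real
  have der: "(f k has_vector_derivative f' k t) (at t within ?S)" for k t
  proof (cases k)
    case 0
    thus ?thesis by (simp add: f_def[abs_def] f'_def)
  next
    case (Suc j)
    have "((\<lambda>t. t ^ Suc j / fact (Suc j)) has_real_derivative (t ^ j / fact j)) (at t within ?S)"
      by (rule derivative_eq_intros refl | simp add: fact_reduce)+ 
    from has_vector_derivative_scaleR[OF this has_vector_derivative_const]
    show ?thesis by (simp add: Suc f_def[abs_def] f'_def op_pow_simps bounded_bilinear.scaleR_right[OF bounded_bilinear_blinfun_compose])
  qed
  have sum': "(\<Sum>i<Suc n. f' i t) = A o\<^sub>L (\<Sum>i<n. f i t)" for n t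
    unfolding sum.lessThan_Suc_shift by (simp add: f'_def bounded_bilinear.sum_right[OF bounded_bilinear_blinfun_compose])
  have lim: "uniform_limit ?S (\<lambda>n t. \<Sum>k<n. f k t) (op_exp A) sequentially"
    using op_exp_uniform_limit[where T = T and A = A] by (simp add: f_def)
  have "\<exists>g. \<forall>x\<in>?S. (\<lambda>n. f n x) sums g x \<and>
      (g has_derivative (\<lambda>h. h *\<^sub>R (A o\<^sub>L op_exp A x))) (at x within ?S)"
  proof (rule has_derivative_series)
    show "convex ?S" by simp
    show "(f n has_derivative (\<lambda>h. h *\<^sub>R f' n x)) (at x within ?S)" for n x
      using der by (simp add: has_vector_derivative_def)
    show "(0::real) \<in> ?S" by (simp add: T_def)
    show "(\<lambda>n. f n 0) sums op_exp A 0" using op_exp_sums[of 0 A] by (simp add: f_def)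
    fix e :: real assume e: "e > 0"
    have "uniform_limit ?S (\<lambda>n t. A o\<^sub>L (\<Sum>k<n. f k t)) (\<lambda>t. A o\<^sub>L op_exp A t) sequentially"
      by (rule bounded_linear_uniform_limit_intros
          bounded_linear.uniform_limit[OF bounded_bilinear.bounded_linear_right[OF bounded_bilinear_blinfun_compose] lim])+
    hence "\<forall>\<^sub>F n in sequentially. \<forall>x\<in>?S. dist (A o\<^sub>L (\<Sum>k<n. f k x)) (A o\<^sub>L op_exp A x) < e"
      using e by (simp add: uniform_limit_iff)
    hence ev: "\<forall>\<^sub>F n in sequentially. \<forall>x\<in>?S. norm ((\<Sum>i<Suc n. f' i x) - (A o\<^sub>L op_exp A x)) < e"
      by (simp only: sum' dist_norm)
    have "\<forall>\<^sub>F n in sequentially. \<forall>x\<in>?S. \<forall>h. norm ((\<Sum>i<Suc n. h *\<^sub>R f' i x) - h *\<^sub>R (A o\<^sub>L op_exp A x)) \<le> e * norm h"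
      using ev
    proof eventually_elim
      case (elim n)
      show ?case
      proof (intro ballI allI)
        fix x h assume "x \<in> ?S"
        have "norm ((\<Sum>i<Suc n. h *\<^sub>R f' i x) - h *\<^sub>R (A o\<^sub>L op_exp A x))
            = \<bar>h\<bar> * norm ((\<Sum>i<Suc n. f' i x) - (A o\<^sub>L op_exp A x))"
          by (simp only: scaleR_right.sum[symmetric] scaleR_right_diff_distrib[symmetric] norm_scaleR)
        also have "\<dots> \<le> \<bar>h\<bar> * e" using elim \<open>x \<in> ?S\<close> by (intro mult_left_mono) (auto intro: less_imp_le)
        finally show "norm ((\<Sum>i<Suc n. h *\<^sub>R f' i x) - h *\<^sub>R (A o\<^sub>L op_exp A x)) \<le> e * norm h"
          by (simp add: mult.commute)
      qed
    qed
    thus "\<forall>\<^sub>F n in sequentially. \<forall>x\<in>?S. \<forall>h. norm ((\<Sum>i<n. h *\<^sub>R f' i x) - h *\<^sub>R (A o\<^sub>L op_exp A x)) \<le> e * norm h"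
      by (rule eventually_sequentially_Suc[THEN iffD1])
  qed
  then obtain g where g: "\<And>x. x \<in> ?S \<Longrightarrow> (\<lambda>n. f n x) sums g x"
    "\<And>x. x \<in> ?S \<Longrightarrow> (g has_vector_derivative (A o\<^sub>L op_exp A x)) (at x within ?S)"
    unfolding has_vector_derivative_def by blast
  have "g x = op_exp A x" if "x \<in> ?S" for x
    using g(1)[OF that] op_exp_sums[of x A] by (simp add: f_def sums_unique2)
  hence "(op_exp A has_vector_derivative (A o\<^sub>L op_exp A t)) (at t within ?S)"
    by (intro has_vector_derivative_transform[OF _ _ g(2)]) (auto simp: T_def)
  moreover have "at t within ?S = at t" by (rule at_within_Icc_at) (auto simp: T_def)
  ultimately show ?thesis by (auto intro: has_vector_derivative_at_within)
qed

lemma op_exp_solves: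
  fixes A :: "'e::banach \<Rightarrow>\<^sub>L 'e"
  shows "solves_ivp A x0 (\<lambda>t. op_exp A t x0)"
  unfolding solves_ivp_def
proof (intro conjI allI impI)
  fix t :: real
  show "((\<lambda>t. op_exp A t x0) has_vector_derivative A (op_exp A t x0)) (at t within {0..})"
    using bounded_linear.has_vector_derivative[OF blinfun.bounded_linear_left op_exp_has_vector_derivative[of A t "{0..}"], of x0]
    by simp
qed (simp add: op_exp_0)

lemma op_exp_backwards_derivative:
  fixes A :: "'e::banach \<Rightarrow>\<^sub>L 'e"
  shows "((\<lambda>s. op_exp A (T - s)) has_vector_derivative - (A o\<^sub>L op_exp A (T - s))) (at s within S)"
proof -
  have "((\<lambda>s. T - s) has_vector_derivative - 1) (at s within S)"
    by (auto intro!: derivative_eq_intros simp: has_vector_derivative_def)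
  from vector_diff_chain_within[OF this op_exp_has_vector_derivative]
  show ?thesis by (simp add: o_def)
qed

text \<open>Uniqueness without a Gronwall estimate: transporting a solution \<open>y\<close> backwards, the curve
  \<open>s \<mapsto> exp ((T - s) A) (y s)\<close> has derivative zero on \<open>[0, T]\<close>, because \<open>A\<close> commutes with its exponential;
  its values at the two ends are \<open>exp (T A) x0\<close> and \<open>y T\<close>.\<close>

lemma solves_ivp_eq_op_exp:
  fixes A :: "'e::banach \<Rightarrow>\<^sub>L 'e"
  assumes y: "solves_ivp A x0 y" and T: "T \<ge> 0"
  shows "y T = op_exp A T x0"
proof -
  have "((\<lambda>s. op_exp A (T - s) (y s)) has_vector_derivative 0) (at s within {0..T})" if "s \<in> {0..T}" for s
  proof -
    have y': "(y has_vector_derivative A (y s)) (at s within {0..T})"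
      using y that unfolding solves_ivp_def
      by (auto intro: has_vector_derivative_within_subset[where S="{0..}"])
    from bounded_bilinear.has_vector_derivative[OF bounded_bilinear_blinfun_apply op_exp_backwards_derivative y', of A T]
    show ?thesis by (simp add: op_exp_commute blinfun.minus_left)
  qed
  then obtain k where k: "\<And>s. s \<in> {0..T} \<Longrightarrow> op_exp A (T - s) (y s) = k"
    using has_vector_derivative_zero_constant[of "{0..T}"] by auto
  from k[of T] k[of 0] T y show ?thesis by (simp add: op_exp_0 solves_ivp_def)
qed

lemma unique_ivp_op_exp:
  fixes A :: "'e::banach \<Rightarrow>\<^sub>L 'e"
  shows "unique_ivp_solution A x0 (\<lambda>t. op_exp A t x0)"
  unfolding unique_ivp_solution_def using op_exp_solves solves_ivp_eq_op_exp by blast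

section \<open>Duality of the two limiting equations\<close>

lemma int01_swap:
  assumes "continuous_on UNIV (\<lambda>(u, v). g u v)"
  shows "int01 (\<lambda>u. int01 (\<lambda>v. g u v)) = int01 (\<lambda>v. int01 (\<lambda>u. g u v))"
proof -
  have "continuous_on (cbox (0, 0) (1, 1)) (\<lambda>(x, y). g (unit_point x) (unit_point y))"
    unfolding case_prod_unfold
    by (rule continuous_on_compose2[OF assms[unfolded case_prod_unfold],
          where f = "\<lambda>p. (unit_point (fst p), unit_point (snd p))", simplified])
       (intro continuous_intros continuous_on_compose2[OF continuous_on_unit_point],
         auto simp: cbox_Pair_eq)
  from integral_swap_continuous[OF this] show ?thesis by (simp add: int01_def)
qed

text \<open>The multiplication terms of the two operators agree, and the integral terms are exchanged by Fubini.\<close>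

lemma int01_density_rhs_dual:
  fixes b c r f :: C01 and lam a1 a2 a3 a4 :: C0101
  shows "int01 (\<lambda>u. density_rhs_fun b c lam a1 a2 a3 a4 r u * f u)
       = int01 (\<lambda>u. r u * P1_fun b c lam a1 a2 a3 a4 f u)"
proof -
  define h where "h u = (b u * (c u - 1) + int01 (\<lambda>v. lam (v, u) * (a4 (v, u) - 1))
      + int01 (\<lambda>v. lam (u, v) * (a1 (u, v) - 1))) * r u * f u" for u
  have cont_int: "continuous_on UNIV (\<lambda>u. int01 (\<lambda>v. g u v))"
    if "continuous_on UNIV (\<lambda>p. g (fst p) (snd p))" for g :: "unit_interval \<Rightarrow> unit_interval \<Rightarrow> real"
    using that continuous_on_int01[of g] by (simp add: case_prod_unfold)
  have h: "continuous_on UNIV h"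
    unfolding h_def by (intro continuous_intros cont_int)
  let ?A = "\<lambda>u v. lam (u, v) * a2 (u, v) * r v * f u"
  let ?B = "\<lambda>u v. lam (v, u) * a3 (v, u) * r v * f u"
  have A: "int01 (\<lambda>u. int01 (\<lambda>v. ?A u v)) = int01 (\<lambda>u. int01 (\<lambda>v. ?A v u))"
    by (rule int01_swap) (simp add: case_prod_unfold, intro continuous_intros)
  have B: "int01 (\<lambda>u. int01 (\<lambda>v. ?B u v)) = int01 (\<lambda>u. int01 (\<lambda>v. ?B v u))"
    by (rule int01_swap) (simp add: case_prod_unfold, intro continuous_intros)
  have lhs: "density_rhs_fun b c lam a1 a2 a3 a4 r u * f u
      = h u + int01 (\<lambda>v. ?A u v) + int01 (\<lambda>v. ?B u v)" for u
  proof -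
    have "int01 (\<lambda>v. ?A u v) = f u * int01 (\<lambda>v. lam (u, v) * a2 (u, v) * r v)"
      "int01 (\<lambda>v. ?B u v) = f u * int01 (\<lambda>v. lam (v, u) * a3 (v, u) * r v)"
      by (simp_all add: int01_cmult[symmetric] mult_ac)
    thus ?thesis by (simp add: h_def density_rhs_fun_def algebra_simps)
  qed
  have rhs: "r u * P1_fun b c lam a1 a2 a3 a4 f u
      = h u + int01 (\<lambda>v. ?A v u) + int01 (\<lambda>v. ?B v u)" for u
  proof -
    have "int01 (\<lambda>v. ?A v u) = r u * int01 (\<lambda>v. lam (v, u) * f v * a2 (v, u))"
      "int01 (\<lambda>v. ?B v u) = r u * int01 (\<lambda>v. lam (u, v) * a3 (u, v) * f v)"
      by (simp_all add: int01_cmult[symmetric] mult_ac)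
    thus ?thesis by (simp add: h_def P1_fun_def algebra_simps)
  qed
  have "int01 (\<lambda>u. h u + int01 (\<lambda>v. ?A u v) + int01 (\<lambda>v. ?B u v))
      = int01 h + int01 (\<lambda>u. int01 (\<lambda>v. ?A u v)) + int01 (\<lambda>u. int01 (\<lambda>v. ?B u v))"
    by (subst int01_add int01_add[of h], (intro continuous_intros h cont_int)+)+ simp
  moreover have "int01 (\<lambda>u. h u + int01 (\<lambda>v. ?A v u) + int01 (\<lambda>v. ?B v u))
      = int01 h + int01 (\<lambda>u. int01 (\<lambda>v. ?A v u)) + int01 (\<lambda>u. int01 (\<lambda>v. ?B v u))"
    by (subst int01_add int01_add[of h], (intro continuous_intros h cont_int)+)+ simp
  ultimately show ?thesis unfolding lhs rhs A B by simp
qed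

lemma density_functional_density_rhs:
  "density_functional (density_rhs b c lam a1 a2 a3 a4 r)
     = P1_adjoint b c lam a1 a2 a3 a4 (density_functional r)"
  by (rule blinfun_eqI)
     (simp add: P1_adjoint_def density_functional_apply density_rhs_apply P1_apply int01_density_rhs_dual)

text \<open>The density equation is driven by an operator of the same form, with the roles of \<open>a2\<close> and \<open>a3\<close>
  exchanged. It is therefore bounded and linear, and its solution is again an operator exponential.\<close>

lemma density_rhs_eq_P1: "density_rhs b c lam a1 a2 a3 a4 = P1 b c lam a1 a3 a2 a4"
  by (intro ext bcontfun_eqI) (simp add: density_rhs_apply P1_apply density_rhs_fun_def P1_fun_def mult_ac)

lemma bounded_linear_density_functional: "bounded_linear density_functional"
proof (rule bounded_linear_intro[where K = 1])
  fix r s :: C01 and k :: real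
  show "density_functional (r + s) = density_functional r + density_functional s"
  proof (rule blinfun_eqI)
    show "density_functional (r + s) f = (density_functional r + density_functional s) f" for f
      unfolding density_functional_apply plus_blinfun.rep_eq plus_bcontfun.rep_eq distrib_right
      by (intro int01_add continuous_intros)
  qed
  show "density_functional (k *\<^sub>R r) = k *\<^sub>R density_functional r"
    by (rule blinfun_eqI)
       (simp add: density_functional_apply scaleR_blinfun.rep_eq int01_cmult[symmetric] mult_ac)
  show "norm (density_functional r) \<le> norm r * 1"
  proof (rule norm_blinfun_bound)
    fix f :: C01
    have "\<bar>r u * f u\<bar> \<le> norm r * norm f" for u
      unfolding abs_mult by (intro mult_mono abs_bcontfun_le_norm) auto
    thus "norm (density_functional r f) \<le> norm r * 1 * norm f"
      by (auto simp: density_functional_apply intro!: int01_bound continuous_intros)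
  qed simp
qed

instance bcontfun :: (metric_space, banach) banach ..

text \<open>Precomposition with \<open>A\<close> is a bounded operator on the dual space, so uniqueness is an instance of the
  uniqueness for operator exponentials. The solution is the precomposition with \<open>exp (t A)\<close> because \<open>A\<close>
  commutes with its exponential.\<close>

lemma unique_ivp_adjoint:
  fixes A :: "'e::banach \<Rightarrow>\<^sub>L 'e" and \<nu> :: "'e \<Rightarrow>\<^sub>L real"
  shows "unique_ivp_solution (\<lambda>\<nu>. \<nu> o\<^sub>L A) \<nu> (\<lambda>t. \<nu> o\<^sub>L op_exp A t)"
proof -
  define B :: "('e \<Rightarrow>\<^sub>L real) \<Rightarrow>\<^sub>L ('e \<Rightarrow>\<^sub>L real)" where "B = Blinfun (\<lambda>\<nu>. \<nu> o\<^sub>L A)"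
  have B: "blinfun_apply B = (\<lambda>\<nu>. \<nu> o\<^sub>L A)"
    unfolding B_def
    by (rule bounded_linear_Blinfun_apply bounded_bilinear.bounded_linear_left bounded_bilinear_blinfun_compose)+
  have "solves_ivp B \<nu> (\<lambda>t. \<nu> o\<^sub>L op_exp A t)"
    unfolding solves_ivp_def
  proof (intro conjI allI impI)
    show "\<nu> o\<^sub>L op_exp A 0 = \<nu>" by (simp add: op_exp_0 id_blinfun_compose)
    fix t :: real
    have "((\<lambda>t. \<nu> o\<^sub>L op_exp A t) has_vector_derivative (\<nu> o\<^sub>L (A o\<^sub>L op_exp A t))) (at t within {0..})"
      by (rule bounded_linear.has_vector_derivative[OF
            bounded_bilinear.bounded_linear_right[OF bounded_bilinear_blinfun_compose]
            op_exp_has_vector_derivative])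
    moreover have "\<nu> o\<^sub>L (A o\<^sub>L op_exp A t) = (\<nu> o\<^sub>L op_exp A t) o\<^sub>L A"
      by (rule blinfun_eqI) (simp add: op_exp_commute)
    ultimately show "((\<lambda>t. \<nu> o\<^sub>L op_exp A t) has_vector_derivative B (\<nu> o\<^sub>L op_exp A t)) (at t within {0..})"
      by (simp add: B)
  qed
  moreover from this have "solves_ivp B \<nu> y \<Longrightarrow> t \<ge> 0 \<Longrightarrow> y t = \<nu> o\<^sub>L op_exp A t" for y t
    using solves_ivp_eq_op_exp[of B \<nu>] by metis
  ultimately show ?thesis unfolding unique_ivp_solution_def B by blast
qed

text \<open>By duality the functionals with density \<open>\<rho>(t)\<close> solve the adjoint equation, and this equation has only one
  solution.\<close>

lemma density_functional_op_exp:
  assumes "t \<ge> 0"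
  shows "density_functional (op_exp (P1 b c lam a1 a3 a2 a4) t \<phi>)
     = density_functional \<phi> o\<^sub>L op_exp (P1 b c lam a1 a2 a3 a4) t"
proof -
  let ?P = "P1 b c lam a1 a2 a3 a4" and ?Q = "P1 b c lam a1 a3 a2 a4"
  have "solves_ivp (\<lambda>\<nu>. \<nu> o\<^sub>L ?P) (density_functional \<phi>) (\<lambda>t. density_functional (op_exp ?Q t \<phi>))"
    unfolding solves_ivp_def
  proof (intro conjI allI impI)
    fix t :: real assume "t \<ge> 0"
    hence "((\<lambda>t. op_exp ?Q t \<phi>) has_vector_derivative ?Q (op_exp ?Q t \<phi>)) (at t within {0..})"
      using op_exp_solves[of ?Q \<phi>] by (simp add: solves_ivp_def)
    from bounded_linear.has_vector_derivative[OF bounded_linear_density_functional this]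
    show "((\<lambda>t. density_functional (op_exp ?Q t \<phi>)) has_vector_derivative
        density_functional (op_exp ?Q t \<phi>) o\<^sub>L ?P) (at t within {0..})"
      by (simp add: density_rhs_eq_P1[symmetric] density_functional_density_rhs P1_adjoint_def)
  qed (simp add: op_exp_0)
  thus ?thesis using unique_ivp_adjoint[of ?P "density_functional \<phi>"] assms
    by (simp add: unique_ivp_solution_def)
qed

section \<open>Uniform convergence of Riemann sums\<close>

text \<open>On each of the \<open>N\<close> cells the integrand differs from its value at the right end point by at most \<open>e\<close>, which
  contributes an error of at most \<open>e / N\<close> per cell.\<close>

lemma riemann_sum_error:
  fixes h :: "real \<Rightarrow> real"
  assumes N: "N \<ge> 1" and h: "continuous_on {0..1} h"
    and mod: "\<And>x y. x \<in> {0..1} \<Longrightarrow> y \<in> {0..1} \<Longrightarrow> \<bar>x - y\<bar> \<le> 1 / real N \<Longrightarrow> \<bar>h x - h y\<bar> \<le> e"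
  shows "\<bar>1 / real N * (\<Sum>j=1..N. h (real j / real N)) - integral {0..1} h\<bar> \<le> e"
proof -
  have part: "\<bar>1 / real N * (\<Sum>j=1..m. h (real j / real N)) - integral {0..real m / real N} h\<bar> \<le> e * (real m / real N)"
    if "m \<le> N" for m
    using that
  proof (induction m)
    case 0
    show ?case by simp
  next
    case (Suc m)
    define x y where "x = real m / real N" and "y = real (Suc m) / real N"
    have xy: "0 \<le> x" "x \<le> y" "y \<le> 1" "y - x = 1 / real N"
      using Suc.prems N by (auto simp: x_def y_def field_simps)
    have hxy: "h integrable_on {x..y}" and h0y: "h integrable_on {0..y}"
      using xy by (auto intro!: integrable_continuous_real continuous_on_subset[OF h])
    have split: "integral {0..y} h = integral {0..x} h + integral {x..y} h"
      using Henstock_Kurzweil_Integration.integral_combine[OF xy(1,2) h0y] by simp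
    have "norm (integral {x..y} (\<lambda>s. h y - h s)) \<le> integral {x..y} (\<lambda>s. e)"
      using xy hxy by (intro integral_norm_bound_integral) (auto intro!: mod integrable_diff)
    moreover have "integral {x..y} (\<lambda>s. h y - h s) = (y - x) * h y - integral {x..y} h"
      using xy hxy by (subst integral_diff) auto
    ultimately have "\<bar>(y - x) * h y - integral {x..y} h\<bar> \<le> e * (y - x)"
      using xy by (simp add: mult.commute)
    moreover have "\<bar>1 / real N * (\<Sum>j=1..m. h (real j / real N)) - integral {0..x} h\<bar> \<le> e * x"
      using Suc by (simp add: x_def)
    moreover have "1 / real N * (\<Sum>j=1..Suc m. h (real j / real N))
        = 1 / real N * (\<Sum>j=1..m. h (real j / real N)) + (y - x) * h y"
      unfolding xy(4) by (simp add: y_def distrib_left)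
    ultimately have "\<bar>1 / real N * (\<Sum>j=1..Suc m. h (real j / real N)) - integral {0..y} h\<bar> \<le> e * x + e * (y - x)"
      unfolding split by linarith
    thus ?case by (simp add: y_def algebra_simps)
  qed
  from part[of N] N show ?thesis by simp
qed

text \<open>One modulus of continuity serves all parameters in a compact set. The parameters will be pairs of a time and a
  position.\<close>

lemma riemann_sums_uniform:
  fixes F :: "'k::metric_space \<Rightarrow> unit_interval \<Rightarrow> real"
  assumes K: "compact K" and F: "continuous_on (K \<times> UNIV) (\<lambda>(k, v). F k v)" and e: "e > 0"
  shows "\<forall>\<^sub>F N in sequentially. \<forall>k\<in>K. \<bar>1 / real N * (\<Sum>j=1..N. F k (grid N j)) - int01 (F k)\<bar> \<le> e"
proof -
  have "uniformly_continuous_on (K \<times> UNIV) (\<lambda>(k, v). F k v)"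
    by (intro compact_uniformly_continuous F compact_Times K compact_UNIV_unit_interval)
  then obtain d where d: "d > 0" "\<And>k v w. k \<in> K \<Longrightarrow> dist v w < d \<Longrightarrow> \<bar>F k v - F k w\<bar> < e"
    using e unfolding uniformly_continuous_on_def by (force simp: dist_Pair_Pair dist_real_def)
  obtain N0 where N0: "1 / real N0 < d" "N0 > 0" 
    using d(1) by (metis nat_approx_posE of_nat_Suc zero_less_Suc)
  show ?thesis
  proof (rule eventually_sequentiallyI[of N0], rule ballI)
    fix N k assume N: "N \<ge> N0" and k: "k \<in> K"
    have "1 / real N \<le> 1 / real N0" using N N0 by (intro divide_left_mono) auto
    hence Nd: "1 / real N < d" using N0 by simp
    have Fk: "continuous_on UNIV (F k)"
      using continuous_on_compose2[OF F, of UNIV "\<lambda>v. (k, v)"] k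
        continuous_on_Pair[OF continuous_on_const continuous_on_id, of UNIV k] by auto
    show "\<bar>1 / real N * (\<Sum>j=1..N. F k (grid N j)) - int01 (F k)\<bar> \<le> e"
      unfolding int01_def grid_def
    proof (rule riemann_sum_error)
      show "1 \<le> N" using N N0 by simp
      show "continuous_on {0..1} (\<lambda>v. F k (unit_point v))"
        by (rule continuous_on_compose2[OF Fk continuous_on_unit_point]) simp
      fix x y :: real assume "x \<in> {0..1}" "y \<in> {0..1}" "\<bar>x - y\<bar> \<le> 1 / real N"
      thus "\<bar>F k (unit_point x) - F k (unit_point y)\<bar> \<le> e"
        using Nd by (intro less_imp_le d(2)[OF k])
          (auto simp: dist_unit_interval.rep_eq unit_point_inverse dist_real_def)
    qed
  qed
qed

lemma bounded_linear_apply_bcontfun: "bounded_linear (\<lambda>f :: 'a::topological_space \<Rightarrow>\<^sub>C real. apply_bcontfun f u)"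
  by (rule bounded_linear_intro[where K = 1]) (auto simp: abs_bcontfun_le_norm)

lemma continuous_on_apply_bcontfun_joint:
  fixes g :: "real \<Rightarrow> 'a::metric_space \<Rightarrow>\<^sub>C real"
  assumes "continuous_on S g"
  shows "continuous_on (S \<times> UNIV) (\<lambda>p. g (fst p) (snd p))"
  unfolding continuous_on_def
proof
  fix p assume p: "p \<in> S \<times> (UNIV :: 'a set)"
  let ?F = "at p within S \<times> (UNIV :: 'a set)"
  have g: "((\<lambda>q. g (fst q)) \<longlongrightarrow> g (fst p)) ?F"
  proof -
    have "continuous_on (S \<times> (UNIV :: 'a set)) (\<lambda>q. g (fst q))"
      by (rule continuous_on_compose2[OF assms]) (auto intro: continuous_intros)
    thus ?thesis using p by (auto simp: continuous_on_def)
  qed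
  have "((\<lambda>q. g (fst q) (snd q) - g (fst p) (snd q)) \<longlongrightarrow> 0) ?F"
  proof (rule Lim_null_comparison)
    show "((\<lambda>q. norm (g (fst q) - g (fst p))) \<longlongrightarrow> 0) ?F"
      using g by (intro tendsto_norm_zero) (simp add: LIM_zero_iff)
    show "\<forall>\<^sub>F q in ?F. norm (g (fst q) (snd q) - g (fst p) (snd q)) \<le> norm (g (fst q) - g (fst p))"
      using abs_bcontfun_le_norm[of "g (fst q) - g (fst p)" "snd q" for q]
      by (intro always_eventually allI) simp
  qed
  moreover have "((\<lambda>q. g (fst p) (snd q)) \<longlongrightarrow> g (fst p) (snd p)) ?F"
  proof -
    have "continuous_on (S \<times> (UNIV :: 'a set)) (\<lambda>q. g (fst p) (snd q))"
      by (intro continuous_intros)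
    thus ?thesis using p by (auto simp: continuous_on_def)
  qed
  ultimately show "((\<lambda>p. g (fst p) (snd p)) \<longlongrightarrow> g (fst p) (snd p)) ?F"
    using tendsto_add by fastforce
qed

section \<open>Evolution of expectations of bounded functions\<close>

lemma lebesgue_integral_abs_le:
  fixes f g :: "'s \<Rightarrow> real"
  assumes f: "integrable M f" and g: "integrable M g" and le: "\<And>x. x \<in> space M \<Longrightarrow> \<bar>f x\<bar> \<le> g x"
  shows "\<bar>\<integral>x. f x \<partial>M\<bar> \<le> (\<integral>x. g x \<partial>M)"
proof -
  have "\<bar>\<integral>x. f x \<partial>M\<bar> \<le> (\<integral>x. \<bar>f x\<bar> \<partial>M)" by (rule integral_abs_bound)
  also have "\<dots> \<le> (\<integral>x. g x \<partial>M)" using f by (intro integral_mono g le) auto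
  finally show ?thesis .
qed

text \<open>This is the measurability needed in order to integrate the conditional expectations that occur in the Markov
  property.\<close>

lemma natural_filtration_subalgebra:
  assumes "\<And>u. u \<ge> 0 \<Longrightarrow> X u \<in> M \<rightarrow>\<^sub>M S"
  shows "subalgebra M (natural_filtration M S X s)"
proof -
  have "{X u -` A \<inter> space M | u A. 0 \<le> u \<and> u \<le> s \<and> A \<in> sets S} \<subseteq> sets M"
    using assms by (auto intro: measurable_sets)
  moreover from this have "{X u -` A \<inter> space M | u A. 0 \<le> u \<and> u \<le> s \<and> A \<in> sets S} \<subseteq> Pow (space M)"
    using sets.space_closed by blast
  ultimately show ?thesis
    unfolding subalgebra_def natural_filtration_def by (simp add: sets.sigma_sets_subset)
qed

text \<open>Integrating the Markov property over the whole space removes the conditional expectation and leaves an identity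
  between one-dimensional laws.\<close>

lemma markov_process_law:
  assumes mp: "markov_process M S P X" and P: "P t \<in> S \<rightarrow>\<^sub>M prob_algebra S"
    and s: "s \<ge> 0" and t: "t \<ge> 0"
  shows "distr M S (X (s + t)) = distr M S (X s) \<bind> P t"
proof (rule measure_eqI)
  have "prob_space M" and X[measurable]: "\<And>t. t \<ge> 0 \<Longrightarrow> X t \<in> M \<rightarrow>\<^sub>M S"
    using mp by (auto simp: markov_process_def)
  interpret prob_space M by fact
  have ne: "space S \<noteq> {}" using measurable_space[OF X[OF s]] not_empty by auto
  have P'[measurable]: "P t \<in> S \<rightarrow>\<^sub>M subprob_algebra S" by (rule measurable_prob_algebraD[OF P])
  interpret D: prob_space "distr M S (X s)" using s by (intro prob_space_distr X)
  have Pt: "P t \<in> distr M S (X s) \<rightarrow>\<^sub>M subprob_algebra S" using P' by simp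
  have Xst: "X (s + t) \<in> M \<rightarrow>\<^sub>M S" using s t by (intro X) simp
  interpret D': prob_space "distr M S (X (s + t))" by (rule prob_space_distr[OF Xst])
  interpret B: subprob_space "distr M S (X s) \<bind> P t"
    by (rule subprob_space_bind[OF _ Pt]) unfold_locales
  show sets: "sets (distr M S (X (s + t))) = sets (distr M S (X s) \<bind> P t)"
    by (subst sets_bind[where N = S]) (use ne sets_kernel[OF P'] in auto)
  fix A assume "A \<in> sets (distr M S (X (s + t)))"
  hence A[measurable]: "A \<in> sets S" by simp
  let ?F = "natural_filtration M S X s"
  interpret F: finite_measure_subalgebra M ?F
    by unfold_locales (rule natural_filtration_subalgebra[OF X])
  have int: "integrable M (\<lambda>\<omega>. indicator A (X (s + t) \<omega>) :: real)"
    using Xst A by (intro integrable_const_bound[of _ 1]) (auto simp: indicator_def)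
  have pm: "(\<lambda>x. measure (P t x) A) \<in> borel_measurable S" by measurable
  have "measure (distr M S (X (s + t))) A = (\<integral>x. indicator A x \<partial>distr M S (X (s + t)))"
    using A by simp
  also have "\<dots> = (\<integral>\<omega>. indicator A (X (s + t) \<omega>) \<partial>M)"
    using Xst A by (intro integral_distr) auto
  also have "\<dots> = (\<integral>\<omega>. real_cond_exp M ?F (\<lambda>\<omega>. indicator A (X (s + t) \<omega>)) \<omega> \<partial>M)"
    using F.real_cond_exp_int(2)[OF int] by simp
  also have "\<dots> = (\<integral>\<omega>. measure (P t (X s \<omega>)) A \<partial>M)"
    using mp s t A
    by (intro integral_cong_AE measurable_compose[OF X[OF s] pm])
       (auto simp: markov_process_def)
  also have "\<dots> = (\<integral>x. measure (P t x) A \<partial>distr M S (X s))"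
    using X[OF s] pm by (simp add: integral_distr)
  also have "\<dots> = measure (distr M S (X s) \<bind> P t) A"
    using D.measure_bind[OF Pt A] by simp
  finally show "emeasure (distr M S (X (s + t))) A = emeasure (distr M S (X s) \<bind> P t) A"
    by (simp add: D'.emeasure_eq_measure B.emeasure_eq_measure)
qed

text \<open>The class of functions on which the generator is specified.\<close>

definition bdd_measurable :: "'s measure \<Rightarrow> ('s \<Rightarrow> real) \<Rightarrow> bool" where
  "bdd_measurable S f \<longleftrightarrow> f \<in> borel_measurable S \<and> bounded (f ` space S)"

lemma bdd_measurableE:
  assumes "bdd_measurable S f"
  obtains B where "B \<ge> 0" "\<And>x. x \<in> space S \<Longrightarrow> \<bar>f x\<bar> \<le> B"
  using assms unfolding bdd_measurable_def bounded_iff real_norm_def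
  by (metis abs_ge_zero image_eqI order_trans ex_in_conv linorder_linear)

lemma (in prob_space) bdd_measurable_integrable:
  assumes f: "bdd_measurable S f" and Y: "Y \<in> M \<rightarrow>\<^sub>M S"
  shows "integrable M (\<lambda>\<omega>. f (Y \<omega>))"
proof -
  obtain B where B: "\<And>x. x \<in> space S \<Longrightarrow> \<bar>f x\<bar> \<le> B" using bdd_measurableE[OF f] by metis
  show ?thesis
    using f Y measurable_space[OF Y] B
    by (intro integrable_const_bound[of _ B]) (auto simp: bdd_measurable_def)
qed

text \<open>Write \<open>E f(X t)\<close> for the expectation. By the law of \<open>X (s + h)\<close>,
  \<open>E f(X (s + h)) - E f(X s) = E (P h f - f)(X s)\<close>, and the generator property gives
  \<open>\<parallel>P h f - f - h \<cdot> L f\<parallel> \<le> e \<cdot> h\<close> for small \<open>h\<close> in the supremum norm. The increment is thus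
  \<open>h \<cdot> E L f(X s)\<close> up to \<open>e \<cdot> h\<close>, uniformly in \<open>s\<close>, which yields the right derivative. For the left derivative
  the starting point of the increment moves with \<open>h\<close>; the same estimate applied to \<open>L f\<close> shows that
  \<open>E L f(X s)\<close> is Lipschitz in \<open>s\<close>, so that the base point may be replaced by the limit.\<close>

lemma markov_generator_derivative:
  assumes gen: "markov_process_with_generator M S L X"
    and L: "\<And>f. bdd_measurable S f \<Longrightarrow> bdd_measurable S (L f)"
    and f: "bdd_measurable S f" and t: "t \<ge> 0"
  shows "((\<lambda>t. \<integral>\<omega>. f (X t \<omega>) \<partial>M) has_real_derivative (\<integral>\<omega>. L f (X t \<omega>) \<partial>M)) (at t within {0..})"
proof -
  obtain P where P: "transition_semigroup S P" "semigroup_generator S P L" and mp: "markov_process M S P X"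
    using gen by (auto simp: markov_process_with_generator_def)
  have "prob_space M" and X: "\<And>t. t \<ge> 0 \<Longrightarrow> X t \<in> M \<rightarrow>\<^sub>M S"
    using mp by (auto simp: markov_process_def)
  interpret prob_space M by fact
  have increment: "\<exists>d>0. \<forall>h s. 0 < h \<longrightarrow> h < d \<longrightarrow> 0 \<le> s \<longrightarrow>
      \<bar>(\<integral>\<omega>. g (X (s + h) \<omega>) \<partial>M) - (\<integral>\<omega>. g (X s \<omega>) \<partial>M) - h * (\<integral>\<omega>. L g (X s \<omega>) \<partial>M)\<bar> \<le> e * h"
    if g: "bdd_measurable S g" and e: "e > 0" for g e
  proof -
    obtain B where B: "\<And>x. x \<in> space S \<Longrightarrow> \<bar>g x\<bar> \<le> B" using bdd_measurableE[OF g] by metis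
    have gm[measurable]: "g \<in> borel_measurable S" using g by (simp add: bdd_measurable_def)
    have "\<forall>\<^sub>F h in at_right 0. \<forall>x\<in>space S. dist (((\<integral>y. g y \<partial>P h x) - g x) / h) (L g x) < e"
      using P(2) g e unfolding semigroup_generator_def bdd_measurable_def uniform_limit_iff by blast
    then obtain d where d: "d > 0" "\<And>h x. 0 < h \<Longrightarrow> h < d \<Longrightarrow> x \<in> space S \<Longrightarrow>
        \<bar>((\<integral>y. g y \<partial>P h x) - g x) / h - L g x\<bar> < e"
      unfolding eventually_at_right_field dist_real_def by auto
    show ?thesis
    proof (intro exI[of _ d] conjI allI impI d(1))
      fix h s :: real assume h: "0 < h" "h < d" and s: "0 \<le> s"
      have Ph: "P h \<in> S \<rightarrow>\<^sub>M prob_algebra S" using P(1) h by (simp add: transition_semigroup_def)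
      have Ph'[measurable]: "P h \<in> S \<rightarrow>\<^sub>M subprob_algebra S" by (rule measurable_prob_algebraD[OF Ph])
      define T where "T x = (\<integral>y. g y \<partial>P h x)" for x
      have T_meas: "T \<in> borel_measurable S"
        unfolding T_def by (rule measurable_compose[OF Ph' integral_measurable_subprob_algebra[OF gm]])
      have T_bd: "\<bar>T x\<bar> \<le> B" if x: "x \<in> space S" for x
      proof -
        have "P h x \<in> space (prob_algebra S)" using measurable_space[OF Ph x] .
        hence px: "prob_space (P h x)" and sx: "sets (P h x) = sets S" by (auto simp: space_prob_algebra)
        interpret px: prob_space "P h x" by fact
        have spx: "space (P h x) = space S" using sx by (rule sets_eq_imp_space_eq)
        have gi: "integrable (P h x) g"
          using B sx by (intro px.integrable_const_bound[of _ B]) (auto simp: spx cong: measurable_cong_sets)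
        have "T x \<le> (\<integral>y. B \<partial>P h x)" unfolding T_def
          using B by (intro integral_mono gi) (auto simp: spx abs_le_iff)
        moreover have "(\<integral>y. - B \<partial>P h x) \<le> T x" unfolding T_def
          using B by (intro integral_mono gi) (auto simp: spx abs_le_iff minus_le_iff)
        ultimately show ?thesis by (simp add: px.prob_space abs_le_iff minus_le_iff)
      qed
      have T: "bdd_measurable S T"
        using T_meas T_bd by (auto simp: bdd_measurable_def bounded_iff)
      have Xsh: "X (s + h) \<in> M \<rightarrow>\<^sub>M S" using s h by (intro X) simp
      note Xs = X[OF s]
      have "(\<integral>\<omega>. g (X (s + h) \<omega>) \<partial>M) = (\<integral>x. g x \<partial>distr M S (X (s + h)))"
        using Xsh by (simp add: integral_distr)
      also have "\<dots> = (\<integral>x. g x \<partial>(distr M S (X s) \<bind> P h))"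
        using markov_process_law[OF mp Ph s] h by simp
      also have "\<dots> = (\<integral>x. T x \<partial>distr M S (X s))"
        unfolding T_def
      proof (rule integral_bind[where K = S and B = B and B' = 1])
        show "finite_measure (distr M S (X s))" using Xs by (intro finite_measure_distr)
        show "AE x in distr M S (X s). emeasure (P h x) (space (P h x)) \<le> ennreal 1"
        proof (rule AE_I2)
          fix x assume "x \<in> space (distr M S (X s))"
          hence "P h x \<in> space (prob_algebra S)" using measurable_space[OF Ph] by simp
          hence "prob_space (P h x)" by (simp add: space_prob_algebra)
          thus "emeasure (P h x) (space (P h x)) \<le> ennreal 1" by (simp add: prob_space.emeasure_space_1)
        qed
      qed (use Ph' B in auto)
      also have "\<dots> = (\<integral>\<omega>. T (X s \<omega>) \<partial>M)"
        using Xs T_meas by (simp add: integral_distr)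
      finally have step: "(\<integral>\<omega>. g (X (s + h) \<omega>) \<partial>M) = (\<integral>\<omega>. T (X s \<omega>) \<partial>M)" .
      have int: "integrable M (\<lambda>\<omega>. T (X s \<omega>))" "integrable M (\<lambda>\<omega>. g (X s \<omega>))" "integrable M (\<lambda>\<omega>. L g (X s \<omega>))"
        using T g L[OF g] Xs by (auto intro: bdd_measurable_integrable)
      have "(\<integral>\<omega>. g (X (s + h) \<omega>) \<partial>M) - (\<integral>\<omega>. g (X s \<omega>) \<partial>M) - h * (\<integral>\<omega>. L g (X s \<omega>) \<partial>M)
          = (\<integral>\<omega>. T (X s \<omega>) - g (X s \<omega>) - h * L g (X s \<omega>) \<partial>M)"
        using int by (simp add: step)
      also have "\<bar>\<dots>\<bar> \<le> (\<integral>\<omega>. e * h \<partial>M)"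
      proof -
        have "\<bar>T x - g x - h * L g x\<bar> \<le> e * h" if "x \<in> space S" for x
        proof -
          have "T x - g x - h * L g x = h * ((T x - g x) / h - L g x)" using h by (simp add: field_simps)
          also have "\<bar>\<dots>\<bar> \<le> h * e"
            using d(2)[OF h that] h unfolding T_def abs_mult by (intro mult_mono) auto
          finally show ?thesis by (simp add: mult.commute)
        qed
        thus ?thesis
          using measurable_space[OF Xs] int by (intro lebesgue_integral_abs_le) auto
      qed
      finally show "\<bar>(\<integral>\<omega>. g (X (s + h) \<omega>) \<partial>M) - (\<integral>\<omega>. g (X s \<omega>) \<partial>M) - h * (\<integral>\<omega>. L g (X s \<omega>) \<partial>M)\<bar> \<le> e * h"
        by (simp add: prob_space)
    qed
  qed
  define E where "E = (\<lambda>s. \<integral>\<omega>. f (X s \<omega>) \<partial>M)"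
  define v where "v = (\<lambda>s. \<integral>\<omega>. L f (X s \<omega>) \<partial>M)"
  obtain B where B: "B \<ge> 0" "\<And>x. x \<in> space S \<Longrightarrow> \<bar>L (L f) x\<bar> \<le> B"
    using bdd_measurableE[OF L[OF L[OF f]]] by metis
  have LL: "\<bar>\<integral>\<omega>. L (L f) (X s \<omega>) \<partial>M\<bar> \<le> B" if "s \<ge> 0" for s
  proof -
    have "\<bar>\<integral>\<omega>. L (L f) (X s \<omega>) \<partial>M\<bar> \<le> (\<integral>\<omega>. B \<partial>M)"
      using B measurable_space[OF X[OF that]] bdd_measurable_integrable[OF L[OF L[OF f]] X[OF that]]
      by (intro lebesgue_integral_abs_le) auto
    thus ?thesis by (simp add: prob_space)
  qed
  obtain d1 where d1: "d1 > 0" "\<And>h s. 0 < h \<Longrightarrow> h < d1 \<Longrightarrow> 0 \<le> s \<Longrightarrow> \<bar>v (s + h) - v s\<bar> \<le> (B + 1) * h"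
  proof -
    from increment[OF L[OF f], of 1] obtain d where d: "d > 0" "\<And>h s. 0 < h \<Longrightarrow> h < d \<Longrightarrow> 0 \<le> s \<Longrightarrow>
      \<bar>v (s + h) - v s - h * (\<integral>\<omega>. L (L f) (X s \<omega>) \<partial>M)\<bar> \<le> 1 * h"
      unfolding v_def by fastforce
    have "\<bar>v (s + h) - v s\<bar> \<le> (B + 1) * h" if "0 < h" "h < d" "0 \<le> s" for h s
    proof -
      have "\<bar>h * (\<integral>\<omega>. L (L f) (X s \<omega>) \<partial>M)\<bar> \<le> h * B"
        unfolding abs_mult using that LL by (intro mult_mono) auto
      thus ?thesis using d(2)[OF that] by (simp add: algebra_simps)
    qed
    thus thesis using d(1) that by blast
  qed
  have "(E has_derivative (\<lambda>h. v t * h)) (at t within {0..})"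
    unfolding has_derivative_within_alt
  proof (intro conjI allI impI bounded_linear_mult_right)
    fix e :: real assume e: "e > 0"
    obtain d2 where d2: "d2 > 0" "\<And>h s. 0 < h \<Longrightarrow> h < d2 \<Longrightarrow> 0 \<le> s \<Longrightarrow>
        \<bar>E (s + h) - E s - h * v s\<bar> \<le> e / 2 * h"
      using increment[OF f, of "e / 2"] e unfolding E_def v_def by fastforce
    \<comment> \<open>The last bound keeps the change of \<open>v\<close> over a time \<open>d\<close> below \<open>e / 2\<close>.\<close>
    define d where "d = min (min d1 d2) (e / 2 / (B + 1))"
    have d: "d > 0" "d \<le> d1" "d \<le> d2" "d * (B + 1) \<le> e / 2"
    proof -
      show "d > 0" using d1 d2 e B by (simp add: d_def)
      have "d * (B + 1) \<le> e / 2 / (B + 1) * (B + 1)" unfolding d_def using B by (intro mult_right_mono) auto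
      moreover have "B + 1 \<noteq> 0" using B by simp
      ultimately show "d * (B + 1) \<le> e / 2" by (metis nonzero_divide_eq_eq)
    qed (auto simp: d_def)
    show "\<exists>d>0. \<forall>y\<in>{0..}. norm (y - t) < d \<longrightarrow> norm (E y - E t - v t * (y - t)) \<le> e * norm (y - t)"
    proof (intro exI[of _ d] conjI d(1) ballI impI)
      fix y assume y: "y \<in> {0..}" "norm (y - t) < d"
      consider "y = t" | "y > t" | "y < t" by linarith
      thus "norm (E y - E t - v t * (y - t)) \<le> e * norm (y - t)"
      proof cases
        case 2
        hence "\<bar>E (t + (y - t)) - E t - (y - t) * v t\<bar> \<le> e / 2 * (y - t)"
          using y d t by (intro d2(2)) auto
        also have "\<dots> \<le> e * (y - t)" using 2 e by (intro mult_right_mono) auto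
        finally show ?thesis using 2 by (simp add: mult.commute)
      next
        case 3
        define h where "h = t - y"
        have h: "0 < h" "h < d" "t = y + h" using 3 y by (auto simp: h_def)
        have 1: "\<bar>E (y + h) - E y - h * v y\<bar> \<le> e / 2 * h" using h d y by (intro d2(2)) auto
        have "\<bar>v (y + h) - v y\<bar> \<le> (B + 1) * h" using h d y by (intro d1(2)) auto
        also have "\<dots> \<le> (B + 1) * d" using h B by (intro mult_left_mono) auto
        also have "\<dots> \<le> e / 2" using d by (simp add: mult.commute)
        finally have "\<bar>h * (v (y + h) - v y)\<bar> \<le> h * (e / 2)"
          unfolding abs_mult using h by (intro mult_mono) auto
        moreover have "E y - E t - v t * (y - t) = - (E (y + h) - E y - h * v y) + h * (v (y + h) - v y)"
          by (simp add: h(3) algebra_simps)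
        ultimately have "\<bar>E y - E t - v t * (y - t)\<bar> \<le> e / 2 * h + h * (e / 2)" using 1 by linarith
        thus ?thesis using h by (simp add: algebra_simps)
      qed simp
    qed
  qed
  thus ?thesis unfolding E_def v_def has_field_derivative_def .
qed

section \<open>Jump processes and functions of quadratic growth\<close>

text \<open>The function \<open>exp (- C s) \<cdot> u s\<close> is nonincreasing.\<close>

lemma gronwall_derivative:
  fixes u u' :: "real \<Rightarrow> real"
  assumes der: "\<And>s. 0 \<le> s \<Longrightarrow> s \<le> T \<Longrightarrow> (u has_real_derivative u' s) (at s within {0..T})"
    and le: "\<And>s. 0 \<le> s \<Longrightarrow> s \<le> T \<Longrightarrow> u' s \<le> C * u s" and T: "0 \<le> T"
  shows "u T \<le> exp (C * T) * u 0"
proof -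
  have "(\<lambda>s. exp (- C * s) * u s) 0 \<ge> (\<lambda>s. exp (- C * s) * u s) T"
  proof (rule DERIV_nonpos_imp_decreasing_open[OF T])
    show "\<exists>y. ((\<lambda>s. exp (- C * s) * u s) has_real_derivative y) (at s) \<and> y \<le> 0"
      if s: "0 < s" "s < T" for s
    proof (intro exI conjI)
      have "(u has_real_derivative u' s) (at s)"
        using der[of s] s by (simp add: at_within_Icc_at)
      thus "((\<lambda>s. exp (- C * s) * u s) has_real_derivative exp (- C * s) * (u' s - C * u s)) (at s)"
        by (auto intro!: derivative_eq_intros simp: algebra_simps)
      show "exp (- C * s) * (u' s - C * u s) \<le> 0"
        using le[of s] s by (simp add: mult_le_0_iff)
    qed
    have "continuous_on {0..T} u"
      using der by (intro DERIV_continuous_on[of _ _ u']) auto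
    thus "continuous_on {0..T} (\<lambda>s. exp (- C * s) * u s)" by (intro continuous_intros)
  qed
  hence "exp (C * T) * (exp (- C * T) * u T) \<le> exp (C * T) * u 0" by simp
  thus ?thesis by (simp add: mult.assoc[symmetric] exp_add[symmetric])
qed

text \<open>A process whose expectations evolve under a generator with finitely many jumps, \<open>x \<mapsto> J k x\<close> at the constant
  rate \<open>r k\<close>. The evolution law is assumed for bounded functions only, because a generator with respect to the
  supremum norm says nothing directly about functions of quadratic growth.\<close>

locale jump_dynamics = prob_space M for M :: "'a measure" +
  fixes S :: "'s measure" and X :: "real \<Rightarrow> 'a \<Rightarrow> 's"
    and K :: "'k set" and r :: "'k \<Rightarrow> real" and J :: "'k \<Rightarrow> 's \<Rightarrow> 's" and L :: "('s \<Rightarrow> real) \<Rightarrow> 's \<Rightarrow> real"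
  assumes finite_K: "finite K" and rate_nonneg: "\<And>k. k \<in> K \<Longrightarrow> 0 \<le> r k"
    and jump_measurable: "\<And>k. k \<in> K \<Longrightarrow> J k \<in> S \<rightarrow>\<^sub>M S"
    and process_measurable: "\<And>t. t \<ge> 0 \<Longrightarrow> X t \<in> M \<rightarrow>\<^sub>M S"
    and L_def: "\<And>f x. L f x = (\<Sum>k\<in>K. r k * (f (J k x) - f x))"
    and derivative_bounded: "\<And>f t. bdd_measurable S f \<Longrightarrow> t \<ge> 0 \<Longrightarrow>
      ((\<lambda>t. \<integral>\<omega>. f (X t \<omega>) \<partial>M) has_real_derivative (\<integral>\<omega>. L f (X t \<omega>) \<partial>M)) (at t within {0..})"
begin

definition total_rate :: real where "total_rate = (\<Sum>k\<in>K. r k)"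

lemma total_rate_nonneg: "total_rate \<ge> 0"
  unfolding total_rate_def by (intro sum_nonneg rate_nonneg)

lemma L_measurable:
  assumes [measurable]: "f \<in> borel_measurable S"
  shows "L f \<in> borel_measurable S"
proof -
  have [measurable]: "(\<lambda>x. f (J k x)) \<in> borel_measurable S" if "k \<in> K" for k
    using jump_measurable[OF that] by measurable
  show ?thesis unfolding L_def[abs_def] by measurable
qed

lemma L_bound:
  assumes "\<And>k. k \<in> K \<Longrightarrow> \<bar>f (J k x)\<bar> \<le> A" and "\<bar>f x\<bar> \<le> B"
  shows "\<bar>L f x\<bar> \<le> total_rate * (A + B)"
proof -
  have "\<bar>L f x\<bar> \<le> (\<Sum>k\<in>K. \<bar>r k * (f (J k x) - f x)\<bar>)" unfolding L_def by (rule sum_abs)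
  also have "\<dots> \<le> (\<Sum>k\<in>K. r k * (A + B))"
    unfolding abs_mult
  proof (rule sum_mono)
    fix k assume k: "k \<in> K"
    have "\<bar>f (J k x) - f x\<bar> \<le> A + B" using assms(1)[OF k] assms(2) by linarith
    thus "\<bar>r k\<bar> * \<bar>f (J k x) - f x\<bar> \<le> r k * (A + B)"
      using rate_nonneg[OF k] by (intro mult_mono) auto
  qed
  finally show ?thesis by (simp add: total_rate_def sum_distrib_right)
qed

lemma L_sub: "L f x - L g x = L (\<lambda>x. f x - g x) x"
  unfolding L_def sum_subtractf[symmetric] by (intro sum.cong) (auto simp: algebra_simps)

lemma L_bdd_measurable:
  assumes f: "bdd_measurable S f"
  shows "bdd_measurable S (L f)"
proof -
  obtain B where B: "\<And>x. x \<in> space S \<Longrightarrow> \<bar>f x\<bar> \<le> B" using bdd_measurableE[OF f] by metis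
  have "\<bar>L f x\<bar> \<le> total_rate * (B + B)" if "x \<in> space S" for x
    using B that measurable_space[OF jump_measurable] by (intro L_bound) auto
  thus ?thesis using L_measurable[of f] f by (auto simp: bdd_measurable_def bounded_iff)
qed

text \<open>The jump condition gives \<open>L W \<le> total_rate \<cdot> \<kappa> \<cdot> W\<close>, to which Gronwall applies.\<close>

lemma moment_bound_bounded:
  assumes W: "bdd_measurable S W" and nonneg: "\<And>x. x \<in> space S \<Longrightarrow> 0 \<le> W x"
    and jump: "\<And>k x. k \<in> K \<Longrightarrow> x \<in> space S \<Longrightarrow> W (J k x) \<le> \<kappa> * W x" and t: "t \<ge> 0"
  shows "(\<integral>\<omega>. W (X t \<omega>) \<partial>M) \<le> exp (total_rate * \<kappa> * t) * (\<integral>\<omega>. W (X 0 \<omega>) \<partial>M)"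
proof (rule gronwall_derivative[where u' = "\<lambda>s. \<integral>\<omega>. L W (X s \<omega>) \<partial>M"])
  fix s assume s: "0 \<le> s" "s \<le> t"
  show "((\<lambda>s. \<integral>\<omega>. W (X s \<omega>) \<partial>M) has_real_derivative (\<integral>\<omega>. L W (X s \<omega>) \<partial>M)) (at s within {0..t})"
    by (rule DERIV_subset[OF derivative_bounded[OF W]]) (use s in auto)
  have LW: "L W x \<le> total_rate * \<kappa> * W x" if x: "x \<in> space S" for x
  proof -
    have "L W x \<le> (\<Sum>k\<in>K. r k * (\<kappa> * W x))"
      unfolding L_def using jump[OF _ x] nonneg[OF x] rate_nonneg
      by (intro sum_mono mult_left_mono) (auto intro: diff_le_eq[THEN iffD2] add_increasing2)
    thus ?thesis by (simp add: total_rate_def sum_distrib_right mult.assoc)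
  qed
  have "(\<integral>\<omega>. L W (X s \<omega>) \<partial>M) \<le> (\<integral>\<omega>. total_rate * \<kappa> * W (X s \<omega>) \<partial>M)"
    using measurable_space[OF process_measurable[OF s(1)]] LW
    by (intro integral_mono bdd_measurable_integrable[OF L_bdd_measurable[OF W]] integrable_mult_right
        bdd_measurable_integrable[OF W] process_measurable s) auto
  thus "(\<integral>\<omega>. L W (X s \<omega>) \<partial>M) \<le> total_rate * \<kappa> * (\<integral>\<omega>. W (X s \<omega>) \<partial>M)" by simp
qed (rule t)

text \<open>The truncation \<open>min W n\<close> inherits the jump condition, since \<open>\<kappa> \<ge> 1\<close>. It satisfies the bound of the
  preceding lemma with a constant that does not depend on \<open>n\<close>, and Fatou removes the truncation.\<close>

lemma moment_bound:
  assumes W: "W \<in> borel_measurable S" and nonneg: "\<And>x. x \<in> space S \<Longrightarrow> 0 \<le> W x"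
    and jump: "\<And>k x. k \<in> K \<Longrightarrow> x \<in> space S \<Longrightarrow> W (J k x) \<le> \<kappa> * W x" and \<kappa>: "\<kappa> \<ge> 1"
    and init: "integrable M (\<lambda>\<omega>. W (X 0 \<omega>))" and t: "t \<ge> 0"
  shows "integrable M (\<lambda>\<omega>. W (X t \<omega>))"
    and "(\<integral>\<omega>. W (X t \<omega>) \<partial>M) \<le> exp (total_rate * \<kappa> * t) * (\<integral>\<omega>. W (X 0 \<omega>) \<partial>M)"
proof -
  define C where "C = exp (total_rate * \<kappa> * t) * (\<integral>\<omega>. W (X 0 \<omega>) \<partial>M)"
  define Wn where "Wn n x = min (W x) (real n)" for n x
  have bdd: "bdd_measurable S (Wn n)" for n
    using W nonneg unfolding Wn_def bdd_measurable_def bounded_iff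
    by (auto intro!: exI[of _ "real n"])
  note Xt = process_measurable[OF t] and X0 = process_measurable[OF order_refl]
  have sp: "X s \<omega> \<in> space S" if "s \<ge> 0" "\<omega> \<in> space M" for s \<omega>
    using that process_measurable by (auto dest: measurable_space)
  have Wn: "(\<integral>\<omega>. Wn n (X t \<omega>) \<partial>M) \<le> C" for n
  proof -
    have "(\<integral>\<omega>. Wn n (X t \<omega>) \<partial>M) \<le> exp (total_rate * \<kappa> * t) * (\<integral>\<omega>. Wn n (X 0 \<omega>) \<partial>M)"
    proof (rule moment_bound_bounded[OF bdd _ _ t])
      fix k x assume k: "k \<in> K" and x: "x \<in> space S"
      have "real n \<le> \<kappa> * real n" using mult_right_mono[OF \<kappa>, of "real n"] by simp
      thus "Wn n (J k x) \<le> \<kappa> * Wn n x"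
        using jump[OF k x] by (auto simp: Wn_def min_def)
    qed (auto simp: Wn_def nonneg)
    also have "\<dots> \<le> C"
      unfolding C_def using sp
      by (intro mult_left_mono integral_mono bdd_measurable_integrable[OF bdd X0] init) (auto simp: Wn_def)
    finally show ?thesis .
  qed
  have conv: "(\<integral>\<^sup>+\<omega>. ennreal (W (X t \<omega>)) \<partial>M) \<le> ennreal C"
  proof -
    have "(\<integral>\<^sup>+\<omega>. ennreal (W (X t \<omega>)) \<partial>M) = (\<integral>\<^sup>+\<omega>. liminf (\<lambda>n. ennreal (Wn n (X t \<omega>))) \<partial>M)"
    proof (intro nn_integral_cong)
      fix \<omega> assume "\<omega> \<in> space M"
      have "\<forall>\<^sub>F n in sequentially. ennreal (Wn n (X t \<omega>)) = ennreal (W (X t \<omega>))"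
        using eventually_ge_at_top[of "nat \<lceil>W (X t \<omega>)\<rceil>"]
      proof eventually_elim
        case (elim n)
        hence "W (X t \<omega>) \<le> real n" by linarith
        thus ?case by (simp add: Wn_def)
      qed
      hence "(\<lambda>n. ennreal (Wn n (X t \<omega>))) \<longlonglongrightarrow> ennreal (W (X t \<omega>))" by (rule tendsto_eventually)
      thus "ennreal (W (X t \<omega>)) = liminf (\<lambda>n. ennreal (Wn n (X t \<omega>)))"
        by (simp add: lim_imp_Liminf)
    qed
    also have "\<dots> \<le> liminf (\<lambda>n. \<integral>\<^sup>+\<omega>. ennreal (Wn n (X t \<omega>)) \<partial>M)"
      using measurable_compose[OF Xt, of "Wn n" borel for n] bdd
      by (intro nn_integral_liminf measurable_compose[OF _ measurable_ennreal]) (simp add: bdd_measurable_def)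
    also have "\<dots> \<le> ennreal C"
    proof -
      have "(\<integral>\<^sup>+\<omega>. ennreal (Wn n (X t \<omega>)) \<partial>M) \<le> ennreal C" for n
        using Wn[of n] sp[OF t] nonneg
        by (subst nn_integral_eq_integral[OF bdd_measurable_integrable[OF bdd Xt]])
           (auto simp: Wn_def intro!: ennreal_leI)
      thus ?thesis by (intro Liminf_le) auto
    qed
    finally show ?thesis .
  qed
  have m: "(\<lambda>\<omega>. W (X t \<omega>)) \<in> borel_measurable M" using W Xt by simp
  have AE: "AE \<omega> in M. 0 \<le> W (X t \<omega>)" using sp[OF t] nonneg by auto
  show int: "integrable M (\<lambda>\<omega>. W (X t \<omega>))"
    using conv AE m by (intro integrableI_nonneg) (auto simp: ennreal_less_top intro: le_less_trans)
  have C: "C \<ge> 0" unfolding C_def using sp[of 0] nonneg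
    by (intro mult_nonneg_nonneg Bochner_Integration.integral_nonneg) auto
  have "ennreal (\<integral>\<omega>. W (X t \<omega>) \<partial>M) \<le> ennreal C"
    using conv nn_integral_eq_integral[OF int AE] by simp
  thus "(\<integral>\<omega>. W (X t \<omega>) \<partial>M) \<le> C" using C by (simp add: ennreal_le_iff)
qed

end

text \<open>The weight \<open>W\<close> grows at most by a constant factor in each jump. The square of \<open>W\<close> is integrable at time zero and
  hence at all times, so that functions bounded by \<open>W\<close> are uniformly integrable on bounded time intervals.\<close>

locale dominated_jump_dynamics = jump_dynamics M S X K r J L
  for M :: "'a measure" and S :: "'s measure" and X :: "real \<Rightarrow> 'a \<Rightarrow> 's"
    and K :: "'k set" and r J L +
  fixes W :: "'s \<Rightarrow> real" and \<kappa> :: real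
  assumes W_measurable: "W \<in> borel_measurable S"
    and W_nonneg: "\<And>x. x \<in> space S \<Longrightarrow> 0 \<le> W x"
    and W_jump: "\<And>k x. k \<in> K \<Longrightarrow> x \<in> space S \<Longrightarrow> W (J k x) \<le> \<kappa> * W x" and \<kappa>: "\<kappa> \<ge> 1"
    and W_init: "integrable M (\<lambda>\<omega>. (W (X 0 \<omega>))\<^sup>2)"
begin

lemma process_space: "s \<ge> 0 \<Longrightarrow> \<omega> \<in> space M \<Longrightarrow> X s \<omega> \<in> space S"
  using process_measurable by (auto dest: measurable_space)

lemma jump_space: "k \<in> K \<Longrightarrow> x \<in> space S \<Longrightarrow> J k x \<in> space S"
  using jump_measurable by (auto dest: measurable_space)

lemma W_square_jump: "k \<in> K \<Longrightarrow> x \<in> space S \<Longrightarrow> (W (J k x))\<^sup>2 \<le> \<kappa>\<^sup>2 * (W x)\<^sup>2"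
  using power_mono[OF W_jump W_nonneg[OF jump_space], of k x 2] by (simp add: power_mult_distrib)

lemma W_square_moment:
  assumes "s \<ge> 0"
  shows "integrable M (\<lambda>\<omega>. (W (X s \<omega>))\<^sup>2)"
    and "(\<integral>\<omega>. (W (X s \<omega>))\<^sup>2 \<partial>M) \<le> exp (total_rate * \<kappa>\<^sup>2 * s) * (\<integral>\<omega>. (W (X 0 \<omega>))\<^sup>2 \<partial>M)"
  using moment_bound[OF _ _ W_square_jump _ W_init assms] W_measurable \<kappa> by auto

lemma dominated_by_square_integrable:
  assumes g: "g \<in> borel_measurable S" and le: "\<And>x. x \<in> space S \<Longrightarrow> \<bar>g x\<bar> \<le> C * (W x)\<^sup>2" and s: "s \<ge> 0"
  shows "integrable M (\<lambda>\<omega>. g (X s \<omega>))"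
proof (rule Bochner_Integration.integrable_bound[OF integrable_mult_right[OF W_square_moment(1)[OF s], of C]])
  show "(\<lambda>\<omega>. g (X s \<omega>)) \<in> borel_measurable M" using process_measurable[OF s] g by simp
  show "AE \<omega> in M. norm (g (X s \<omega>)) \<le> norm (C * (W (X s \<omega>))\<^sup>2)"
    using le process_space[OF s] by (intro AE_I2) force
qed

lemma dominated_integrable:
  assumes g: "g \<in> borel_measurable S" and le: "\<And>x. x \<in> space S \<Longrightarrow> \<bar>g x\<bar> \<le> C * W x" and s: "s \<ge> 0"
  shows "integrable M (\<lambda>\<omega>. g (X s \<omega>))"
proof (rule Bochner_Integration.integrable_bound[where f = "\<lambda>\<omega>. \<bar>C\<bar> * (1 + (W (X s \<omega>))\<^sup>2)"])
  show "integrable M (\<lambda>\<omega>. \<bar>C\<bar> * (1 + (W (X s \<omega>))\<^sup>2))"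
    using W_square_moment(1)[OF s] by simp
  show "(\<lambda>\<omega>. g (X s \<omega>)) \<in> borel_measurable M" using process_measurable[OF s] g by simp
  show "AE \<omega> in M. norm (g (X s \<omega>)) \<le> norm (\<bar>C\<bar> * (1 + (W (X s \<omega>))\<^sup>2))"
  proof (rule AE_I2)
    fix \<omega> assume "\<omega> \<in> space M"
    hence x: "X s \<omega> \<in> space S" by (rule process_space[OF s])
    have w: "w \<le> 1 + w\<^sup>2" for w :: real
      using zero_le_power2[of "w - 1 / 2"] by (simp add: power2_eq_square algebra_simps)
    have "\<bar>g (X s \<omega>)\<bar> \<le> C * W (X s \<omega>)" by (rule le[OF x])
    also have "\<dots> \<le> \<bar>C\<bar> * (1 + (W (X s \<omega>))\<^sup>2)"
      using W_nonneg[OF x] w by (intro mult_mono) auto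
    finally show "norm (g (X s \<omega>)) \<le> norm (\<bar>C\<bar> * (1 + (W (X s \<omega>))\<^sup>2))" by simp
  qed
qed

lemma L_dominated_integrable:
  assumes f: "f \<in> borel_measurable S" and fW: "\<And>x. x \<in> space S \<Longrightarrow> \<bar>f x\<bar> \<le> W x" and s: "s \<ge> 0"
  shows "integrable M (\<lambda>\<omega>. L f (X s \<omega>))"
proof (rule dominated_integrable[OF L_measurable[OF f] _ s])
  fix x assume x: "x \<in> space S"
  have "\<bar>L f x\<bar> \<le> total_rate * (\<kappa> * W x + W x)"
  proof (rule L_bound)
    show "\<bar>f (J k x)\<bar> \<le> \<kappa> * W x" if k: "k \<in> K" for k
      using fW[OF jump_space[OF k x]] W_jump[OF k x] by (rule order_trans)
  qed (rule fW[OF x])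
  thus "\<bar>L f x\<bar> \<le> total_rate * (\<kappa> + 1) * W x" by (simp add: algebra_simps)
qed

text \<open>Truncate \<open>f\<close> to values in \<open>[-n, n]\<close>. The truncation differs from \<open>f\<close> only where \<open>W > n\<close>, so the error is at most
  \<open>W\<^sup>2 / n\<close>, and the error of the generator is at most a constant times \<open>W\<^sup>2 / n\<close>. As the expectation of \<open>W\<^sup>2\<close> is bounded on
  \<open>[0, T]\<close>, the derivatives of the truncated expectations converge uniformly there.\<close>

lemma derivative_dominated:
  assumes f: "f \<in> borel_measurable S" and fW: "\<And>x. x \<in> space S \<Longrightarrow> \<bar>f x\<bar> \<le> W x"
    and t: "0 \<le> t" "t \<le> T"
  shows "((\<lambda>t. \<integral>\<omega>. f (X t \<omega>) \<partial>M) has_real_derivative (\<integral>\<omega>. L f (X t \<omega>) \<partial>M)) (at t within {0..T})"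
proof -
  define D where "D = exp (total_rate * \<kappa>\<^sup>2 * T) * (\<integral>\<omega>. (W (X 0 \<omega>))\<^sup>2 \<partial>M)"
  define fn where "fn n x = max (- real n) (min (f x) (real n))" for n x
  have W2le: "(\<integral>\<omega>. (W (X s \<omega>))\<^sup>2 \<partial>M) \<le> D" if "0 \<le> s" "s \<le> T" for s
  proof -
    have "(\<integral>\<omega>. (W (X s \<omega>))\<^sup>2 \<partial>M) \<le> exp (total_rate * \<kappa>\<^sup>2 * s) * (\<integral>\<omega>. (W (X 0 \<omega>))\<^sup>2 \<partial>M)"
      by (rule W_square_moment) fact
    also have "\<dots> \<le> D" unfolding D_def
      using that total_rate_nonneg \<kappa>
      by (intro mult_right_mono Bochner_Integration.integral_nonneg) (auto intro!: mult_left_mono)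
    finally show ?thesis .
  qed
  have bdd: "bdd_measurable S (fn n)" for n
    using f unfolding fn_def bdd_measurable_def bounded_iff
    by (auto intro!: exI[of _ "real n"])
  have diff: "real n * \<bar>fn n x - f x\<bar> \<le> (W x)\<^sup>2" if x: "x \<in> space S" for n x
  proof (cases "\<bar>f x\<bar> \<le> real n")
    case True
    thus ?thesis by (simp add: fn_def)
  next
    case False
    hence "\<bar>fn n x - f x\<bar> \<le> \<bar>f x\<bar>" "real n \<le> W x" using fW[OF x] by (auto simp: fn_def)
    thus ?thesis unfolding power2_eq_square using fW[OF x] W_nonneg[OF x] by (intro mult_mono) auto
  qed
  define C where "C = total_rate * (\<kappa>\<^sup>2 + 1)"
  have C: "C \<ge> 0" using total_rate_nonneg by (simp add: C_def)
  have Ldiff: "real n * \<bar>L (fn n) x - L f x\<bar> \<le> C * (W x)\<^sup>2" if x: "x \<in> space S" and n: "n > 0" for n x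
  proof -
    have "\<bar>fn n y - f y\<bar> \<le> (W y)\<^sup>2 / real n" if "y \<in> space S" for y
      using diff[OF that, of n] n by (simp add: field_simps)
    note near = this
    have 1: "\<bar>L (\<lambda>x. fn n x - f x) x\<bar> \<le> total_rate * (\<kappa>\<^sup>2 * (W x)\<^sup>2 / real n + (W x)\<^sup>2 / real n)"
    proof (rule L_bound)
      fix k assume k: "k \<in> K"
      have "(W (J k x))\<^sup>2 / real n \<le> \<kappa>\<^sup>2 * (W x)\<^sup>2 / real n"
        by (intro divide_right_mono W_square_jump[OF k x]) simp
      thus "\<bar>fn n (J k x) - f (J k x)\<bar> \<le> \<kappa>\<^sup>2 * (W x)\<^sup>2 / real n"
        using near[OF jump_space[OF k x]] by linarith
    qed (rule near[OF x])
    have "real n * \<bar>L (\<lambda>x. fn n x - f x) x\<bar>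
        \<le> real n * (total_rate * (\<kappa>\<^sup>2 * (W x)\<^sup>2 / real n + (W x)\<^sup>2 / real n))"
      by (intro mult_left_mono 1) simp
    also have "\<dots> = C * (W x)\<^sup>2" using n by (simp add: C_def field_simps)
    finally show ?thesis by (simp add: L_sub)
  qed
  have bound_dom: "\<bar>\<integral>\<omega>. g (X s \<omega>) \<partial>M\<bar> \<le> c * D"
    if g: "g \<in> borel_measurable S" "\<And>x. x \<in> space S \<Longrightarrow> \<bar>g x\<bar> \<le> c * (W x)\<^sup>2"
      and s: "0 \<le> s" "s \<le> T" and c: "c \<ge> 0" for g c s
  proof -
    have "\<bar>\<integral>\<omega>. g (X s \<omega>) \<partial>M\<bar> \<le> (\<integral>\<omega>. c * (W (X s \<omega>))\<^sup>2 \<partial>M)"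
      using g(2) process_space[OF s(1)] W_square_moment(1)[OF s(1)]
      by (intro lebesgue_integral_abs_le dominated_by_square_integrable[OF g s(1)]) auto
    also have "\<dots> \<le> c * D" using W2le[OF s] c by (simp add: mult_left_mono)
    finally show ?thesis .
  qed
  have f_int: "integrable M (\<lambda>\<omega>. f (X s \<omega>))" if "s \<ge> 0" for s
    by (rule dominated_integrable[where C = 1]) (use f fW that in auto)
  have Lf_int: "integrable M (\<lambda>\<omega>. L f (X s \<omega>))" if "s \<ge> 0" for s
    by (rule L_dominated_integrable[OF f _ that]) (rule fW)
  have approx: "\<bar>(\<integral>\<omega>. fn n (X s \<omega>) \<partial>M) - (\<integral>\<omega>. f (X s \<omega>) \<partial>M)\<bar> \<le> D / real n"
    and Lapprox: "\<bar>(\<integral>\<omega>. L (fn n) (X s \<omega>) \<partial>M) - (\<integral>\<omega>. L f (X s \<omega>) \<partial>M)\<bar> \<le> C * D / real n"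
    if s: "0 \<le> s" "s \<le> T" and n: "n > 0" for s n
  proof -
    note X = process_measurable[OF s(1)]
    have "\<bar>\<integral>\<omega>. (\<lambda>x. fn n x - f x) (X s \<omega>) \<partial>M\<bar> \<le> 1 / real n * D"
      using diff[of _ n] f bdd[of n] n s by (intro bound_dom) (auto simp: bdd_measurable_def field_simps)
    thus "\<bar>(\<integral>\<omega>. fn n (X s \<omega>) \<partial>M) - (\<integral>\<omega>. f (X s \<omega>) \<partial>M)\<bar> \<le> D / real n"
      using f_int[OF s(1)] bdd_measurable_integrable[OF bdd X] by simp
    have "\<bar>\<integral>\<omega>. (\<lambda>x. L (fn n) x - L f x) (X s \<omega>) \<partial>M\<bar> \<le> C / real n * D"
      using Ldiff[of _ n] L_measurable[OF f] L_bdd_measurable[OF bdd[of n]] n s C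
      by (intro bound_dom) (auto simp: bdd_measurable_def field_simps)
    thus "\<bar>(\<integral>\<omega>. L (fn n) (X s \<omega>) \<partial>M) - (\<integral>\<omega>. L f (X s \<omega>) \<partial>M)\<bar> \<le> C * D / real n"
      using Lf_int[OF s(1)] bdd_measurable_integrable[OF L_bdd_measurable[OF bdd] X] by simp
  qed
  have D: "D \<ge> 0" unfolding D_def by (intro mult_nonneg_nonneg Bochner_Integration.integral_nonneg) auto
  have lim: "(\<lambda>n. c / real n) \<longlonglongrightarrow> 0" for c by (rule lim_const_over_n)
  have conv: "(\<lambda>n. \<integral>\<omega>. fn n (X s \<omega>) \<partial>M) \<longlonglongrightarrow> (\<integral>\<omega>. f (X s \<omega>) \<partial>M)" if "0 \<le> s" "s \<le> T" for s
  proof -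
    have "(\<lambda>n. (\<integral>\<omega>. fn n (X s \<omega>) \<partial>M) - (\<integral>\<omega>. f (X s \<omega>) \<partial>M)) \<longlonglongrightarrow> 0"
    proof (rule Lim_null_comparison[OF _ lim[of D]])
      show "\<forall>\<^sub>F n in sequentially. norm ((\<integral>\<omega>. fn n (X s \<omega>) \<partial>M) - (\<integral>\<omega>. f (X s \<omega>) \<partial>M)) \<le> D / real n"
        using eventually_gt_at_top[of "0::nat"] by eventually_elim (use approx[OF that] in simp)
    qed
    thus ?thesis by (simp add: LIM_zero_iff)
  qed
  have "\<exists>g. \<forall>s\<in>{0..T}. (\<lambda>n. \<integral>\<omega>. fn n (X s \<omega>) \<partial>M) \<longlonglongrightarrow> g s \<and>
     (g has_derivative (\<lambda>h. (\<integral>\<omega>. L f (X s \<omega>) \<partial>M) * h)) (at s within {0..T})"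
  proof (rule has_derivative_sequence)
    show "convex {0..T}" by simp
    show "((\<lambda>s. \<integral>\<omega>. fn n (X s \<omega>) \<partial>M) has_derivative (\<lambda>h. (\<integral>\<omega>. L (fn n) (X s \<omega>) \<partial>M) * h)) (at s within {0..T})"
      if "s \<in> {0..T}" for n s
      using DERIV_subset[OF derivative_bounded[OF bdd[of n]], of s "{0..T}"] that
      by (auto simp: has_field_derivative_def)
    fix e :: real assume e: "e > 0"
    have "\<forall>\<^sub>F n in sequentially. C * D / real n < e" using order_tendstoD(2)[OF lim e] .
    thus "\<forall>\<^sub>F n in sequentially. \<forall>s\<in>{0..T}. \<forall>h.
        norm ((\<integral>\<omega>. L (fn n) (X s \<omega>) \<partial>M) * h - (\<integral>\<omega>. L f (X s \<omega>) \<partial>M) * h) \<le> e * norm h"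
      using eventually_gt_at_top[of 0]
    proof eventually_elim
      case (elim n)
      thus ?case using Lapprox[of _ n]
        by (fastforce simp: left_diff_distrib[symmetric] abs_mult intro!: mult_right_mono)
    qed
  next
    show "t \<in> {0..T}" using t by simp
    show "(\<lambda>n. \<integral>\<omega>. fn n (X t \<omega>) \<partial>M) \<longlonglongrightarrow> (\<integral>\<omega>. f (X t \<omega>) \<partial>M)" by (rule conv) (use t in auto)
  qed
  then obtain g where g: "\<And>s. s \<in> {0..T} \<Longrightarrow> (\<lambda>n. \<integral>\<omega>. fn n (X s \<omega>) \<partial>M) \<longlonglongrightarrow> g s"
     "\<And>s. s \<in> {0..T} \<Longrightarrow> (g has_real_derivative (\<integral>\<omega>. L f (X s \<omega>) \<partial>M)) (at s within {0..T})"
    unfolding has_field_derivative_def by blast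
  have "g s = (\<integral>\<omega>. f (X s \<omega>) \<partial>M)" if "s \<in> {0..T}" for s
    using LIMSEQ_unique[OF g(1)[OF that] conv] that by simp
  thus ?thesis
    using t has_field_derivative_transform_within[OF g(2)[of t] zero_less_one, of "\<lambda>s. \<integral>\<omega>. f (X s \<omega>) \<partial>M"] by simp
qed

text \<open>The operator \<open>\<Gamma>(h, h)\<close>: the rate at which jumps produce quadratic variation of \<open>h(X)\<close>.\<close>

definition carre_du_champ :: "('s \<Rightarrow> real) \<Rightarrow> 's \<Rightarrow> real" where
  "carre_du_champ h x = (\<Sum>k\<in>K. r k * (h (J k x) - h x)\<^sup>2)"

lemma L_square: "L (\<lambda>x. (h x)\<^sup>2) x = 2 * h x * L h x + carre_du_champ h x"
  unfolding L_def carre_du_champ_def sum_distrib_left sum.distrib[symmetric]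
  by (intro sum.cong) (auto simp: power2_eq_square algebra_simps)

lemma L_sum: "finite I \<Longrightarrow> L (\<lambda>x. \<Sum>i\<in>I. \<alpha> i * e i x) x = (\<Sum>i\<in>I. \<alpha> i * L (e i) x)"
  unfolding L_def sum_subtractf[symmetric] sum_distrib_left
  by (subst sum.swap) (auto intro!: sum.cong simp: algebra_simps)

text \<open>For a linear combination \<open>l s\<close> of the observables \<open>y i\<close> with time-dependent coefficients, \<open>(l s)\<^sup>2\<close> is a finite sum of
  products \<open>y i \<cdot> y j\<close> with differentiable coefficients. The product rule and the evolution law for each
  product give the derivative, which is rearranged by \<open>L (l\<^sup>2) = 2 l \<cdot> L l + \<Gamma>(l, l)\<close>.\<close>

lemma second_moment_derivative:
  fixes y :: "'i \<Rightarrow> 's \<Rightarrow> real" and \<gamma> \<gamma>' :: "real \<Rightarrow> 'i \<Rightarrow> real"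
  assumes I: "finite I" and y: "\<And>i. i \<in> I \<Longrightarrow> y i \<in> borel_measurable S"
    and dom: "\<And>i j x. i \<in> I \<Longrightarrow> j \<in> I \<Longrightarrow> x \<in> space S \<Longrightarrow> \<bar>y i x * y j x\<bar> \<le> W x"
    and \<gamma>: "\<And>i. i \<in> I \<Longrightarrow> ((\<lambda>s. \<gamma> s i) has_real_derivative \<gamma>' s i) (at s within {0..T})"
    and s: "0 \<le> s" "s \<le> T"
  defines "l \<equiv> \<lambda>s x. \<Sum>i\<in>I. \<gamma> s i * y i x"
    and "l' \<equiv> \<lambda>x. \<Sum>i\<in>I. \<gamma>' s i * y i x"
  defines "G \<equiv> \<lambda>x. 2 * l s x * (l' x + L (l s) x) + carre_du_champ (l s) x"
  shows "((\<lambda>s. \<integral>\<omega>. (l s (X s \<omega>))\<^sup>2 \<partial>M) has_real_derivative (\<integral>\<omega>. G (X s \<omega>) \<partial>M)) (at s within {0..T})"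
    and "integrable M (\<lambda>\<omega>. G (X s \<omega>))"
proof -
  define e where "e = (\<lambda>p x. y (fst p) x * y (snd p) x)"
  define \<alpha> where "\<alpha> = (\<lambda>s p. \<gamma> s (fst p) * \<gamma> s (snd p))"
  define \<alpha>' where "\<alpha>' = (\<lambda>p. \<gamma>' s (fst p) * \<gamma> s (snd p) + \<gamma> s (fst p) * \<gamma>' s (snd p))"
  have e: "e p \<in> borel_measurable S" if "p \<in> I \<times> I" for p
    using that y unfolding e_def by (auto intro!: borel_measurable_times)
  have eW: "\<bar>e p x\<bar> \<le> W x" if "p \<in> I \<times> I" "x \<in> space S" for p x
    using that dom unfolding e_def by auto
  have prod: "(\<Sum>i\<in>I. f i) * (\<Sum>j\<in>I. g j) = (\<Sum>p\<in>I \<times> I. f (fst p) * g (snd p))" for f g :: "'i \<Rightarrow> real"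
    by (simp add: sum_product sum.cartesian_product case_prod_unfold)
  have l2: "(l s x)\<^sup>2 = (\<Sum>p\<in>I \<times> I. \<alpha> s p * e p x)" for s x
    unfolding power2_eq_square l_def prod \<alpha>_def e_def by (simp add: mult_ac)
  have G: "G x = (\<Sum>p\<in>I \<times> I. \<alpha>' p * e p x + \<alpha> s p * L (e p) x)" for x
  proof -
    have "2 * l s x * l' x = l' x * l s x + l s x * l' x" by simp
    also have "\<dots> = (\<Sum>p\<in>I \<times> I. \<alpha>' p * e p x)"
      unfolding l_def l'_def prod sum.distrib[symmetric] \<alpha>'_def e_def
      by (intro sum.cong) (auto simp: algebra_simps)
    finally have 1: "2 * l s x * l' x = (\<Sum>p\<in>I \<times> I. \<alpha>' p * e p x)" .
    have "2 * l s x * L (l s) x + carre_du_champ (l s) x = L (\<lambda>x. (l s x)\<^sup>2) x" by (simp add: L_square)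
    also have "\<dots> = (\<Sum>p\<in>I \<times> I. \<alpha> s p * L (e p) x)" unfolding l2 using I by (intro L_sum) auto
    finally show ?thesis using 1 unfolding G_def sum.distrib by (simp add: algebra_simps)
  qed
  have ei: "integrable M (\<lambda>\<omega>. e p (X u \<omega>))" if "p \<in> I \<times> I" "u \<ge> 0" for p u
    using e[OF that(1)] eW[OF that(1)] that(2) by (intro dominated_integrable[where C = 1]) auto
  have Lei: "integrable M (\<lambda>\<omega>. L (e p) (X s \<omega>))" if "p \<in> I \<times> I" for p
    using e[OF that] eW[OF that] s by (intro L_dominated_integrable) auto
  show "integrable M (\<lambda>\<omega>. G (X s \<omega>))" unfolding G using ei Lei s by (intro Bochner_Integration.integrable_sum) auto
  have "((\<lambda>s. \<Sum>p\<in>I \<times> I. \<alpha> s p * (\<integral>\<omega>. e p (X s \<omega>) \<partial>M)) has_real_derivative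
      (\<Sum>p\<in>I \<times> I. \<alpha>' p * (\<integral>\<omega>. e p (X s \<omega>) \<partial>M) + \<alpha> s p * (\<integral>\<omega>. L (e p) (X s \<omega>) \<partial>M))) (at s within {0..T})"
  proof (rule DERIV_sum)
    fix p assume p: "p \<in> I \<times> I"
    have "((\<lambda>s. \<alpha> s p) has_real_derivative \<alpha>' p) (at s within {0..T})"
      using DERIV_mult[OF \<gamma>[of "fst p"] \<gamma>[of "snd p"]] p
      unfolding \<alpha>_def \<alpha>'_def by (auto simp: algebra_simps)
    from DERIV_mult[OF this derivative_dominated[OF e[OF p] eW[OF p] s]]
    show "((\<lambda>s. \<alpha> s p * (\<integral>\<omega>. e p (X s \<omega>) \<partial>M)) has_real_derivative
      \<alpha>' p * (\<integral>\<omega>. e p (X s \<omega>) \<partial>M) + \<alpha> s p * (\<integral>\<omega>. L (e p) (X s \<omega>) \<partial>M)) (at s within {0..T})"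
      by (simp add: algebra_simps)
  qed
  also have "(\<Sum>p\<in>I \<times> I. \<alpha>' p * (\<integral>\<omega>. e p (X s \<omega>) \<partial>M) + \<alpha> s p * (\<integral>\<omega>. L (e p) (X s \<omega>) \<partial>M)) = (\<integral>\<omega>. G (X s \<omega>) \<partial>M)"
    unfolding G using ei Lei s by (subst Bochner_Integration.integral_sum) auto
  finally have D: "((\<lambda>s. \<Sum>p\<in>I \<times> I. \<alpha> s p * (\<integral>\<omega>. e p (X s \<omega>) \<partial>M)) has_real_derivative
      (\<integral>\<omega>. G (X s \<omega>) \<partial>M)) (at s within {0..T})" .
  have "(\<Sum>p\<in>I \<times> I. \<alpha> u p * (\<integral>\<omega>. e p (X u \<omega>) \<partial>M)) = (\<integral>\<omega>. (l u (X u \<omega>))\<^sup>2 \<partial>M)" if "u \<in> {0..T}" for u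
    unfolding l2 using ei that by (subst Bochner_Integration.integral_sum) auto
  thus "((\<lambda>s. \<integral>\<omega>. (l s (X s \<omega>))\<^sup>2 \<partial>M) has_real_derivative (\<integral>\<omega>. G (X s \<omega>) \<partial>M)) (at s within {0..T})"
    using s by (intro has_field_derivative_transform_within[OF D zero_less_one]) auto
qed

end

section \<open>The drift of linear statistics\<close>

text \<open>Everything in \<open>P1 g u\<close> that is integrated against the second variable, collected in one integrand. The finite
  system sees the sum of this kernel over the grid.\<close>

definition interaction_kernel ::
    "C0101 \<Rightarrow> C0101 \<Rightarrow> C0101 \<Rightarrow> C0101 \<Rightarrow> C0101 \<Rightarrow> C01 \<Rightarrow> unit_interval \<Rightarrow> unit_interval \<Rightarrow> real" where
  "interaction_kernel lam a1 a2 a3 a4 g u v =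
     g u * (lam (u, v) * (a1 (u, v) - 1)) + lam (u, v) * a3 (u, v) * g v
     + g u * (lam (v, u) * (a4 (v, u) - 1)) + lam (v, u) * g v * a2 (v, u)"

lemma P1_fun_eq_interaction_kernel:
  "P1_fun b c lam a1 a2 a3 a4 g u
     = b u * (c u - 1) * g u + int01 (interaction_kernel lam a1 a2 a3 a4 g u)"
proof -
  have "int01 (interaction_kernel lam a1 a2 a3 a4 g u) =
      int01 (\<lambda>v. g u * (lam (u, v) * (a1 (u, v) - 1))) + int01 (\<lambda>v. lam (u, v) * a3 (u, v) * g v)
      + int01 (\<lambda>v. g u * (lam (v, u) * (a4 (v, u) - 1))) + int01 (\<lambda>v. lam (v, u) * g v * a2 (v, u))"
    unfolding interaction_kernel_def by (subst int01_add, (intro continuous_intros)+)+ simp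
  thus ?thesis by (simp add: P1_fun_def int01_cmult)
qed

text \<open>The finite analogue of \<open>P1 g\<close> at the grid point \<open>i / N\<close>: an urn does not interact with itself, so the diagonal
  is left out of the sum.\<close>

definition discrete_drift ::
    "C01 \<Rightarrow> C01 \<Rightarrow> C0101 \<Rightarrow> C0101 \<Rightarrow> C0101 \<Rightarrow> C0101 \<Rightarrow> C0101 \<Rightarrow> nat \<Rightarrow> C01 \<Rightarrow> nat \<Rightarrow> real" where
  "discrete_drift b c lam a1 a2 a3 a4 N g i =
     b (grid N i) * (c (grid N i) - 1) * g (grid N i)
     + 1 / real N * (\<Sum>j\<in>{1..N} - {i}. interaction_kernel lam a1 a2 a3 a4 g (grid N i) (grid N j))"

text \<open>Up to the missing diagonal term, which is bounded by a constant times \<open>1 / N\<close>, the difference is the error of a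
  Riemann sum of a jointly continuous function of time, position and integration variable.\<close>

lemma discrete_drift_tendsto:
  fixes \<gamma> :: "real \<Rightarrow> C01"
  assumes \<gamma>: "continuous_on {0..T} \<gamma>" and e: "e > 0"
  shows "\<forall>\<^sub>F N in sequentially. \<forall>s\<in>{0..T}. \<forall>i\<in>{1..N}.
    \<bar>discrete_drift b c lam a1 a2 a3 a4 N (\<gamma> s) i - P1_fun b c lam a1 a2 a3 a4 (\<gamma> s) (grid N i)\<bar> \<le> e"
proof -
  let ?k = "interaction_kernel lam a1 a2 a3 a4"
  let ?K = "{0..T} \<times> (UNIV :: unit_interval set)"
  have \<gamma>1: "continuous_on (?K \<times> UNIV) (\<lambda>p. \<gamma> (fst (fst p)) (snd (fst p)))"
    by (rule continuous_on_compose2[OF continuous_on_apply_bcontfun_joint[OF \<gamma>], of _ fst, simplified])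
       (auto intro!: continuous_intros)
  have \<gamma>2: "continuous_on (?K \<times> UNIV) (\<lambda>p. \<gamma> (fst (fst p)) (snd p))"
    by (rule continuous_on_compose2[OF continuous_on_apply_bcontfun_joint[OF \<gamma>], of _ "\<lambda>p. (fst (fst p), snd p)", simplified])
       (auto intro!: continuous_intros)
  have cont: "continuous_on (?K \<times> UNIV) (\<lambda>(p, v). ?k (\<gamma> (fst p)) (snd p) v)"
    unfolding interaction_kernel_def case_prod_unfold
    by (intro continuous_intros \<gamma>1 \<gamma>2)
  have K: "compact ?K" by (intro compact_Times compact_UNIV_unit_interval) auto
  have "bounded ((\<lambda>(p, v). ?k (\<gamma> (fst p)) (snd p) v) ` (?K \<times> UNIV))"
    by (intro compact_imp_bounded compact_continuous_image cont compact_Times K compact_UNIV_unit_interval)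
  then obtain B where "\<forall>z\<in>(\<lambda>(p, v). ?k (\<gamma> (fst p)) (snd p) v) ` (?K \<times> UNIV). norm z \<le> B"
    unfolding bounded_iff ..
  hence B: "\<And>q. q \<in> ?K \<times> UNIV \<Longrightarrow> \<bar>(\<lambda>(p, v). ?k (\<gamma> (fst p)) (snd p) v) q\<bar> \<le> B"
    unfolding real_norm_def by (rule bspec) (rule imageI)
  have B: "\<bar>?k (\<gamma> s) u v\<bar> \<le> B" if "s \<in> {0..T}" for s u v
    using B[of "((s, u), v)"] that by simp
  have "(\<lambda>N. B / real N) \<longlonglongrightarrow> 0" by (rule lim_const_over_n)
  hence "\<forall>\<^sub>F N in sequentially. B / real N < e / 2" by (rule order_tendstoD) (use e in auto)
  moreover have "\<forall>\<^sub>F N in sequentially. \<forall>p\<in>?K.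
      \<bar>1 / real N * (\<Sum>j=1..N. ?k (\<gamma> (fst p)) (snd p) (grid N j)) - int01 (?k (\<gamma> (fst p)) (snd p))\<bar> \<le> e / 2"
    using e by (intro riemann_sums_uniform K cont) auto
  ultimately show ?thesis
  proof eventually_elim
    case (elim N)
    show ?case
    proof (intro ballI)
      fix s i assume s: "s \<in> {0..T}" and i: "i \<in> {1..N}"
      let ?u = "grid N i"
      have "(\<Sum>j=1..N. ?k (\<gamma> s) ?u (grid N j)) = ?k (\<gamma> s) ?u ?u + (\<Sum>j\<in>{1..N} - {i}. ?k (\<gamma> s) ?u (grid N j))"
        using i by (intro sum.remove) auto
      hence "discrete_drift b c lam a1 a2 a3 a4 N (\<gamma> s) i - P1_fun b c lam a1 a2 a3 a4 (\<gamma> s) ?u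
        = (1 / real N * (\<Sum>j=1..N. ?k (\<gamma> s) ?u (grid N j)) - int01 (?k (\<gamma> s) ?u)) - ?k (\<gamma> s) ?u ?u / real N"
        unfolding discrete_drift_def P1_fun_eq_interaction_kernel by (simp add: add_divide_distrib)
      moreover have "\<bar>1 / real N * (\<Sum>j=1..N. ?k (\<gamma> s) ?u (grid N j)) - int01 (?k (\<gamma> s) ?u)\<bar> \<le> e / 2"
        using elim(2) s by force
      moreover have "\<bar>?k (\<gamma> s) ?u ?u / real N\<bar> \<le> e / 2"
      proof -
        have "\<bar>?k (\<gamma> s) ?u ?u / real N\<bar> \<le> B / real N" using B[OF s] by (simp add: divide_right_mono)
        thus ?thesis using elim(1) by linarith
      qed
      ultimately show "\<bar>discrete_drift b c lam a1 a2 a3 a4 N (\<gamma> s) i - P1_fun b c lam a1 a2 a3 a4 (\<gamma> s) ?u\<bar> \<le> e"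
        by linarith
    qed
  qed
qed

section \<open>Estimates for the generator of the urn system\<close>

lemma sum_fun_upd_component:
  fixes h :: "'i \<Rightarrow> 'v \<Rightarrow> real"
  assumes "finite I" "i \<in> I"
  shows "(\<Sum>k\<in>I. h k ((x(i := y)) k)) = (\<Sum>k\<in>I. h k (x k)) - h i (x i) + h i y"
proof -
  have "(\<Sum>k\<in>I. h k ((x(i := y)) k)) = h i y + (\<Sum>k\<in>I - {i}. h k (x k))"
    using assms by (subst sum.remove[of I i]) (auto intro!: sum.cong)
  moreover have "(\<Sum>k\<in>I. h k (x k)) = h i (x i) + (\<Sum>k\<in>I - {i}. h k (x k))"
    using assms by (rule sum.remove)
  ultimately show ?thesis by simp
qed

lemma sum_off_diagonal_swap:
  fixes f :: "'i \<Rightarrow> 'i \<Rightarrow> real"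
  assumes "finite I"
  shows "(\<Sum>i\<in>I. \<Sum>j\<in>I - {i}. f i j) = (\<Sum>i\<in>I. \<Sum>j\<in>I - {i}. f j i)"
proof -
  have *: "(\<Sum>j\<in>I - {i}. g j) = (\<Sum>j\<in>I. if j = i then 0 else g j)" for g :: "'i \<Rightarrow> real" and i
    using assms by (simp add: sum.If_cases Int_Diff Collect_neg_eq[symmetric] Diff_eq)
  have "(\<Sum>i\<in>I. \<Sum>j\<in>I. if j = i then 0 else f i j) = (\<Sum>j\<in>I. \<Sum>i\<in>I. if j = i then 0 else f i j)"
    by (rule sum.swap)
  thus ?thesis unfolding * by (simp add: eq_commute[of _ "_ :: 'i"] cong: if_cong)
qed

locale urn_system =
  fixes b c :: C01 and lam a1 a2 a3 a4 :: C0101 and N :: nat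
  assumes b_nonneg: "\<And>u. 0 \<le> b u" and c_nonneg: "\<And>u. 0 \<le> c u" and lam_nonneg: "\<And>p. 0 \<le> lam p"
    and a1_nonneg: "\<And>p. 0 \<le> a1 p" and a2_nonneg: "\<And>p. 0 \<le> a2 p"
    and a3_nonneg: "\<And>p. 0 \<le> a3 p" and a4_nonneg: "\<And>p. 0 \<le> a4 p"
    and N: "1 \<le> N"
begin

abbreviation "L \<equiv> urn_generator b c lam a1 a2 a3 a4 N"
abbreviation "S \<equiv> urn_states N"

text \<open>The diagonal index \<open>(i, i)\<close> stands for the jump of the single urn \<open>i\<close>, an off-diagonal index \<open>(i, j)\<close> for the
  interaction of the urns \<open>i\<close> and \<open>j\<close>.\<close>

definition jumps :: "(nat \<times> nat) set" where
  "jumps = {1..N} \<times> {1..N}"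

definition rate :: "nat \<times> nat \<Rightarrow> real" where
  "rate = (\<lambda>(i, j). if i = j then b (grid N i) else lam (grid N i, grid N j) / real N)"

definition jump :: "nat \<times> nat \<Rightarrow> (nat \<Rightarrow> real) \<Rightarrow> nat \<Rightarrow> real" where
  "jump = (\<lambda>(i, j) x. if i = j then single_jump c N i x else pair_jump a1 a2 a3 a4 N i j x)"

text \<open>A common bound for all coefficients, at least \<open>1\<close> and independent of \<open>N\<close>. All estimates below are stated in
  terms of it, so that their uniformity in \<open>N\<close> can be read off.\<close>

definition bnd :: real where
  "bnd = 1 + norm b + norm c + norm lam + norm a1 + norm a2 + norm a3 + norm a4"

lemma bnd: "1 \<le> bnd" "b u \<le> bnd" "c u \<le> bnd" "lam p \<le> bnd" "a1 p \<le> bnd" "a2 p \<le> bnd" "a3 p \<le> bnd" "a4 p \<le> bnd"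
  using abs_bcontfun_le_norm[of b u] abs_bcontfun_le_norm[of c u] abs_bcontfun_le_norm[of lam p]
    abs_bcontfun_le_norm[of a1 p] abs_bcontfun_le_norm[of a2 p] abs_bcontfun_le_norm[of a3 p]
    abs_bcontfun_le_norm[of a4 p] norm_ge_zero[of b] norm_ge_zero[of c] norm_ge_zero[of lam]
    norm_ge_zero[of a1] norm_ge_zero[of a2] norm_ge_zero[of a3] norm_ge_zero[of a4]
  unfolding bnd_def by linarith+

lemma rate_nonneg: "0 \<le> rate k"
  by (auto simp: rate_def b_nonneg lam_nonneg split: prod.splits)

lemma generator_eq: "L f x = (\<Sum>k\<in>jumps. rate k * (f (jump k x) - f x))"
proof -
  have "(\<Sum>k\<in>jumps. rate k * (f (jump k x) - f x))
      = (\<Sum>i\<in>{1..N}. \<Sum>j\<in>{1..N}. rate (i, j) * (f (jump (i, j) x) - f x))"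
    by (simp add: jumps_def sum.cartesian_product)
  also have "\<dots> = (\<Sum>i\<in>{1..N}. rate (i, i) * (f (jump (i, i) x) - f x)
      + (\<Sum>j\<in>{1..N} - {i}. rate (i, j) * (f (jump (i, j) x) - f x)))"
    by (intro sum.cong sum.remove) auto
  also have "\<dots> = L f x"
    unfolding urn_generator_def sum.distrib sum_distrib_left
    by (intro arg_cong2[where f = "(+)"] sum.cong) (auto simp: rate_def jump_def)
  finally show ?thesis by simp
qed

lemma space_S: "x \<in> space S \<Longrightarrow> i \<in> {1..N} \<Longrightarrow> 0 \<le> x i"
  by (auto simp: urn_states_def space_PiM space_restrict_space)

lemma coordinate_measurable:
  assumes "i \<in> {1..N}"
  shows "(\<lambda>x. x i) \<in> borel_measurable S"
  unfolding urn_states_def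
  by (rule measurable_restrict_space2_iff[THEN iffD1, THEN conjunct1, OF measurable_component_singleton[OF assms]])

lemma fun_upd_measurable:
  assumes i: "i \<in> {1..N}" and f: "f \<in> S \<rightarrow>\<^sub>M S" and h: "h \<in> borel_measurable S"
    and nonneg: "\<And>x. x \<in> space S \<Longrightarrow> 0 \<le> h x"
  shows "(\<lambda>x. (f x)(i := h x)) \<in> S \<rightarrow>\<^sub>M S"
proof -
  have "h \<in> S \<rightarrow>\<^sub>M restrict_space borel {0..}"
    using h nonneg by (intro measurable_restrict_space2) auto
  moreover have "{1..N} = {1..N} \<union> {i}" using i by auto
  ultimately show ?thesis
    using f unfolding urn_states_def by (intro measurable_fun_upd) auto
qed

lemma jump_measurable:
  assumes "k \<in> jumps"
  shows "jump k \<in> S \<rightarrow>\<^sub>M S"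
proof -
  obtain i j where k: "k = (i, j)" and i: "i \<in> {1..N}" and j: "j \<in> {1..N}"
    using assms by (auto simp: jumps_def)
  note [measurable] = coordinate_measurable[OF i] coordinate_measurable[OF j]
  have id: "(\<lambda>x. x) \<in> S \<rightarrow>\<^sub>M S" by simp
  show ?thesis
  proof (cases "i = j")
    case True
    have "(\<lambda>x. x(i := c (grid N i) * x i)) \<in> S \<rightarrow>\<^sub>M S"
    proof (rule fun_upd_measurable[OF i id])
      show "(\<lambda>x. c (grid N i) * x i) \<in> borel_measurable S" by measurable
      show "0 \<le> c (grid N i) * x i" if "x \<in> space S" for x
        by (rule mult_nonneg_nonneg[OF c_nonneg space_S[OF that i]])
    qed
    thus ?thesis using True by (simp add: k jump_def single_jump_def[abs_def])
  next
    case False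
    let ?p = "(grid N i, grid N j)"
    have nn: "0 \<le> a1 ?p * x i + a2 ?p * x j" "0 \<le> a3 ?p * x i + a4 ?p * x j" if "x \<in> space S" for x
      using space_S[OF that i] space_S[OF that j] a1_nonneg a2_nonneg a3_nonneg a4_nonneg by simp_all
    have "(\<lambda>x. x(i := a1 ?p * x i + a2 ?p * x j)) \<in> S \<rightarrow>\<^sub>M S"
      by (rule fun_upd_measurable[OF i id _ nn(1)]) measurable
    hence "(\<lambda>x. x(i := a1 ?p * x i + a2 ?p * x j, j := a3 ?p * x i + a4 ?p * x j)) \<in> S \<rightarrow>\<^sub>M S"
      by (rule fun_upd_measurable[OF j _ _ nn(2)]) measurable
    thus ?thesis using False by (simp add: k jump_def pair_jump_def[abs_def])
  qed
qed

lemma separable_increment: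
  fixes h :: "nat \<Rightarrow> real \<Rightarrow> real"
  assumes "(i, j) \<in> jumps"
  shows "(\<Sum>k\<in>{1..N}. h k (jump (i, j) x k)) - (\<Sum>k\<in>{1..N}. h k (x k)) =
    (if i = j then h i (c (grid N i) * x i) - h i (x i)
     else h i (a1 (grid N i, grid N j) * x i + a2 (grid N i, grid N j) * x j) - h i (x i)
        + (h j (a3 (grid N i, grid N j) * x i + a4 (grid N i, grid N j) * x j) - h j (x j)))"
  using assms by (auto simp: jumps_def jump_def single_jump_def pair_jump_def sum_fun_upd_component simp del: fun_upd_apply)
     (auto simp: fun_upd_apply)

text \<open>In the part with factor \<open>\<beta>\<close> every \<open>(x i)\<^sup>2\<close> occurs \<open>2 N\<close> times. All bounds of sums over jumps are reduced to this
  identity.\<close>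

lemma jumps_sum_quadratic:
  "(\<Sum>(i, j)\<in>jumps. (if i = j then \<alpha> * (x i)\<^sup>2 else 0) + \<beta> * ((x i)\<^sup>2 + (x j)\<^sup>2))
     = (\<alpha> + 2 * real N * \<beta>) * (\<Sum>i\<in>{1..N}. (x i)\<^sup>2)"
proof -
  have "(\<Sum>(i, j)\<in>jumps. (if i = j then \<alpha> * (x i)\<^sup>2 else 0) + \<beta> * ((x i)\<^sup>2 + (x j)\<^sup>2))
      = (\<Sum>i\<in>{1..N}. \<Sum>j\<in>{1..N}. (if i = j then \<alpha> * (x i)\<^sup>2 else 0)) 
        + \<beta> * ((\<Sum>i\<in>{1..N}. \<Sum>j\<in>{1..N}. (x i)\<^sup>2) + (\<Sum>i\<in>{1..N}. \<Sum>j\<in>{1..N}. (x j)\<^sup>2))"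
    by (simp add: jumps_def sum.cartesian_product[symmetric] sum.distrib sum_distrib_left distrib_left mult_ac)
  also have "(\<Sum>i\<in>{1..N}. \<Sum>j\<in>{1..N}. (if i = j then \<alpha> * (x i)\<^sup>2 else 0)) = \<alpha> * (\<Sum>i\<in>{1..N}. (x i)\<^sup>2)"
    by (simp add: sum_distrib_left)
  also have "(\<Sum>i\<in>{1..N}. \<Sum>j\<in>{1..N}. (x i)\<^sup>2) = real N * (\<Sum>i\<in>{1..N}. (x i)\<^sup>2)"
    by (simp add: sum_distrib_left)
  also have "(\<Sum>i\<in>{1..N}. \<Sum>j\<in>{1..N}. (x j)\<^sup>2) = real N * (\<Sum>i\<in>{1..N}. (x i)\<^sup>2)"
    by simp
  finally show ?thesis by (simp only: distrib_right mult_2 distrib_left mult.assoc mult.left_commute)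
qed

lemma pair_image_bound:
  fixes \<alpha> \<beta> B y z :: real
  assumes "0 \<le> \<alpha>" "\<alpha> \<le> B" "0 \<le> \<beta>" "\<beta> \<le> B" "0 \<le> y" "0 \<le> z"
  shows "(\<alpha> * y + \<beta> * z)\<^sup>2 \<le> 2 * B\<^sup>2 * (y\<^sup>2 + z\<^sup>2)"
proof -
  have "\<alpha> * y + \<beta> * z \<le> B * y + B * z" using assms by (intro add_mono mult_right_mono) auto
  hence "(\<alpha> * y + \<beta> * z)\<^sup>2 \<le> (B * y + B * z)\<^sup>2" using assms by (intro power_mono) auto
  also have "\<dots> = B\<^sup>2 * (y + z)\<^sup>2" by (simp add: power2_eq_square algebra_simps)
  also have "\<dots> \<le> B\<^sup>2 * (2 * (y\<^sup>2 + z\<^sup>2))"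
    using sum_squares_bound[of y z] by (intro mult_left_mono) (auto simp: power2_sum)
  finally show ?thesis by (simp add: algebra_simps)
qed

lemma square_increment_bound:
  assumes "(i, j) \<in> jumps" "x \<in> space S"
  shows "(\<Sum>k\<in>{1..N}. (jump (i, j) x k)\<^sup>2) - (\<Sum>k\<in>{1..N}. (x k)\<^sup>2)
     \<le> (if i = j then bnd\<^sup>2 * (x i)\<^sup>2 else 4 * bnd\<^sup>2 * ((x i)\<^sup>2 + (x j)\<^sup>2))"
proof -
  have x: "0 \<le> x i" "0 \<le> x j" using assms space_S by (auto simp: jumps_def)
  let ?p = "(grid N i, grid N j)"
  have "(c (grid N i) * x i)\<^sup>2 \<le> bnd\<^sup>2 * (x i)\<^sup>2"
    unfolding power_mult_distrib using c_nonneg bnd(3) by (intro mult_right_mono power_mono) auto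
  moreover have "(a1 ?p * x i + a2 ?p * x j)\<^sup>2 \<le> 2 * bnd\<^sup>2 * ((x i)\<^sup>2 + (x j)\<^sup>2)"
    by (intro pair_image_bound a1_nonneg a2_nonneg bnd x)
  moreover have "(a3 ?p * x i + a4 ?p * x j)\<^sup>2 \<le> 2 * bnd\<^sup>2 * ((x i)\<^sup>2 + (x j)\<^sup>2)"
    by (intro pair_image_bound a3_nonneg a4_nonneg bnd x)
  moreover have "0 \<le> (x i)\<^sup>2" "0 \<le> (x j)\<^sup>2" by auto
  ultimately show ?thesis
    unfolding separable_increment[OF assms(1), of "\<lambda>_ y. y\<^sup>2" x] by (cases "i = j"; simp; linarith)
qed

text \<open>The empirical second moment. Its expectation stays bounded uniformly in \<open>N\<close>, and it dominates all error terms.\<close>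

definition sq :: "(nat \<Rightarrow> real) \<Rightarrow> real" where
  "sq x = 1 / real N * (\<Sum>i\<in>{1..N}. (x i)\<^sup>2)"

lemma sq_nonneg: "0 \<le> sq x" by (simp add: sq_def sum_nonneg)

text \<open>The diagonal jumps contribute \<open>bnd ^ 3\<close>; an interaction has rate at most \<open>bnd / N\<close> and increases \<open>sq\<close> by at most
  \<open>4 \<cdot> bnd\<^sup>2 \<cdot> ((x i)\<^sup>2 + (x j)\<^sup>2) / N\<close>, and the double sum turns this into \<open>8 \<cdot> bnd ^ 3\<close>. The constant does not
  depend on \<open>N\<close>.\<close>

lemma generator_sq_bound:
  assumes x: "x \<in> space S"
  shows "L sq x \<le> 9 * bnd ^ 3 * sq x"
proof -
  have "L sq x \<le> (\<Sum>(i, j)\<in>jumps. (if i = j then (bnd ^ 3 / real N) * (x i)\<^sup>2 else 0)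
      + (4 * bnd ^ 3 / (real N)\<^sup>2) * ((x i)\<^sup>2 + (x j)\<^sup>2))"
    unfolding generator_eq
  proof (rule sum_mono, clarify)
    fix i j assume k: "(i, j) \<in> jumps"
    have "sq (jump (i, j) x) - sq x = 1 / real N * ((\<Sum>k\<in>{1..N}. (jump (i, j) x k)\<^sup>2) - (\<Sum>k\<in>{1..N}. (x k)\<^sup>2))"
      by (simp add: sq_def right_diff_distrib)
    also have "\<dots> \<le> 1 / real N * (if i = j then bnd\<^sup>2 * (x i)\<^sup>2 else 4 * bnd\<^sup>2 * ((x i)\<^sup>2 + (x j)\<^sup>2))"
      by (intro mult_left_mono square_increment_bound[OF k x]) auto
    finally have "rate (i, j) * (sq (jump (i, j) x) - sq x)
      \<le> rate (i, j) * (1 / real N * (if i = j then bnd\<^sup>2 * (x i)\<^sup>2 else 4 * bnd\<^sup>2 * ((x i)\<^sup>2 + (x j)\<^sup>2)))"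
      by (intro mult_left_mono rate_nonneg)
    also have "\<dots> \<le> (if i = j then bnd else bnd / real N) *
        (1 / real N * (if i = j then bnd\<^sup>2 * (x i)\<^sup>2 else 4 * bnd\<^sup>2 * ((x i)\<^sup>2 + (x j)\<^sup>2)))"
      using bnd by (intro mult_right_mono) (auto simp: rate_def intro!: divide_right_mono)
    also have "\<dots> \<le> (if i = j then (bnd ^ 3 / real N) * (x i)\<^sup>2 else 0)
      + (4 * bnd ^ 3 / (real N)\<^sup>2) * ((x i)\<^sup>2 + (x j)\<^sup>2)"
    proof -
      have "0 \<le> (4 * bnd ^ 3 / (real N)\<^sup>2) * ((x i)\<^sup>2 + (x j)\<^sup>2)" using bnd(1) by simp
      thus ?thesis by (cases "i = j") (simp_all add: power2_eq_square power3_eq_cube mult_ac)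
    qed
    finally show "rate (i, j) * (sq (jump (i, j) x) - sq x) \<le> \<dots>" .
  qed
  also have "\<dots> = (bnd ^ 3 / real N + 2 * real N * (4 * bnd ^ 3 / (real N)\<^sup>2)) * (\<Sum>i\<in>{1..N}. (x i)\<^sup>2)"
    by (rule jumps_sum_quadratic)
  also have "\<dots> = 9 * bnd ^ 3 * sq x"
    using N by (simp add: sq_def field_simps power2_eq_square)
  finally show ?thesis .
qed

text \<open>A weight for the finite system that dominates \<open>1\<close>, all coordinates and all products of two coordinates. Its
  dependence on \<open>N\<close> is harmless, because it is used only for integrability.\<close>

definition W :: "(nat \<Rightarrow> real) \<Rightarrow> real" where
  "W x = 1 + (\<Sum>i\<in>{1..N}. (x i)\<^sup>2)"

lemma W_jump:
  assumes k: "k \<in> jumps" and x: "x \<in> space S"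
  shows "W (jump k x) \<le> (1 + 5 * bnd\<^sup>2) * W x"
proof -
  obtain i j where ij: "k = (i, j)" by (cases k)
  let ?s = "\<Sum>k\<in>{1..N}. (x k)\<^sup>2"
  have m: "i \<in> {1..N}" "j \<in> {1..N}" using k by (auto simp: ij jumps_def)
  have "(x i)\<^sup>2 \<le> ?s" using m by (intro member_le_sum) auto
  moreover have "(x i)\<^sup>2 + (x j)\<^sup>2 \<le> ?s" if "i \<noteq> j"
    using m that sum_mono2[of "{1..N}" "{i, j}" "\<lambda>k. (x k)\<^sup>2"] by simp
  ultimately have "(if i = j then bnd\<^sup>2 * (x i)\<^sup>2 else 4 * bnd\<^sup>2 * ((x i)\<^sup>2 + (x j)\<^sup>2)) \<le> 4 * bnd\<^sup>2 * ?s"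
    by (auto intro!: mult_mono)
  hence "(\<Sum>l\<in>{1..N}. (jump k x l)\<^sup>2) - ?s \<le> 4 * bnd\<^sup>2 * ?s"
    using square_increment_bound[of i j x] k x by (simp add: ij)
  hence "W (jump k x) \<le> 1 + ?s + 4 * bnd\<^sup>2 * ?s" by (simp add: W_def)
  also have "\<dots> \<le> (1 + 5 * bnd\<^sup>2) * W x"
    by (simp add: W_def algebra_simps sum_nonneg add_nonneg_nonneg)
  finally show ?thesis .
qed

lemma W_measurable: "W \<in> borel_measurable S"
  unfolding W_def[abs_def] using coordinate_measurable by measurable

text \<open>The generator maps linear statistics to linear statistics. Exchanging the two summation indices in half of
  the interaction terms collects the coefficient of each \<open>x i\<close>, in which \<open>i\<close> occurs once as the first and once as the
  second partner.\<close>

lemma generator_empirical_density: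
  "L (\<lambda>x. empirical_density N x g) x
     = 1 / real N * (\<Sum>i\<in>{1..N}. x i * discrete_drift b c lam a1 a2 a3 a4 N g i)"
proof -
  define G where "G i = g (grid N i)" for i
  define p where "p i j = (grid N i, grid N j)" for i j
  have inc: "empirical_density N (jump (i, j) x) g - empirical_density N x g =
      1 / real N * (if i = j then (c (grid N i) - 1) * x i * G i
        else x i * ((a1 (p i j) - 1) * G i + a3 (p i j) * G j) + x j * (a2 (p i j) * G i + (a4 (p i j) - 1) * G j))"
    if "(i, j) \<in> jumps" for i j
  proof -
    have "empirical_density N (jump (i, j) x) g - empirical_density N x g
      = 1 / real N * ((\<Sum>k\<in>{1..N}. jump (i, j) x k * G k) - (\<Sum>k\<in>{1..N}. x k * G k))"
      by (simp add: empirical_density_def G_def right_diff_distrib)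
    also have "(\<Sum>k\<in>{1..N}. jump (i, j) x k * G k) - (\<Sum>k\<in>{1..N}. x k * G k)
      = (if i = j then (c (grid N i) - 1) * x i * G i
        else x i * ((a1 (p i j) - 1) * G i + a3 (p i j) * G j) + x j * (a2 (p i j) * G i + (a4 (p i j) - 1) * G j))"
      using separable_increment[OF that, of "\<lambda>k y. y * G k" x] by (auto simp: p_def algebra_simps)
    finally show ?thesis .
  qed
  let ?e = "\<lambda>x. empirical_density N x g"
  define A where "A i j = lam (p i j) * ((a1 (p i j) - 1) * G i + a3 (p i j) * G j)" for i j
  define B where "B i j = lam (p i j) * (a2 (p i j) * G i + (a4 (p i j) - 1) * G j)" for i j
  have "L ?e x = (\<Sum>i\<in>{1..N}. \<Sum>j\<in>{1..N}. rate (i, j) * (?e (jump (i, j) x) - ?e x))"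
    by (simp add: generator_eq jumps_def sum.cartesian_product)
  also have "\<dots> = (\<Sum>i\<in>{1..N}. 1 / real N * (b (grid N i) * ((c (grid N i) - 1) * x i * G i))
      + 1 / real N * (1 / real N * (\<Sum>j\<in>{1..N} - {i}. x i * A i j + x j * B i j)))"
  proof (intro sum.cong refl)
    fix i assume i: "i \<in> {1..N}"
    have "(\<Sum>j\<in>{1..N}. rate (i, j) * (?e (jump (i, j) x) - ?e x)) = rate (i, i) * (?e (jump (i, i) x) - ?e x)
        + (\<Sum>j\<in>{1..N} - {i}. rate (i, j) * (?e (jump (i, j) x) - ?e x))"
      using i by (intro sum.remove) auto
    also have "(\<Sum>j\<in>{1..N} - {i}. rate (i, j) * (?e (jump (i, j) x) - ?e x))
      = (\<Sum>j\<in>{1..N} - {i}. 1 / real N * (1 / real N * (x i * A i j + x j * B i j)))"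
      using i by (intro sum.cong) (auto simp: inc jumps_def rate_def p_def A_def B_def algebra_simps)
    finally show "(\<Sum>j\<in>{1..N}. rate (i, j) * (?e (jump (i, j) x) - ?e x))
      = 1 / real N * (b (grid N i) * ((c (grid N i) - 1) * x i * G i))
      + 1 / real N * (1 / real N * (\<Sum>j\<in>{1..N} - {i}. x i * A i j + x j * B i j))"
      using i by (simp add: inc jumps_def rate_def sum_distrib_left)
  qed
  also have "\<dots> = 1 / real N * ((\<Sum>i\<in>{1..N}. b (grid N i) * ((c (grid N i) - 1) * x i * G i))
      + 1 / real N * ((\<Sum>i\<in>{1..N}. \<Sum>j\<in>{1..N} - {i}. x i * A i j) + (\<Sum>i\<in>{1..N}. \<Sum>j\<in>{1..N} - {i}. x j * B i j)))"
    by (simp only: sum.distrib sum_distrib_left[symmetric] distrib_left)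
  also have "(\<Sum>i\<in>{1..N}. \<Sum>j\<in>{1..N} - {i}. x j * B i j) = (\<Sum>i\<in>{1..N}. \<Sum>j\<in>{1..N} - {i}. x i * B j i)"
    by (rule sum_off_diagonal_swap) simp
  also have "1 / real N * ((\<Sum>i\<in>{1..N}. b (grid N i) * ((c (grid N i) - 1) * x i * G i))
      + 1 / real N * ((\<Sum>i\<in>{1..N}. \<Sum>j\<in>{1..N} - {i}. x i * A i j) + (\<Sum>i\<in>{1..N}. \<Sum>j\<in>{1..N} - {i}. x i * B j i)))
    = 1 / real N * (\<Sum>i\<in>{1..N}. x i * (b (grid N i) * (c (grid N i) - 1) * G i
        + 1 / real N * (\<Sum>j\<in>{1..N} - {i}. A i j + B j i)))"
    by (simp add: sum.distrib sum_distrib_left distrib_left mult_ac)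
  also have "\<dots> = 1 / real N * (\<Sum>i\<in>{1..N}. x i * discrete_drift b c lam a1 a2 a3 a4 N g i)"
    by (intro arg_cong[where f = "(*) (1 / real N)"] sum.cong refl)
       (simp add: discrete_drift_def interaction_kernel_def A_def B_def G_def p_def algebra_simps sum.distrib)
  finally show ?thesis .
qed

lemma mean_squared_le_sq: "(1 / real N * (\<Sum>i\<in>{1..N}. x i))\<^sup>2 \<le> sq x"
proof -
  have "(\<Sum>i\<in>{1..N}. x i)\<^sup>2 \<le> real N * (\<Sum>i\<in>{1..N}. (x i)\<^sup>2)"
    using sum_squared_le_sum_of_squares[of "x" "{1..N}"] by (simp add: mult.commute)
  hence "(\<Sum>i\<in>{1..N}. x i)\<^sup>2 / (real N)\<^sup>2 \<le> real N * (\<Sum>i\<in>{1..N}. (x i)\<^sup>2) / (real N)\<^sup>2"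
    by (rule divide_right_mono) simp
  thus ?thesis using N by (simp add: sq_def power_mult_distrib power_divide power2_eq_square)
qed

lemma sq_measurable: "sq \<in> borel_measurable S"
  unfolding sq_def[abs_def] using coordinate_measurable by measurable

lemma sq_le_W: "\<bar>sq x\<bar> \<le> W x"
proof -
  have "1 / real N * (\<Sum>i\<in>{1..N}. (x i)\<^sup>2) \<le> 1 * (\<Sum>i\<in>{1..N}. (x i)\<^sup>2)"
    using N by (intro mult_right_mono) (auto simp: sum_nonneg)
  thus ?thesis using sq_nonneg[of x] by (simp add: sq_def W_def)
qed

lemma weighted_average_bound:
  assumes x: "x \<in> space S" and h: "\<And>i. i \<in> {1..N} \<Longrightarrow> \<bar>h i\<bar> \<le> d"
  shows "\<bar>1 / real N * (\<Sum>i\<in>{1..N}. x i * h i)\<bar> \<le> d * (1 / real N * (\<Sum>i\<in>{1..N}. x i))"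
proof -
  have "\<bar>\<Sum>i\<in>{1..N}. x i * h i\<bar> \<le> (\<Sum>i\<in>{1..N}. x i * d)"
    using h space_S[OF x] by (intro order_trans[OF sum_abs sum_mono]) (simp add: abs_mult mult_left_mono)
  hence "1 / real N * \<bar>\<Sum>i\<in>{1..N}. x i * h i\<bar> \<le> 1 / real N * (\<Sum>i\<in>{1..N}. x i * d)"
    by (intro mult_left_mono) auto
  thus ?thesis by (simp add: abs_mult sum_distrib_left[symmetric] mult_ac)
qed

lemma empirical_density_square_bound:
  assumes x: "x \<in> space S"
  shows "(empirical_density N x g)\<^sup>2 \<le> (norm g)\<^sup>2 * sq x"
proof -
  define p where "p = 1 / real N * (\<Sum>i\<in>{1..N}. x i)"
  have "\<bar>empirical_density N x g\<bar> \<le> norm g * p"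
    unfolding empirical_density_def p_def by (intro weighted_average_bound[OF x] abs_bcontfun_le_norm)
  from power_mono[OF this, of 2] have "(empirical_density N x g)\<^sup>2 \<le> (norm g)\<^sup>2 * p\<^sup>2"
    by (simp add: power_mult_distrib)
  also have "\<dots> \<le> (norm g)\<^sup>2 * sq x"
    unfolding p_def by (intro mult_left_mono mean_squared_le_sq) simp
  finally show ?thesis .
qed

text \<open>A jump changes one or two coordinates of an average over \<open>N\<close> urns, so its effect is of order \<open>1 / N\<close>.\<close>

lemma empirical_density_increment_bound:
  fixes g :: C01
  assumes k: "(i, j) \<in> jumps" and x: "x \<in> space S" and g: "\<And>u. \<bar>g u\<bar> \<le> Q"
  shows "(empirical_density N (jump (i, j) x) g - empirical_density N x g)\<^sup>2
     \<le> (if i = j then (bnd * Q / real N)\<^sup>2 * (x i)\<^sup>2 else 8 * (bnd * Q / real N)\<^sup>2 * ((x i)\<^sup>2 + (x j)\<^sup>2))"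
proof -
  have xi: "0 \<le> x i" "0 \<le> x j" using k space_S[OF x] by (auto simp: jumps_def)
  have Q: "0 \<le> Q" using g[of "grid N i"] by simp
  have bnd0: "0 \<le> bnd" using bnd(1) by simp
  define B where "B = bnd * Q / real N"
  have B: "0 \<le> B" using Q bnd0 by (simp add: B_def)
  let ?p = "(grid N i, grid N j)" and ?d = "empirical_density N (jump (i, j) x) g - empirical_density N x g"
  have one: "\<bar>\<alpha> - 1\<bar> \<le> bnd" if "0 \<le> \<alpha>" "\<alpha> \<le> bnd" for \<alpha> using that bnd(1) by linarith
  have d: "?d = 1 / real N * ((\<Sum>k\<in>{1..N}. jump (i, j) x k * g (grid N k)) - (\<Sum>k\<in>{1..N}. x k * g (grid N k)))"
    by (simp add: empirical_density_def right_diff_distrib)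
  have tb: "\<bar>\<alpha> * y * g u\<bar> \<le> bnd * y * Q" if "\<bar>\<alpha>\<bar> \<le> bnd" "0 \<le> y" for \<alpha> y u
    unfolding abs_mult using that g[of u] Q bnd0 by (intro mult_mono) auto
  show ?thesis
  proof (cases "i = j")
    case True
    have "?d = 1 / real N * ((c (grid N i) - 1) * x i * g (grid N i))"
      unfolding d separable_increment[OF k, of "\<lambda>k y. y * g (grid N k)"] using True by (simp add: algebra_simps)
    also have "\<bar>\<dots>\<bar> \<le> 1 / real N * (bnd * x i * Q)"
      unfolding abs_mult[of "1 / real N"] using xi
      by (intro mult_mono tb one c_nonneg bnd) (auto intro!: mult_nonneg_nonneg simp: Q bnd0)
    also have "\<dots> = B * x i" by (simp add: B_def)
    finally have "?d\<^sup>2 \<le> (B * x i)\<^sup>2" using B xi by (simp add: abs_le_square_iff[symmetric] abs_mult)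
    thus ?thesis using True by (simp only: power_mult_distrib B_def simp_thms if_True)
  next
    case False
    have "?d = 1 / real N * ((a1 ?p - 1) * x i * g (grid N i) + a2 ?p * x j * g (grid N i)
        + (a3 ?p * x i * g (grid N j) + (a4 ?p - 1) * x j * g (grid N j)))"
      unfolding d separable_increment[OF k, of "\<lambda>k y. y * g (grid N k)"] using False by (simp add: algebra_simps)
    also have "\<bar>\<dots>\<bar> \<le> 1 / real N * (2 * (bnd * x i * Q + bnd * x j * Q))"
    proof -
      have triangle: "\<bar>z1\<bar> \<le> A \<Longrightarrow> \<bar>z2\<bar> \<le> A' \<Longrightarrow> \<bar>z3\<bar> \<le> A \<Longrightarrow> \<bar>z4\<bar> \<le> A'
          \<Longrightarrow> \<bar>z1 + z2 + (z3 + z4)\<bar> \<le> 2 * (A + A')" for z1 z2 z3 z4 A A' :: real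
        unfolding abs_le_iff by auto
      have "\<bar>(a1 ?p - 1) * x i * g (grid N i)\<bar> \<le> bnd * x i * Q"
        by (intro tb one a1_nonneg bnd xi)
      moreover have "\<bar>a2 ?p * x j * g (grid N i)\<bar> \<le> bnd * x j * Q"
        using a2_nonneg bnd xi by (intro tb) auto
      moreover have "\<bar>a3 ?p * x i * g (grid N j)\<bar> \<le> bnd * x i * Q"
        using a3_nonneg bnd xi by (intro tb) auto
      moreover have "\<bar>(a4 ?p - 1) * x j * g (grid N j)\<bar> \<le> bnd * x j * Q"
        by (intro tb one a4_nonneg bnd xi)
      ultimately have "\<bar>(a1 ?p - 1) * x i * g (grid N i) + a2 ?p * x j * g (grid N i)
        + (a3 ?p * x i * g (grid N j) + (a4 ?p - 1) * x j * g (grid N j))\<bar>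
        \<le> 2 * (bnd * x i * Q + bnd * x j * Q)"
        by (rule triangle)
      thus ?thesis unfolding abs_mult[of "1 / real N"] by (intro mult_mono) simp_all
    qed
    also have "\<dots> = B * (2 * (x i + x j))" by (simp add: B_def algebra_simps add_divide_distrib)
    finally have "?d\<^sup>2 \<le> (B * (2 * (x i + x j)))\<^sup>2" using B xi by (simp add: abs_le_square_iff[symmetric] abs_mult)
    also have "\<dots> = B\<^sup>2 * (4 * (x i + x j)\<^sup>2)"
      by (simp only: power_mult_distrib power2_eq_square[of "2 :: real"])
    also have "\<dots> \<le> B\<^sup>2 * (8 * ((x i)\<^sup>2 + (x j)\<^sup>2))"
      using sum_squares_bound[of "x i" "x j"] by (intro mult_left_mono) (auto simp: power2_sum)
    finally show ?thesis using False by (simp add: B_def algebra_simps)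
  qed
qed

text \<open>There are \<open>N\<close> single jumps of rate of order \<open>1\<close> and \<open>N\<^sup>2\<close> interactions of rate of order \<open>1 / N\<close>, and the squared
  increments are of order \<open>1 / N\<^sup>2\<close>: the fluctuations are of order \<open>1 / N\<close>. The constant is \<open>1 + 2 \<cdot> 8\<close>.\<close>

lemma carre_du_champ_bound:
  fixes g :: C01
  assumes x: "x \<in> space S" and g: "\<And>u. \<bar>g u\<bar> \<le> Q"
  shows "(\<Sum>k\<in>jumps. rate k * (empirical_density N (jump k x) g - empirical_density N x g)\<^sup>2)
    \<le> 17 * bnd ^ 3 * Q\<^sup>2 / real N * sq x"
proof -
  let ?d = "\<lambda>k. (empirical_density N (jump k x) g - empirical_density N x g)\<^sup>2"
  let ?B = "(bnd * Q / real N)\<^sup>2"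
  have bnd0: "0 \<le> bnd" using bnd(1) by simp
  have "(\<Sum>k\<in>jumps. rate k * ?d k) \<le> (\<Sum>(i, j)\<in>jumps. (if i = j then (bnd * ?B) * (x i)\<^sup>2 else 0)
      + (8 * bnd * ?B / real N) * ((x i)\<^sup>2 + (x j)\<^sup>2))"
  proof (rule sum_mono, clarify)
    fix i j assume k: "(i, j) \<in> jumps"
    have "rate (i, j) * ?d (i, j) \<le> (if i = j then bnd else bnd / real N) *
        (if i = j then ?B * (x i)\<^sup>2 else 8 * ?B * ((x i)\<^sup>2 + (x j)\<^sup>2))"
      using bnd bnd0 rate_nonneg
      by (intro mult_mono empirical_density_increment_bound[OF k x g])
         (auto simp: rate_def intro!: divide_right_mono)
    also have "\<dots> \<le> (if i = j then (bnd * ?B) * (x i)\<^sup>2 else 0) + (8 * bnd * ?B / real N) * ((x i)\<^sup>2 + (x j)\<^sup>2)"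
      using bnd0 by (cases "i = j") (simp_all add: mult_ac)
    finally show "rate (i, j) * ?d (i, j) \<le> \<dots>" .
  qed
  also have "\<dots> = (bnd * ?B + 2 * real N * (8 * bnd * ?B / real N)) * (\<Sum>i\<in>{1..N}. (x i)\<^sup>2)"
    by (rule jumps_sum_quadratic)
  also have "\<dots> = 17 * bnd ^ 3 * Q\<^sup>2 / real N * sq x"
    using N by (simp add: sq_def field_simps power2_eq_square power3_eq_cube)
  finally show ?thesis .
qed

end

section \<open>The second moment of the urn process\<close>

text \<open>Initial values in \<open>{0, 1}\<close> bound all moments at time zero.\<close>

locale urn_process = urn_system b c lam a1 a2 a3 a4 N
  for b c lam a1 a2 a3 a4 N +
  fixes M :: "'a measure" and X :: "real \<Rightarrow> 'a \<Rightarrow> nat \<Rightarrow> real"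
  assumes markov: "markov_process_with_generator M (urn_states N) (urn_generator b c lam a1 a2 a3 a4 N) X"
    and init: "AE \<omega> in M. \<forall>i\<in>{1..N}. X 0 \<omega> i \<in> {0, 1}"
begin

lemma prob_space_M: "prob_space M" and X_measurable: "t \<ge> 0 \<Longrightarrow> X t \<in> M \<rightarrow>\<^sub>M S"
  using markov by (auto simp: markov_process_with_generator_def markov_process_def)

lemma generator_bdd_measurable:
  assumes f: "bdd_measurable S f"
  shows "bdd_measurable S (L f)"
proof -
  obtain B where B: "\<And>x. x \<in> space S \<Longrightarrow> \<bar>f x\<bar> \<le> B" using bdd_measurableE[OF f] by metis
  have Lf: "L f = (\<lambda>x. \<Sum>k\<in>jumps. rate k * (f (jump k x) - f x))" by (rule ext) (rule generator_eq)
  have fm: "f \<in> borel_measurable S" using f by (simp add: bdd_measurable_def)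
  have "L f \<in> borel_measurable S"
    unfolding Lf using fm measurable_compose[OF jump_measurable fm] by (intro borel_measurable_sum) auto
  moreover have "\<bar>L f x\<bar> \<le> (\<Sum>k\<in>jumps. rate k * (B + B))" if x: "x \<in> space S" for x
    unfolding Lf
  proof (rule order_trans[OF sum_abs sum_mono])
    fix k assume "k \<in> jumps"
    hence "jump k x \<in> space S" by (rule measurable_space[OF jump_measurable x])
    hence "\<bar>f (jump k x) - f x\<bar> \<le> B + B" using B[of "jump k x"] B[OF x] by linarith
    thus "\<bar>rate k * (f (jump k x) - f x)\<bar> \<le> rate k * (B + B)"
      unfolding abs_mult using rate_nonneg by (intro mult_mono) auto
  qed
  ultimately show ?thesis by (auto simp: bdd_measurable_def bounded_iff)
qed

lemma init_sum_squares: "AE \<omega> in M. (\<Sum>i\<in>{1..N}. (X 0 \<omega> i)\<^sup>2) \<le> real N"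
  using init
proof eventually_elim
  case (elim \<omega>)
  have "(\<Sum>i\<in>{1..N}. (X 0 \<omega> i)\<^sup>2) \<le> (\<Sum>i\<in>{1..N}. 1)"
  proof (rule sum_mono)
    fix i assume "i \<in> {1..N}"
    hence "X 0 \<omega> i = 0 \<or> X 0 \<omega> i = 1" using elim by blast
    thus "(X 0 \<omega> i)\<^sup>2 \<le> 1" by auto
  qed
  thus ?case by simp
qed

lemma W_square_init: "integrable M (\<lambda>\<omega>. (W (X 0 \<omega>))\<^sup>2)"
proof -
  interpret prob_space M by (rule prob_space_M)
  have "AE \<omega> in M. norm ((W (X 0 \<omega>))\<^sup>2) \<le> (1 + real N)\<^sup>2"
    using init_sum_squares
  proof eventually_elim
    case (elim \<omega>)
    have "0 \<le> W (X 0 \<omega>)" "W (X 0 \<omega>) \<le> 1 + real N" using elim by (auto simp: W_def sum_nonneg add_nonneg_nonneg)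
    thus ?case by (simp add: power_mono)
  qed
  thus ?thesis
    using measurable_compose[OF X_measurable[of 0] W_measurable]
    by (intro integrable_const_bound[of _ "(1 + real N)\<^sup>2"]) auto
qed

sublocale dominated_jump_dynamics M S X jumps rate jump L W "1 + 5 * bnd\<^sup>2"
proof (intro dominated_jump_dynamics.intro jump_dynamics.intro prob_space_M
    jump_dynamics_axioms.intro dominated_jump_dynamics_axioms.intro)
  show "finite jumps" by (simp add: jumps_def)
  show "((\<lambda>t. \<integral>\<omega>. f (X t \<omega>) \<partial>M) has_real_derivative (\<integral>\<omega>. L f (X t \<omega>) \<partial>M)) (at t within {0..})"
    if "bdd_measurable S f" "t \<ge> 0" for f t
    by (rule markov_generator_derivative[OF markov generator_bdd_measurable that])
  show "0 \<le> W x" for x by (simp add: W_def sum_nonneg add_nonneg_nonneg)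
qed (rule rate_nonneg jump_measurable X_measurable generator_eq W_measurable W_jump W_square_init | assumption | simp)+

text \<open>The initial value is at most \<open>1\<close> because the urns start with \<open>0\<close> or \<open>1\<close>, and the growth rate of
  \<open>generator_sq_bound\<close> does not depend on \<open>N\<close>; this is where uniformity in \<open>N\<close> comes from.\<close>

lemma sq_moment:
  assumes t: "0 \<le> t"
  shows "integrable M (\<lambda>\<omega>. sq (X t \<omega>))" and "(\<integral>\<omega>. sq (X t \<omega>) \<partial>M) \<le> exp (9 * bnd ^ 3 * t)"
proof -
  have int: "integrable M (\<lambda>\<omega>. sq (X s \<omega>))" if "s \<ge> 0" for s
    by (rule dominated_integrable[where C = 1]) (use sq_measurable sq_le_W that in auto)
  thus "integrable M (\<lambda>\<omega>. sq (X t \<omega>))" using t .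
  have "(\<integral>\<omega>. sq (X t \<omega>) \<partial>M) \<le> exp (9 * bnd ^ 3 * t) * (\<integral>\<omega>. sq (X 0 \<omega>) \<partial>M)"
  proof (rule gronwall_derivative[OF derivative_dominated[OF sq_measurable sq_le_W] _ t])
    fix s assume s: "0 \<le> s" "s \<le> t"
    have "(\<integral>\<omega>. L sq (X s \<omega>) \<partial>M) \<le> (\<integral>\<omega>. 9 * bnd ^ 3 * sq (X s \<omega>) \<partial>M)"
      using generator_sq_bound process_space[OF s(1)] int[OF s(1)] s
      by (intro integral_mono L_dominated_integrable sq_measurable sq_le_W) auto
    thus "(\<integral>\<omega>. L sq (X s \<omega>) \<partial>M) \<le> 9 * bnd ^ 3 * (\<integral>\<omega>. sq (X s \<omega>) \<partial>M)" by simp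
  qed
  also have "\<dots> \<le> exp (9 * bnd ^ 3 * t) * 1"
  proof (intro mult_left_mono)
    have "(\<integral>\<omega>. sq (X 0 \<omega>) \<partial>M) \<le> (\<integral>\<omega>. 1 \<partial>M)"
    proof (rule integral_mono_AE[OF int])
      show "AE \<omega> in M. sq (X 0 \<omega>) \<le> 1"
        using init_sum_squares
      proof eventually_elim
        case (elim \<omega>)
        thus ?case using N by (simp add: sq_def divide_le_eq_1)
      qed
    qed auto
    thus "(\<integral>\<omega>. sq (X 0 \<omega>) \<partial>M) \<le> 1" by (simp add: prob_space)
  qed simp
  finally show "(\<integral>\<omega>. sq (X t \<omega>) \<partial>M) \<le> exp (9 * bnd ^ 3 * t)" by simp
qed

lemma empirical_density_measurable: "(\<lambda>x. empirical_density N x g) \<in> borel_measurable S"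
  unfolding empirical_density_def using coordinate_measurable by measurable

lemma empirical_density_square_integrable:
  assumes t: "t \<ge> 0"
  shows "integrable M (\<lambda>\<omega>. (empirical_density N (X t \<omega>) g)\<^sup>2)"
proof (rule dominated_integrable[OF _ _ t])
  show "(\<lambda>x. (empirical_density N x g)\<^sup>2) \<in> borel_measurable S"
    using empirical_density_measurable by simp
  show "\<bar>(empirical_density N x g)\<^sup>2\<bar> \<le> (norm g)\<^sup>2 * W x" if "x \<in> space S" for x
    using empirical_density_square_bound[OF that, of g]
      mult_left_mono[OF order_trans[OF abs_ge_self sq_le_W], of "(norm g)\<^sup>2" x] by simp
qed

text \<open>The curve \<open>\<gamma>\<close> solves the backward equation, so the drift of the statistic of \<open>\<gamma> s\<close> is only the difference
  between \<open>discrete_drift\<close> and \<open>P1\<close>. The derivative of the mean square distance to the constant \<open>m\<close> therefore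
  consists of a term proportional to the drift error \<open>e\<close> and the term \<open>\<Gamma>\<close> of order \<open>1 / N\<close>, both multiplied by at
  most \<open>1 + sq\<close>, whose expectation is at most \<open>1 + R\<close>. Integration over \<open>[0, T]\<close> gives the bound.\<close>

lemma squared_error_bound:
  fixes \<gamma> :: "real \<Rightarrow> C01"
  assumes T: "0 \<le> T"
    and \<gamma>: "\<And>s. s \<in> {0..T} \<Longrightarrow> (\<gamma> has_vector_derivative - P1 b c lam a1 a2 a3 a4 (\<gamma> s)) (at s within {0..T})"
    and Q: "\<And>s. s \<in> {0..T} \<Longrightarrow> norm (\<gamma> s) \<le> Q"
    and e: "\<And>s i. s \<in> {0..T} \<Longrightarrow> i \<in> {1..N} \<Longrightarrow>
      \<bar>discrete_drift b c lam a1 a2 a3 a4 N (\<gamma> s) i - P1_fun b c lam a1 a2 a3 a4 (\<gamma> s) (grid N i)\<bar> \<le> e"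
  defines "R \<equiv> exp (9 * bnd ^ 3 * T)"
  shows "(\<integral>\<omega>. (empirical_density N (X T \<omega>) (\<gamma> T) - m)\<^sup>2 \<partial>M)
      \<le> (\<integral>\<omega>. (empirical_density N (X 0 \<omega>) (\<gamma> 0) - m)\<^sup>2 \<partial>M)
        + T * (2 * e * (Q + \<bar>m\<bar>) * (1 + R) + 17 * bnd ^ 3 * Q\<^sup>2 / real N * R)"
proof -
  let ?P = "P1_fun b c lam a1 a2 a3 a4" and ?D = "discrete_drift b c lam a1 a2 a3 a4 N"
  \<comment> \<open>The index \<open>0\<close> carries the constant observable \<open>1\<close> with coefficient \<open>- m\<close>, so that the distance to \<open>m\<close> is itself a linear combination.\<close>
  define I where "I = insert 0 {1..N}"
  define y :: "nat \<Rightarrow> (nat \<Rightarrow> real) \<Rightarrow> real" where "y i x = (if i = 0 then 1 else x i)" for i x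
  define \<alpha> where "\<alpha> s i = (if i = 0 then - m else \<gamma> s (grid N i) / real N)" for s and i :: nat
  define \<alpha>' where "\<alpha>' s i = (if i = 0 then 0 else - ?P (\<gamma> s) (grid N i) / real N)" for s and i :: nat
  have I: "finite I" by (simp add: I_def)
  have sumI: "(\<Sum>i\<in>I. f i) = f 0 + (\<Sum>i\<in>{1..N}. f i)" for f :: "nat \<Rightarrow> real"
    unfolding I_def by (subst sum.insert) auto
  have l: "(\<Sum>i\<in>I. \<alpha> s i * y i x) = empirical_density N x (\<gamma> s) - m" for s x
    unfolding sumI by (simp add: \<alpha>_def y_def empirical_density_def sum_distrib_left mult_ac)
  have l': "(\<Sum>i\<in>I. \<alpha>' s i * y i x) = - (1 / real N * (\<Sum>i\<in>{1..N}. x i * ?P (\<gamma> s) (grid N i)))" for s x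
    unfolding sumI by (simp add: \<alpha>'_def y_def sum_distrib_left sum_negf[symmetric] mult_ac)
  have ym: "y i \<in> borel_measurable S" if "i \<in> I" for i
    using that coordinate_measurable[of i] unfolding y_def[abs_def] I_def by (cases "i = 0") auto
  have yW: "\<bar>y i x * y j x\<bar> \<le> W x" if i: "i \<in> I" and j: "j \<in> I" for i j x
  proof -
    have sq: "(y k x)\<^sup>2 \<le> W x" if k: "k \<in> I" for k
    proof (cases "k = 0")
      case False
      hence "(x k)\<^sup>2 \<le> (\<Sum>i\<in>{1..N}. (x i)\<^sup>2)" using k by (intro member_le_sum) (auto simp: I_def)
      thus ?thesis using False by (simp add: y_def W_def)
    qed (simp add: y_def W_def sum_nonneg)
    have "2 * \<bar>y i x\<bar> * \<bar>y j x\<bar> \<le> (y i x)\<^sup>2 + (y j x)\<^sup>2" using sum_squares_bound[of "\<bar>y i x\<bar>" "\<bar>y j x\<bar>"] by simp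
    thus ?thesis using sq[OF i] sq[OF j] by (simp add: abs_mult)
  qed
  have \<alpha>d: "((\<lambda>s. \<alpha> s i) has_real_derivative \<alpha>' s i) (at s within {0..T})" if s: "s \<in> {0..T}" for s i
  proof (cases "i = 0")
    case False
    have "((\<lambda>s. \<gamma> s (grid N i)) has_real_derivative - ?P (\<gamma> s) (grid N i)) (at s within {0..T})"
      using bounded_linear.has_vector_derivative[OF bounded_linear_apply_bcontfun \<gamma>[OF s], of "grid N i"]
      by (simp add: has_real_derivative_iff_has_vector_derivative P1_apply)
    from DERIV_cdivide[OF this, of "real N"] False show ?thesis by (simp add: \<alpha>_def[abs_def] \<alpha>'_def)
  qed (simp add: \<alpha>_def \<alpha>'_def)
  define F where "F s x = (empirical_density N x (\<gamma> s) - m)\<^sup>2" for s x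
  define G where "G s x = 2 * (empirical_density N x (\<gamma> s) - m)
      * (1 / real N * (\<Sum>i\<in>{1..N}. x i * (?D (\<gamma> s) i - ?P (\<gamma> s) (grid N i))))
      + (\<Sum>k\<in>jumps. rate k * (empirical_density N (jump k x) (\<gamma> s) - empirical_density N x (\<gamma> s))\<^sup>2)" for s x
  have Geq: "G s = (\<lambda>x. 2 * (\<Sum>i\<in>I. \<alpha> s i * y i x) * ((\<Sum>i\<in>I. \<alpha>' s i * y i x) + L (\<lambda>x. \<Sum>i\<in>I. \<alpha> s i * y i x) x)
      + carre_du_champ (\<lambda>x. \<Sum>i\<in>I. \<alpha> s i * y i x) x)" for s
  proof
    fix x
    have "L (\<lambda>x. empirical_density N x (\<gamma> s) - m) x = L (\<lambda>x. empirical_density N x (\<gamma> s)) x"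
      by (simp add: generator_eq)
    thus "G s x = 2 * (\<Sum>i\<in>I. \<alpha> s i * y i x) * ((\<Sum>i\<in>I. \<alpha>' s i * y i x) + L (\<lambda>x. \<Sum>i\<in>I. \<alpha> s i * y i x) x)
      + carre_du_champ (\<lambda>x. \<Sum>i\<in>I. \<alpha> s i * y i x) x"
      unfolding l l' G_def carre_du_champ_def generator_empirical_density
      by (simp add: right_diff_distrib sum_subtractf)
  qed
  note smd = second_moment_derivative[where I = I and y = y and \<gamma> = \<alpha> and \<gamma>' = \<alpha>' and T = T, OF I ym yW \<alpha>d]
  have der: "((\<lambda>s. \<integral>\<omega>. F s (X s \<omega>) \<partial>M) has_real_derivative (\<integral>\<omega>. G s (X s \<omega>) \<partial>M)) (at s within {0..T})"
    and Gi: "integrable M (\<lambda>\<omega>. G s (X s \<omega>))" if s: "0 \<le> s" "s \<le> T" for s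
    using smd[of s] s unfolding Geq F_def l by auto
  have e0: "0 \<le> e" using e[of 0 1] T N by fastforce
  have Q0: "0 \<le> Q" using Q[of 0] T by (auto intro: order_trans[OF norm_ge_zero])
  define A where "A = 2 * e * (Q + \<bar>m\<bar>)"
  define B where "B = 17 * bnd ^ 3 * Q\<^sup>2 / real N"
  have A: "0 \<le> A" using e0 Q0 by (simp add: A_def)
  have B: "0 \<le> B" using bnd(1) by (simp add: B_def)
  have Gle: "G s x \<le> A * (1 + sq x) + B * sq x" if s: "s \<in> {0..T}" and x: "x \<in> space S" for s x
  proof -
    define p where "p = 1 / real N * (\<Sum>i\<in>{1..N}. x i)"
    have p: "0 \<le> p" "p\<^sup>2 \<le> sq x"
      using mean_squared_le_sq[of x] space_S[OF x] by (auto simp: p_def intro!: divide_nonneg_nonneg sum_nonneg)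
    note avg = weighted_average_bound[OF x, folded p_def]
    have double: "2 * v * w \<le> z" if "\<bar>v * w\<bar> \<le> z / 2" for v w z :: real
      using that by (auto simp: abs_le_iff mult.assoc)
    have g: "\<bar>\<gamma> s u\<bar> \<le> Q" for u using abs_bcontfun_le_norm[of "\<gamma> s" u] Q[OF s] by linarith
    have "\<bar>empirical_density N x (\<gamma> s) - m\<bar> \<le> Q * p + \<bar>m\<bar>"
      using avg[of "\<lambda>i. \<gamma> s (grid N i)" Q] g unfolding empirical_density_def by (smt (verit))
    moreover have "\<bar>1 / real N * (\<Sum>i\<in>{1..N}. x i * (?D (\<gamma> s) i - ?P (\<gamma> s) (grid N i)))\<bar> \<le> e * p"
      using e[OF s] by (intro avg) auto
    ultimately have "\<bar>(empirical_density N x (\<gamma> s) - m) * (1 / real N * (\<Sum>i\<in>{1..N}. x i * (?D (\<gamma> s) i - ?P (\<gamma> s) (grid N i))))\<bar>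
        \<le> (Q * p + \<bar>m\<bar>) * (e * p)"
      unfolding abs_mult[of "empirical_density N x (\<gamma> s) - m"]
      using Q0 p by (intro mult_mono) auto
    also have "\<dots> = e * (Q * p\<^sup>2 + \<bar>m\<bar> * p)" by (simp add: algebra_simps power2_eq_square)
    also have "\<dots> \<le> e * (Q * (1 + sq x) + \<bar>m\<bar> * (1 + sq x))"
    proof (intro mult_left_mono add_mono e0 Q0 abs_ge_zero)
      show "p\<^sup>2 \<le> 1 + sq x" using p by simp
      have "p \<le> 1 + p\<^sup>2" using sum_squares_bound[of p 1] p by simp
      thus "p \<le> 1 + sq x" using p by simp
    qed
    also have "\<dots> = A * (1 + sq x) / 2" by (simp add: A_def algebra_simps)
    finally have "2 * (empirical_density N x (\<gamma> s) - m) * (1 / real N * (\<Sum>i\<in>{1..N}. x i * (?D (\<gamma> s) i - ?P (\<gamma> s) (grid N i))))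
        \<le> A * (1 + sq x)"
      by (rule double)
    thus ?thesis
      unfolding G_def B_def using carre_du_champ_bound[OF x g] by (rule add_mono)
  qed
  have G_int: "(\<integral>\<omega>. G s (X s \<omega>) \<partial>M) \<le> A * (1 + R) + B * R" if s: "0 \<le> s" "s \<le> T" for s
  proof -
    have "(\<integral>\<omega>. G s (X s \<omega>) \<partial>M) \<le> (\<integral>\<omega>. A * (1 + sq (X s \<omega>)) + B * sq (X s \<omega>) \<partial>M)"
      using Gi[OF s] sq_moment(1)[OF s(1)] process_space[OF s(1)] s by (intro integral_mono Gle) auto
    also have "\<dots> = A * (1 + (\<integral>\<omega>. sq (X s \<omega>) \<partial>M)) + B * (\<integral>\<omega>. sq (X s \<omega>) \<partial>M)"
      using sq_moment(1)[OF s(1)] by (simp add: prob_space distrib_left)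
    also have "\<dots> \<le> A * (1 + R) + B * R"
    proof -
      have "exp (9 * bnd ^ 3 * s) \<le> R"
        unfolding R_def using s bnd(1) by (simp add: mult_left_mono)
      hence "(\<integral>\<omega>. sq (X s \<omega>) \<partial>M) \<le> R" using sq_moment(2)[OF s(1)] by simp
      thus ?thesis using A B by (intro add_mono mult_left_mono) auto
    qed
    finally show ?thesis .
  qed
  let ?C = "A * (1 + R) + B * R"
  have "(\<lambda>s. (\<integral>\<omega>. F s (X s \<omega>) \<partial>M) - ?C * s) T \<le> exp (0 * T) * (\<lambda>s. (\<integral>\<omega>. F s (X s \<omega>) \<partial>M) - ?C * s) 0"
  proof (rule gronwall_derivative[where u' = "\<lambda>s. (\<integral>\<omega>. G s (X s \<omega>) \<partial>M) - ?C", OF _ _ T])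
    show "((\<lambda>s. (\<integral>\<omega>. F s (X s \<omega>) \<partial>M) - ?C * s) has_real_derivative (\<integral>\<omega>. G s (X s \<omega>) \<partial>M) - ?C) (at s within {0..T})"
      if "0 \<le> s" "s \<le> T" for s
      using DERIV_diff[OF der[OF that] DERIV_cmult_Id[of ?C]] by simp
  qed (use G_int in auto)
  thus "(\<integral>\<omega>. (empirical_density N (X T \<omega>) (\<gamma> T) - m)\<^sup>2 \<partial>M)
      \<le> (\<integral>\<omega>. (empirical_density N (X 0 \<omega>) (\<gamma> 0) - m)\<^sup>2 \<partial>M)
        + T * (2 * e * (Q + \<bar>m\<bar>) * (1 + R) + 17 * bnd ^ 3 * Q\<^sup>2 / real N * R)"
    by (simp add: F_def A_def B_def mult.commute)
qed

end

section \<open>The initial state and the limit theorem\<close>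

text \<open>Expanding the square leaves only the diagonal terms and the constant.\<close>

lemma (in prob_space) uncorrelated_second_moment:
  fixes Z :: "'i \<Rightarrow> 'a \<Rightarrow> real"
  assumes I: "finite I" and Z: "\<And>i. i \<in> I \<Longrightarrow> Z i \<in> borel_measurable M"
    and bounded: "\<And>i. i \<in> I \<Longrightarrow> AE \<omega> in M. \<bar>Z i \<omega>\<bar> \<le> 1"
    and mean: "\<And>i. i \<in> I \<Longrightarrow> expectation (Z i) = 0"
    and uncorrelated: "\<And>i j. i \<in> I \<Longrightarrow> j \<in> I \<Longrightarrow> i \<noteq> j \<Longrightarrow> expectation (\<lambda>\<omega>. Z i \<omega> * Z j \<omega>) = 0"
  shows "expectation (\<lambda>\<omega>. ((\<Sum>i\<in>I. a i * Z i \<omega>) + \<delta>)\<^sup>2) \<le> (\<Sum>i\<in>I. (a i)\<^sup>2) + \<delta>\<^sup>2"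
proof -
  have Zi: "integrable M (Z i)" if "i \<in> I" for i
    using Z[OF that] bounded[OF that] by (intro integrable_const_bound[of _ 1]) auto
  have ZZb: "AE \<omega> in M. \<bar>Z i \<omega> * Z j \<omega>\<bar> \<le> 1" if "i \<in> I" "j \<in> I" for i j
    using bounded[OF that(1)] bounded[OF that(2)]
    by eventually_elim (simp add: abs_mult mult_le_one)
  have ZZ: "integrable M (\<lambda>\<omega>. Z i \<omega> * Z j \<omega>)" if "i \<in> I" "j \<in> I" for i j
    using Z[OF that(1)] Z[OF that(2)] ZZb[OF that] by (intro integrable_const_bound[of _ 1]) auto
  have "expectation (\<lambda>\<omega>. ((\<Sum>i\<in>I. a i * Z i \<omega>) + \<delta>)\<^sup>2)
    = expectation (\<lambda>\<omega>. (\<Sum>i\<in>I. \<Sum>j\<in>I. a i * a j * (Z i \<omega> * Z j \<omega>)) + (2 * \<delta> * (\<Sum>i\<in>I. a i * Z i \<omega>) + \<delta>\<^sup>2))"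
    by (intro Bochner_Integration.integral_cong refl) (simp add: power2_sum power2_eq_square[of "sum _ _"] sum_product mult_ac)
  also have "\<dots> = (\<Sum>i\<in>I. \<Sum>j\<in>I. a i * a j * expectation (\<lambda>\<omega>. Z i \<omega> * Z j \<omega>)) + (2 * \<delta> * (\<Sum>i\<in>I. a i * expectation (Z i)) + \<delta>\<^sup>2)"
    using Zi ZZ by (simp add: prob_space)
  also have "(\<Sum>i\<in>I. a i * expectation (Z i)) = 0" using mean by simp
  also have "(\<Sum>i\<in>I. \<Sum>j\<in>I. a i * a j * expectation (\<lambda>\<omega>. Z i \<omega> * Z j \<omega>)) \<le> (\<Sum>i\<in>I. (a i)\<^sup>2)"
  proof (rule sum_mono)
    fix i assume i: "i \<in> I"
    have "(\<Sum>j\<in>I. a i * a j * expectation (\<lambda>\<omega>. Z i \<omega> * Z j \<omega>)) = (\<Sum>j\<in>I. if j = i then (a i)\<^sup>2 * expectation (\<lambda>\<omega>. Z i \<omega> * Z i \<omega>) else 0)"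
      using uncorrelated[OF i] by (intro sum.cong) (auto simp: power2_eq_square)
    also have "\<dots> = (a i)\<^sup>2 * expectation (\<lambda>\<omega>. Z i \<omega> * Z i \<omega>)" using I i by simp
    also have "\<dots> \<le> (a i)\<^sup>2 * 1"
    proof (rule mult_left_mono)
      have "expectation (\<lambda>\<omega>. Z i \<omega> * Z i \<omega>) \<le> expectation (\<lambda>\<omega>. 1)"
        using ZZb[OF i i] by (intro integral_mono_AE ZZ i) auto
      thus "expectation (\<lambda>\<omega>. Z i \<omega> * Z i \<omega>) \<le> 1" by (simp add: prob_space)
    qed simp
    finally show "(\<Sum>j\<in>I. a i * a j * expectation (\<lambda>\<omega>. Z i \<omega> * Z j \<omega>)) \<le> (a i)\<^sup>2" by simp
  qed
  finally show ?thesis by simp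
qed

lemma (in prob_space) indep_vars_product_expectation:
  fixes Y :: "'i \<Rightarrow> 'a \<Rightarrow> real"
  assumes indep: "indep_vars (\<lambda>_. borel) Y I" and i: "i \<in> I" and j: "j \<in> I" and ne: "i \<noteq> j"
    and int: "integrable M (Y i)" "integrable M (Y j)"
  shows "expectation (\<lambda>\<omega>. Y i \<omega> * Y j \<omega>) = expectation (Y i) * expectation (Y j)"
proof -
  have "indep_vars (\<lambda>_. borel) Y {i, j}" using indep i j by (intro indep_vars_subset[OF indep]) auto
  hence "expectation (\<lambda>\<omega>. \<Prod>k\<in>{i, j}. Y k \<omega>) = (\<Prod>k\<in>{i, j}. expectation (Y k))"
    using int by (intro indep_vars_lebesgue_integral) auto
  thus ?thesis using ne by simp
qed

lemma (in prob_space) bernoulli_AE_and_mean: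
  fixes Y :: "'a \<Rightarrow> real"
  assumes Y[measurable]: "Y \<in> borel_measurable M"
    and one: "prob {\<omega> \<in> space M. Y \<omega> = 1} = p" and zero: "prob {\<omega> \<in> space M. Y \<omega> = 0} = 1 - p"
  shows "AE \<omega> in M. Y \<omega> \<in> {0, 1}" and "expectation Y = p"
proof -
  have "prob ({\<omega> \<in> space M. Y \<omega> = 1} \<union> {\<omega> \<in> space M. Y \<omega> = 0}) = 1"
    using one zero by (subst finite_measure_Union) auto
  hence "AE \<omega> in M. \<omega> \<in> {\<omega> \<in> space M. Y \<omega> = 1} \<union> {\<omega> \<in> space M. Y \<omega> = 0}" by (rule AE_prob_1)
  thus AE: "AE \<omega> in M. Y \<omega> \<in> {0, 1}" by eventually_elim auto
  have "expectation Y = expectation (indicator {\<omega> \<in> space M. Y \<omega> = 1})"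
    using AE AE_space by (intro integral_cong_AE) (auto simp: indicator_def elim!: eventually_elim2)
  thus "expectation Y = p" using one by simp
qed

text \<open>Weak law of large numbers for the Bernoulli initial state: the centred variables are uncorrelated, which gives
  the first term; the second is the deviation of the mean, a Riemann sum error when \<open>m\<close> is the integral of
  \<open>\<phi> \<cdot> g\<close>.\<close>

lemma initial_error_bound:
  fixes \<phi> g :: C01 and X0 :: "'a \<Rightarrow> nat \<Rightarrow> real"
  assumes M: "prob_space M" and N: "1 \<le> N"
    and Y: "\<And>i. i \<in> {1..N} \<Longrightarrow> (\<lambda>\<omega>. X0 \<omega> i) \<in> borel_measurable M"
    and indep: "prob_space.indep_vars M (\<lambda>_. borel) (\<lambda>i \<omega>. X0 \<omega> i) {1..N}"
    and one: "\<And>i. i \<in> {1..N} \<Longrightarrow> measure M {\<omega> \<in> space M. X0 \<omega> i = 1} = \<phi> (grid N i)"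
    and zero: "\<And>i. i \<in> {1..N} \<Longrightarrow> measure M {\<omega> \<in> space M. X0 \<omega> i = 0} = 1 - \<phi> (grid N i)"
  shows "(\<integral>\<omega>. (empirical_density N (X0 \<omega>) g - m)\<^sup>2 \<partial>M)
    \<le> (norm g)\<^sup>2 / real N + (1 / real N * (\<Sum>i=1..N. \<phi> (grid N i) * g (grid N i)) - m)\<^sup>2"
proof -
  interpret prob_space M by (rule M)
  define p where "p i = \<phi> (grid N i)" for i
  define Z where "Z i \<omega> = X0 \<omega> i - p i" for i \<omega>
  define \<delta> where "\<delta> = 1 / real N * (\<Sum>i=1..N. \<phi> (grid N i) * g (grid N i)) - m"
  note ber = bernoulli_AE_and_mean[OF Y one zero, folded p_def]
  have p01: "0 \<le> p i" "p i \<le> 1" if "i \<in> {1..N}" for i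
    using measure_nonneg[of M] one[OF that] zero[OF that] unfolding p_def by (metis, smt (verit) measure_nonneg)
  have bounded: "AE \<omega> in M. \<bar>Z i \<omega>\<bar> \<le> 1" if "i \<in> {1..N}" for i
    using ber(1)[OF that that that] by eventually_elim (use p01[OF that] in \<open>auto simp: Z_def\<close>)
  have Yi: "integrable M (\<lambda>\<omega>. X0 \<omega> i)" if "i \<in> {1..N}" for i
    using ber(1)[OF that that that] by (intro integrable_const_bound[of _ 1] Y that) auto
  have mean: "expectation (\<lambda>\<omega>. X0 \<omega> i) = p i" if "i \<in> {1..N}" for i using ber(2)[OF that that that] .
  have second_moment: "expectation (\<lambda>\<omega>. ((\<Sum>i\<in>{1..N}. g (grid N i) / real N * Z i \<omega>) + \<delta>)\<^sup>2)
      \<le> (\<Sum>i\<in>{1..N}. (g (grid N i) / real N)\<^sup>2) + \<delta>\<^sup>2"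
  proof (rule uncorrelated_second_moment)
    show "expectation (Z i) = 0" if "i \<in> {1..N}" for i
      using Yi[OF that] mean[OF that] by (simp add: Z_def[abs_def] prob_space)
    fix i j assume ij: "i \<in> {1..N}" "j \<in> {1..N}" "i \<noteq> j"
    have YY: "expectation (\<lambda>\<omega>. X0 \<omega> i * X0 \<omega> j) = p i * p j"
      using indep_vars_product_expectation[OF indep ij Yi[OF ij(1)] Yi[OF ij(2)]] mean ij by simp
    have YYi: "integrable M (\<lambda>\<omega>. X0 \<omega> i * X0 \<omega> j)"
    proof (rule integrable_const_bound[of _ 1])
      show "AE \<omega> in M. norm (X0 \<omega> i * X0 \<omega> j) \<le> 1"
        using ber(1)[OF ij(1) ij(1) ij(1)] ber(1)[OF ij(2) ij(2) ij(2)] by eventually_elim auto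
    qed (use Y ij in \<open>auto intro!: borel_measurable_times\<close>)
    have "expectation (\<lambda>\<omega>. Z i \<omega> * Z j \<omega>)
        = expectation (\<lambda>\<omega>. X0 \<omega> i * X0 \<omega> j - p j * X0 \<omega> i - p i * X0 \<omega> j + p i * p j)"
      by (simp add: Z_def algebra_simps)
    also have "\<dots> = 0" using YYi Yi ij by (simp add: YY mean prob_space algebra_simps)
    finally show "expectation (\<lambda>\<omega>. Z i \<omega> * Z j \<omega>) = 0" .
  qed (use Y bounded in \<open>auto simp: Z_def\<close>)
  have centred: "(\<Sum>i\<in>{1..N}. g (grid N i) / real N * Z i \<omega>) + \<delta> = empirical_density N (X0 \<omega>) g - m" for \<omega>
    by (simp add: \<delta>_def Z_def p_def empirical_density_def right_diff_distrib sum_subtractf sum_distrib_left mult_ac)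
  moreover have "(\<Sum>i\<in>{1..N}. (g (grid N i) / real N)\<^sup>2) \<le> (norm g)\<^sup>2 / real N"
  proof -
    have "(\<Sum>i\<in>{1..N}. (g (grid N i) / real N)\<^sup>2) \<le> (\<Sum>i\<in>{1..N}. (norm g / real N)\<^sup>2)"
      using abs_bcontfun_le_norm[of g]
      by (intro sum_mono) (simp add: power_divide divide_right_mono abs_le_square_iff[symmetric])
    thus ?thesis using N by (simp add: power_divide power2_eq_square)
  qed
  ultimately show ?thesis using second_moment unfolding centred \<delta>_def[symmetric] by linarith
qed

theorem theorem2p2:
  fixes b c \<phi> :: C01 and lam a1 a2 a3 a4 :: C0101
    and M :: "nat \<Rightarrow> 'a measure" and X :: "nat \<Rightarrow> real \<Rightarrow> 'a \<Rightarrow> nat \<Rightarrow> real"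
  assumes "\<And>u. 0 \<le> b u" and "\<And>u. 0 \<le> c u" and "\<And>p. 0 \<le> lam p"
    and "\<And>p. 0 \<le> a1 p" and "\<And>p. 0 \<le> a2 p" and "\<And>p. 0 \<le> a3 p" and "\<And>p. 0 \<le> a4 p"
    and markov: "\<And>N. 1 \<le> N \<Longrightarrow>
      markov_process_with_generator (M N) (urn_states N)
        (urn_generator b c lam a1 a2 a3 a4 N) (X N)"
    and indep: "\<And>N. 1 \<le> N \<Longrightarrow>
      prob_space.indep_vars (M N) (\<lambda>_. borel) (\<lambda>i \<omega>. X N 0 \<omega> i) {1..N}"
    and init_1: "\<And>N i. 1 \<le> i \<Longrightarrow> i \<le> N \<Longrightarrow>
      measure (M N) {\<omega> \<in> space (M N). X N 0 \<omega> i = 1} = \<phi> (grid N i)"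
    and init_0: "\<And>N i. 1 \<le> i \<Longrightarrow> i \<le> N \<Longrightarrow>
      measure (M N) {\<omega> \<in> space (M N). X N 0 \<omega> i = 0} = 1 - \<phi> (grid N i)"
  shows "\<exists>(\<mu> :: real \<Rightarrow> C01_dual) (\<rho> :: real \<Rightarrow> C01).
    unique_ivp_solution (P1_adjoint b c lam a1 a2 a3 a4) (density_functional \<phi>) \<mu> \<and>
    unique_ivp_solution (density_rhs b c lam a1 a2 a3 a4) \<phi> \<rho> \<and>
    (\<forall>t\<ge>0. \<forall>f :: C01.
       tendsto_L2 M (\<lambda>N \<omega>. empirical_density N (X N t \<omega>) f) (\<mu> t f) \<and>
       \<mu> t f = int01 (\<lambda>u. \<rho> t u * f u))"
proof -
  let ?P = "P1 b c lam a1 a2 a3 a4" and ?Q = "P1 b c lam a1 a3 a2 a4"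
  define \<mu> where "\<mu> t = density_functional \<phi> o\<^sub>L op_exp ?P t" for t
  define \<rho> where "\<rho> t = op_exp ?Q t \<phi>" for t
  have \<mu>: "unique_ivp_solution (P1_adjoint b c lam a1 a2 a3 a4) (density_functional \<phi>) \<mu>"
    unfolding P1_adjoint_def[abs_def] \<mu>_def[abs_def] by (rule unique_ivp_adjoint)
  have \<rho>: "unique_ivp_solution (density_rhs b c lam a1 a2 a3 a4) \<phi> \<rho>"
    unfolding density_rhs_eq_P1 \<rho>_def[abs_def] by (rule unique_ivp_op_exp)
  have density: "\<mu> t f = int01 (\<lambda>u. \<rho> t u * f u)" if "t \<ge> 0" for t f
    unfolding \<mu>_def \<rho>_def density_functional_op_exp[OF that, symmetric] by (rule density_functional_apply)
  have sys: "urn_system b c lam a1 a2 a3 a4 N" if "1 \<le> N" for N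
    using assms(1-7) that by unfold_locales
  have prob: "prob_space (M N)" and Xm: "\<And>t. t \<ge> 0 \<Longrightarrow> X N t \<in> M N \<rightarrow>\<^sub>M urn_states N" if "1 \<le> N" for N
    using markov[OF that] by (auto simp: markov_process_with_generator_def markov_process_def)
  have X0m: "(\<lambda>\<omega>. X N 0 \<omega> i) \<in> borel_measurable (M N)" if "1 \<le> N" "i \<in> {1..N}" for N i
    using measurable_compose[OF Xm[OF that(1) order_refl] urn_system.coordinate_measurable[OF sys[OF that(1)] that(2)]] .
  have proc: "urn_process b c lam a1 a2 a3 a4 N (M N) (X N)" if N: "1 \<le> N" for N
  proof (rule urn_process.intro[OF sys[OF N] urn_process_axioms.intro[OF markov[OF N]]])
    have "AE \<omega> in M N. X N 0 \<omega> i \<in> {0, 1}" if i: "i \<in> {1..N}" for i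
      using i init_1[of i N] init_0[of i N]
      by (intro prob_space.bernoulli_AE_and_mean(1)[OF prob[OF N] X0m[OF N i]]) auto
    thus "AE \<omega> in M N. \<forall>i\<in>{1..N}. X N 0 \<omega> i \<in> {0, 1}"
      by (intro AE_finite_allI) auto
  qed
  have conv: "tendsto_L2 M (\<lambda>N \<omega>. empirical_density N (X N t \<omega>) f) (\<mu> t f)" if t: "t \<ge> 0" for t f
  proof -
    \<comment> \<open>The test function is evolved backwards: it equals \<open>f\<close> at time \<open>t\<close>, and the expected statistic of \<open>\<gamma> s\<close> at time \<open>s\<close> is asymptotically constant in \<open>s\<close>.\<close>
    define \<gamma> where "\<gamma> s = op_exp ?P (t - s) f" for s
    have \<gamma>_der: "(\<gamma> has_vector_derivative - ?P (\<gamma> s)) (at s within {0..t})" for s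
      using bounded_linear.has_vector_derivative[OF blinfun.bounded_linear_left
          op_exp_backwards_derivative[of ?P t s "{0..t}"], of f]
      by (simp add: \<gamma>_def[abs_def] blinfun.minus_left)
    have \<gamma>t: "\<gamma> t = f" by (simp add: \<gamma>_def op_exp_0)
    have \<gamma>_cont: "continuous_on {0..t} \<gamma>"
      using has_vector_derivative_continuous[OF \<gamma>_der] by (simp add: continuous_on_eq_continuous_within)
    obtain Q where Q: "\<And>s. s \<in> {0..t} \<Longrightarrow> norm (\<gamma> s) \<le> Q"
      using compact_imp_bounded[OF compact_continuous_image[OF \<gamma>_cont compact_Icc]]
      unfolding bounded_iff by blast
    define m where "m = \<mu> t f"
    have m: "m = int01 (\<lambda>u. \<phi> u * \<gamma> 0 u)"
      by (simp add: m_def \<mu>_def \<gamma>_def density_functional_apply)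
    define E where "E N = (\<integral>\<omega>. (empirical_density N (X N t \<omega>) f - m)\<^sup>2 \<partial>M N)" for N
    define B where "B = urn_system.bnd b c lam a1 a2 a3 a4"
    define R where "R = exp (9 * B ^ 3 * t)"
    define \<delta> where "\<delta> N = 1 / real N * (\<Sum>i=1..N. \<phi> (grid N i) * \<gamma> 0 (grid N i)) - m" for N
    define rest where "rest N = (norm (\<gamma> 0))\<^sup>2 / real N + (\<delta> N)\<^sup>2 + t * (17 * B ^ 3 * Q\<^sup>2 * R) / real N" for N
    have drift: "\<forall>\<^sub>F N in sequentially. \<forall>s\<in>{0..t}. \<forall>i\<in>{1..N}.
        \<bar>discrete_drift b c lam a1 a2 a3 a4 N (\<gamma> s) i - P1_fun b c lam a1 a2 a3 a4 (\<gamma> s) (grid N i)\<bar> \<le> e" if "e > 0" for e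
      by (rule discrete_drift_tendsto[OF \<gamma>_cont that])
    have E_bound: "E N \<le> rest N + t * (2 * e * (Q + \<bar>m\<bar>) * (1 + R))"
      if N: "1 \<le> N" and e: "\<And>s i. s \<in> {0..t} \<Longrightarrow> i \<in> {1..N} \<Longrightarrow>
        \<bar>discrete_drift b c lam a1 a2 a3 a4 N (\<gamma> s) i - P1_fun b c lam a1 a2 a3 a4 (\<gamma> s) (grid N i)\<bar> \<le> e" for N e
    proof -
      interpret urn_process b c lam a1 a2 a3 a4 N "M N" "X N" by (rule proc[OF N])
      have "E N \<le> (\<integral>\<omega>. (empirical_density N (X N 0 \<omega>) (\<gamma> 0) - m)\<^sup>2 \<partial>M N)
          + t * (2 * e * (Q + \<bar>m\<bar>) * (1 + R) + 17 * B ^ 3 * Q\<^sup>2 / real N * R)"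
        using squared_error_bound[OF t \<gamma>_der Q e, of m] unfolding E_def \<gamma>t R_def B_def by simp
      also have "(\<integral>\<omega>. (empirical_density N (X N 0 \<omega>) (\<gamma> 0) - m)\<^sup>2 \<partial>M N) \<le> (norm (\<gamma> 0))\<^sup>2 / real N + (\<delta> N)\<^sup>2"
        unfolding \<delta>_def
        using init_1 init_0 by (intro initial_error_bound[OF prob[OF N] N X0m[OF N] indep[OF N]]) auto
      finally show ?thesis by (simp add: rest_def algebra_simps)
    qed
    have \<delta>: "\<delta> \<longlonglongrightarrow> 0"
    proof (rule tendstoI)
      fix e :: real assume e: "e > 0"
      \<comment> \<open>A single integrand, seen as a family over a one-point parameter set.\<close>
      have "continuous_on ({0} \<times> UNIV) (\<lambda>(k :: real, v). \<phi> v * \<gamma> 0 v)"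
        unfolding case_prod_unfold by (intro continuous_intros)
      from riemann_sums_uniform[OF _ this, of "e / 2"] e
      show "\<forall>\<^sub>F N in sequentially. dist (\<delta> N) 0 < e"
        by (auto simp: \<delta>_def m dist_real_def elim!: eventually_mono)
    qed
    have rest: "rest \<longlonglongrightarrow> 0"
    proof -
      have "(\<lambda>N. (norm (\<gamma> 0))\<^sup>2 / real N + (\<delta> N)\<^sup>2 + t * (17 * B ^ 3 * Q\<^sup>2 * R) / real N) \<longlonglongrightarrow> 0 + 0\<^sup>2 + 0"
        by (intro tendsto_add lim_const_over_n tendsto_power \<delta>)
      thus ?thesis by (simp add: rest_def[abs_def])
    qed
    have "E \<longlonglongrightarrow> 0"
    proof (rule tendstoI)
      fix \<eta> :: real assume \<eta>: "\<eta> > 0"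
      define C where "C = t * (2 * (Q + \<bar>m\<bar>) * (1 + R))"
      have "0 \<le> Q" using Q[of 0] t by (auto intro: order_trans[OF norm_ge_zero])
      hence C: "0 \<le> C" using t by (simp add: C_def R_def)
      \<comment> \<open>The summand \<open>1\<close> covers the case \<open>C = 0\<close>, which occurs for \<open>t = 0\<close>.\<close>
      define e where "e = \<eta> / 2 / (C + 1)"
      have e: "e > 0" using \<eta> C by (simp add: e_def)
      have "e * C \<le> e * (C + 1)" using e by (intro mult_left_mono) auto
      also have "\<dots> = \<eta> / 2" using C unfolding e_def by (intro nonzero_eq_divide_eq[THEN iffD1]) auto
      finally have eC: "e * C \<le> \<eta> / 2" .
      have "\<forall>\<^sub>F N in sequentially. rest N < \<eta> / 2"
        by (rule order_tendstoD(2)[OF rest]) (use \<eta> in simp)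
      with drift[OF e] eventually_ge_at_top[of 1]
      show "\<forall>\<^sub>F N in sequentially. dist (E N) 0 < \<eta>"
      proof eventually_elim
        case (elim N)
        have "E N \<le> rest N + t * (2 * e * (Q + \<bar>m\<bar>) * (1 + R))"
          using elim by (intro E_bound) auto
        also have "t * (2 * e * (Q + \<bar>m\<bar>) * (1 + R)) = e * C" by (simp add: C_def)
        finally have "E N < \<eta>" using eC elim by linarith
        moreover have "0 \<le> E N" unfolding E_def by (rule Bochner_Integration.integral_nonneg) simp
        ultimately show ?case by simp
      qed
    qed
    moreover have "(\<lambda>\<omega>. empirical_density N (X N t \<omega>) f) \<in> borel_measurable (M N)"
      "integrable (M N) (\<lambda>\<omega>. (empirical_density N (X N t \<omega>) f)\<^sup>2)" if N: "1 \<le> N" for N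
    proof -
      interpret urn_process b c lam a1 a2 a3 a4 N "M N" "X N" by (rule proc[OF N])
      show "(\<lambda>\<omega>. empirical_density N (X N t \<omega>) f) \<in> borel_measurable (M N)"
        using measurable_compose[OF process_measurable[OF t] empirical_density_measurable] .
      show "integrable (M N) (\<lambda>\<omega>. (empirical_density N (X N t \<omega>) f)\<^sup>2)"
        by (rule empirical_density_square_integrable[OF t])
    qed
    ultimately show ?thesis unfolding tendsto_L2_def E_def m_def by blast
  qed
  show ?thesis using \<mu> \<rho> density conv by blast
qed

end
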